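(* Let $A = \Bbbk Q_A/I_A$ and $B = \Bbbk Q_B/I_B$ be finite dimensional algebras, and let $C = \Bbbk Q_C/I_C$ be a finite dimensional algebra which is a Morita context algebra on $A$ and $B$, satisfying the following conditions: (1) $(Q_C)_0 = (Q_A)_0 \cup (Q_B)_0$ (disjoint union); (2) $(Q_C)_1 = (Q_A)_1 \cup (Q_B)_1 \cup \{\alpha_j\}_{j\in J} \cup \{\beta_k\}_{k\in K}$ (disjoint union), where each arrow $\alpha_j$ starts at a vertex of $Q_A$ and ends at a vertex of $Q_B$, and each arrow $\beta_k$ starts at a vertex of $Q_B$ and ends at a vertex of $Q_A$; (3) the ideal of $\Bbbk Q_C$ generated by $I_A$, $I_B$, all $\alpha\alpha_j$ and $\beta\beta_k$ with $\alpha\in (Q_A)_1$, $\beta\in (Q_B)_1$, and all $\alpha_j\beta_k$ and $\beta_k\alpha_j$, with $j\in J$, $k\in K$, is contained in $I_C$; (4) the subgroup $\mathcal{O} = \langle \mathrm{add}\,\mathrm{Orb}_{\Omega_A}(\Pi_A(\Omega_C(C_0))) \times \mathrm{add}\,\mathrm{Orb}_{\Omega_B}(\Pi_B(\Omega_C(C_0)))\rangle$ of $K_0(C)$ is finitely generated. Then $C$ is a syzygy finite algebra if and only if $A$ and $B$ are syzygy finite algebras.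
   Context: $\Bbbk$ is a field; quivers are finite and connected; $I_A, I_B, I_C$ are admissible ideals (an ideal $I$ of $\Bbbk Q$ is admissible if $J_Q^m\subset I\subset J_Q^2$ for some $m\ge 2$, $J_Q$ being the ideal generated by the arrows). Paths are composed from left to right. For an algebra $\Lambda$, $\mathrm{mod}\,\Lambda$ is the category of finitely generated right $\Lambda$-modules, identified for a bound quiver algebra $\Bbbk Q/I$ with finite dimensional representations of $Q$ bound by $I$. That $C$ is a Morita context algebra on $A$ and $B$ means that its diagonal corner algebras, for the idempotents given by the sums of the vertices of $Q_A$ and of $Q_B$, are $A$ and $B$ (i.e. $I_C\cap \Bbbk Q_A = I_A$ and $I_C\cap\Bbbk Q_B = I_B$). Modules over $A$ (resp. $B$) are regarded as $C$-modules supported on the vertices of $Q_A$ (resp. $Q_B$), with the arrows $\alpha_j,\beta_k$ acting as zero. The functors $\Pi_A:\mathrm{mod}\, C\to\mathrm{mod}\, A$ and $\Pi_B:\mathrm{mod}\, C\to \mathrm{mod}\, B$ restrict a representation of $Q_C$ to the vertices and arrows of $Q_A$, respectively $Q_B$. $\Omega_\Lambda(M)$ is the syzygy of $M$ (kernel of the projective cover). $C_0$ is the direct sum of a complete set of representatives of the isomorphism classes of simple $C$-modules. $\mathrm{Orb}_{\Omega_\Lambda}(M)=\{\Omega_\Lambda^n(M)\}_{n\ge 0}$. For a class $\mathcal{C}$ of modules, $\mathrm{add}\,\mathcal{C}$ is the full subcategory of finite direct sums of direct summands of modules in $\mathcal{C}$. $K_0(\Lambda)$ is the abelian group generated by the symbols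 $[M]$, $M\in\mathrm{mod}\,\Lambda$, modulo the relations $[M]=[M']+[M'']$ if $M\cong M'\oplus M''$ and $[P]=0$ for $P$ projective. For a class $\mathcal{C}$ of modules, $\langle\mathcal{C}\rangle$ is the subgroup generated by the classes of direct summands of modules of $\mathcal{C}$; thus $\mathcal{O}$ is the subgroup of $K_0(C)$ generated by the classes of the modules in $\mathrm{add}\,\mathrm{Orb}_{\Omega_A}(\Pi_A(\Omega_C(C_0)))$ and in $\mathrm{add}\,\mathrm{Orb}_{\Omega_B}(\Pi_B(\Omega_C(C_0)))$. $\bar\Omega:K_0(\Lambda)\to K_0(\Lambda)$ is the endomorphism $\bar\Omega([M])=[\Omega(M)]$. The algebra $\Lambda$ is syzygy finite if $K_0(\Lambda)$ is syzygy finite, i.e. there is $n\ge 0$ such that $\bar\Omega^n(K_0(\Lambda))$ is finitely generated (equivalently, only finitely many isomorphism classes of indecomposable modules occur as direct summands of modules $\Omega^n(M)$, $M\in\mathrm{mod}\,\Lambda$). *)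

theory Defs
  imports
    "HOL-Algebra.Algebra"
    "Graph_Theory.Graph_Theory"
    "Jordan_Normal_Form.Matrix"
    "Jordan_Normal_Form.Matrix_Kernel"
begin

section \<open>Quivers, path algebras and admissible ideals\<close>

definition quiver :: "('v, 'e) pre_digraph \<Rightarrow> bool" where
  "quiver Q \<longleftrightarrow> fin_digraph Q \<and> Digraph_Component.connected Q"

definition subquiver :: "('v, 'e) pre_digraph \<Rightarrow> ('v, 'e) pre_digraph \<Rightarrow> bool" where
  "subquiver Q' Q \<longleftrightarrow> verts Q' \<subseteq> verts Q \<and> arcs Q' \<subseteq> arcs Q \<and>
     (\<forall>a \<in> arcs Q'. tail Q' a = tail Q a \<and> head Q' a = head Q a)"

text \<open>A path is recorded as (source, arrows, target), the arrows being listed from left to right;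
  the trivial path at v is (v, [], v).\<close>

type_synonym ('v, 'e) path = "'v \<times> 'e list \<times> 'v"

definition paths :: "('v, 'e) pre_digraph \<Rightarrow> ('v, 'e) path set" where
  "paths Q = {(u, p, v). pre_digraph.awalk Q u p v}"

text \<open>The product of two paths with coefficient c; it vanishes unless the paths are composable.\<close>

fun path_times :: "('v, 'e) path \<Rightarrow> ('v, 'e) path \<Rightarrow> 'k::field \<Rightarrow> (('v, 'e) path \<Rightarrow>\<^sub>0 'k)" where
  "path_times (u, p, v) (v', q, w) c = (if v = v' then Poly_Mapping.single (u, p @ q, w) c else 0)"

definition palg_mult ::
  "(('v, 'e) path \<Rightarrow>\<^sub>0 'k::field) \<Rightarrow> (('v, 'e) path \<Rightarrow>\<^sub>0 'k) \<Rightarrow> (('v, 'e) path \<Rightarrow>\<^sub>0 'k)" where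
  "palg_mult f g = (\<Sum>x\<in>Poly_Mapping.keys f. \<Sum>y\<in>Poly_Mapping.keys g.
     path_times x y (Poly_Mapping.lookup f x * Poly_Mapping.lookup g y))"

definition path_algebra :: "('v, 'e) pre_digraph \<Rightarrow> (('v, 'e) path \<Rightarrow>\<^sub>0 'k::field) ring" where
  "path_algebra Q =
     \<lparr>carrier = {f. Poly_Mapping.keys f \<subseteq> paths Q},
      monoid.mult = palg_mult,
      monoid.one = (\<Sum>v\<in>verts Q. Poly_Mapping.single (v, [], v) 1),
      ring.zero = 0,
      ring.add = (+)\<rparr>"

text \<open>The library's notion of a (two-sided) ideal presupposes a ring; kQ is one.\<close>

lemma path_times_add: "path_times x y (c + d) = path_times x y c + path_times x y d"
  by (cases x; cases y) (auto simp: single_add)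

lemma path_times_0 [simp]: "path_times x y 0 = 0"
  by (cases x; cases y) auto

lemma palg_mult_superset:
  assumes "finite S" "Poly_Mapping.keys f \<subseteq> S" "finite T" "Poly_Mapping.keys g \<subseteq> T"
  shows "palg_mult f g = (\<Sum>x\<in>S. \<Sum>y\<in>T.
    path_times x y (Poly_Mapping.lookup f x * Poly_Mapping.lookup g y))"
proof -
  have "(\<Sum>y\<in>Poly_Mapping.keys g. path_times x y (Poly_Mapping.lookup f x * Poly_Mapping.lookup g y))
    = (\<Sum>y\<in>T. path_times x y (Poly_Mapping.lookup f x * Poly_Mapping.lookup g y))" for x
    by (rule sum.mono_neutral_left) (use assms in \<open>auto simp: in_keys_iff\<close>)
  then have "palg_mult f g = (\<Sum>x\<in>Poly_Mapping.keys f. \<Sum>y\<in>T.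
    path_times x y (Poly_Mapping.lookup f x * Poly_Mapping.lookup g y))"
    by (simp add: palg_mult_def)
  also have "\<dots> = (\<Sum>x\<in>S. \<Sum>y\<in>T.
    path_times x y (Poly_Mapping.lookup f x * Poly_Mapping.lookup g y))"
    by (rule sum.mono_neutral_left) (use assms in \<open>auto simp: in_keys_iff\<close>)
  finally show ?thesis .
qed

lemma palg_mult_add_left: "palg_mult (f + g) h = palg_mult f h + palg_mult g h"
proof -
  let ?S = "Poly_Mapping.keys f \<union> Poly_Mapping.keys g"
  have "Poly_Mapping.keys (f + g) \<subseteq> ?S" by (rule Poly_Mapping.keys_add)
  then show ?thesis
    by (subst (1 2 3) palg_mult_superset[of ?S _ "Poly_Mapping.keys h"])
       (auto simp: lookup_add distrib_right path_times_add sum.distrib)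
qed

lemma palg_mult_add_right: "palg_mult h (f + g) = palg_mult h f + palg_mult h g"
proof -
  let ?S = "Poly_Mapping.keys f \<union> Poly_Mapping.keys g"
  have "Poly_Mapping.keys (f + g) \<subseteq> ?S" by (rule Poly_Mapping.keys_add)
  then show ?thesis
    by (subst (1 2 3) palg_mult_superset[of "Poly_Mapping.keys h" _ ?S])
       (auto simp: lookup_add distrib_left path_times_add sum.distrib)
qed

lemma palg_mult_0 [simp]: "palg_mult 0 f = 0" "palg_mult f 0 = 0"
  by (auto simp: palg_mult_def)

lemma palg_mult_single:
  "palg_mult (Poly_Mapping.single x a) (Poly_Mapping.single y b) = path_times x y (a * b)"
  by (subst palg_mult_superset[of "{x}" _ "{y}"]) auto

lemma palg_mult_sum_left: "palg_mult (sum F A) g = (\<Sum>x\<in>A. palg_mult (F x) g)"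
  by (induction A rule: infinite_finite_induct) (auto simp: palg_mult_add_left)

lemma palg_mult_sum_right: "palg_mult g (sum F A) = (\<Sum>x\<in>A. palg_mult g (F x))"
  by (induction A rule: infinite_finite_induct) (auto simp: palg_mult_add_right)

lemma palg_induct:
  fixes f :: "'a \<Rightarrow>\<^sub>0 'b::comm_monoid_add"
  assumes "\<And>x c. x \<in> Poly_Mapping.keys f \<Longrightarrow> P (Poly_Mapping.single x c)" "P 0" "\<And>g h. P g \<Longrightarrow> P h \<Longrightarrow> P (g + h)"
  shows "P f"
proof -
  have e: "f = (\<Sum>x\<in>Poly_Mapping.keys f. Poly_Mapping.single x (Poly_Mapping.lookup f x))"
    by (rule poly_mapping_eqI) (auto simp: lookup_sum lookup_single when_def sum.delta in_keys_iff)
  have "finite A \<Longrightarrow> A \<subseteq> Poly_Mapping.keys f \<Longrightarrow> P (\<Sum>x\<in>A. Poly_Mapping.single x (Poly_Mapping.lookup f x))" for A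
    by (induction A rule: finite_induct) (auto simp: assms)
  then show ?thesis using e by (metis finite_keys order_refl)
qed

lemma palg_mult_assoc: "palg_mult (palg_mult f g) h = palg_mult f (palg_mult g h)"
proof (rule palg_induct[of f])
  fix x a
  show "palg_mult (palg_mult (Poly_Mapping.single x a) g) h = palg_mult (Poly_Mapping.single x a) (palg_mult g h)"
  proof (rule palg_induct[of g])
    fix y b
    show "palg_mult (palg_mult (Poly_Mapping.single x a) (Poly_Mapping.single y b)) h = palg_mult (Poly_Mapping.single x a) (palg_mult (Poly_Mapping.single y b) h)"
    proof (rule palg_induct[of h])
      fix z c
      show "palg_mult (palg_mult (Poly_Mapping.single x a) (Poly_Mapping.single y b)) (Poly_Mapping.single z c)
        = palg_mult (Poly_Mapping.single x a) (palg_mult (Poly_Mapping.single y b) (Poly_Mapping.single z c))"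
        by (cases x; cases y; cases z) (auto simp: palg_mult_single mult.assoc)
    qed (auto simp: palg_mult_add_right)
  qed (auto simp: palg_mult_add_left palg_mult_add_right)
qed (auto simp: palg_mult_add_left)

lemma keys_palg_mult:
  assumes "wf_digraph Q" "Poly_Mapping.keys f \<subseteq> paths Q" "Poly_Mapping.keys g \<subseteq> paths Q"
  shows "Poly_Mapping.keys (palg_mult f g) \<subseteq> paths Q"
proof -
  interpret wf_digraph Q by fact
  have *: "Poly_Mapping.keys (path_times x y c) \<subseteq> paths Q" if "x \<in> paths Q" "y \<in> paths Q" for x y and c :: 'c
    using that by (cases x; cases y) (auto simp: paths_def)
  show ?thesis unfolding palg_mult_def
    by (intro order.trans[OF keys_sum] UN_least *) (use assms in auto)
qed

lemma ring_path_algebra: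
  assumes "fin_digraph Q" shows "ring (path_algebra Q :: (('v,'e) path \<Rightarrow>\<^sub>0 'k::field) ring)" (is "ring ?R")
proof -
  interpret fin_digraph Q by fact
  have one: "palg_mult (\<Sum>v\<in>verts Q. Poly_Mapping.single (v, [], v) 1) f = f"
      "palg_mult f (\<Sum>v\<in>verts Q. Poly_Mapping.single (v, [], v) 1) = f"
    if "Poly_Mapping.keys f \<subseteq> paths Q" for f :: "('v,'e) path \<Rightarrow>\<^sub>0 'k"
  proof -
    have 1: "palg_mult (\<Sum>v\<in>verts Q. Poly_Mapping.single (v, [], v) 1) (Poly_Mapping.single x c) = Poly_Mapping.single x c"
      if "x \<in> paths Q" for x and c :: 'k
      using that by (cases x) (auto simp: palg_mult_sum_left palg_mult_single paths_def awalk_def sum.delta')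
    have 2: "palg_mult (Poly_Mapping.single x c) (\<Sum>v\<in>verts Q. Poly_Mapping.single (v, [], v) 1) = Poly_Mapping.single x c"
      if "x \<in> paths Q" for x and c :: 'k
      using that awlast_in_verts by (cases x) (auto simp: palg_mult_sum_right palg_mult_single paths_def sum.delta)
    show "palg_mult (\<Sum>v\<in>verts Q. Poly_Mapping.single (v, [], v) 1) f = f"
      by (rule palg_induct[of f]) (use 1 that in \<open>auto simp: palg_mult_add_right\<close>)
    show "palg_mult f (\<Sum>v\<in>verts Q. Poly_Mapping.single (v, [], v) 1) = f"
      by (rule palg_induct[of f]) (use 2 that in \<open>auto simp: palg_mult_add_left\<close>)
  qed
  show ?thesis
  proof (rule ringI)
    show "abelian_group ?R"
    proof (rule abelian_groupI)
      fix x assume "x \<in> carrier ?R"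
      then show "\<exists>y\<in>carrier ?R. y \<oplus>\<^bsub>?R\<^esub> x = \<zero>\<^bsub>?R\<^esub>"
        by (intro bexI[of _ "-x"]) (auto simp: path_algebra_def in_keys_iff subset_iff)
    qed (use Poly_Mapping.keys_add in \<open>fastforce simp: path_algebra_def ac_simps\<close>)+
    show "monoid ?R"
    proof (rule monoidI)
      have "Poly_Mapping.keys (\<Sum>v\<in>verts Q. Poly_Mapping.single (v, [], v) (1::'k)) \<subseteq> paths Q"
        by (intro order.trans[OF keys_sum] UN_least) (auto simp: paths_def awalk_def)
      then show "\<one>\<^bsub>?R\<^esub> \<in> carrier ?R" by (simp add: path_algebra_def)
    qed (auto simp: path_algebra_def palg_mult_assoc one keys_palg_mult[OF wf_digraph, THEN subsetD])
  qed (auto simp: path_algebra_def palg_mult_add_left palg_mult_add_right)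
qed

definition arrow :: "('v, 'e) pre_digraph \<Rightarrow> 'e \<Rightarrow> (('v, 'e) path \<Rightarrow>\<^sub>0 'k::field)" where
  "arrow Q a = Poly_Mapping.single (tail Q a, [a], head Q a) 1"

definition arrow_ideal :: "('v, 'e) pre_digraph \<Rightarrow> (('v, 'e) path \<Rightarrow>\<^sub>0 'k::field) set" where
  "arrow_ideal Q = Idl\<^bsub>path_algebra Q\<^esub> (arrow Q ` arcs Q)"

primrec ideal_power :: "('a, 'm) ring_scheme \<Rightarrow> 'a set \<Rightarrow> nat \<Rightarrow> 'a set" where
  "ideal_power R I 0 = carrier R"
| "ideal_power R I (Suc n) = ideal_prod R (ideal_power R I n) I"

definition admissible :: "('v, 'e) pre_digraph \<Rightarrow> (('v, 'e) path \<Rightarrow>\<^sub>0 'k::field) set \<Rightarrow> bool" where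
  "admissible Q I \<longleftrightarrow> ideal I (path_algebra Q) \<and>
     (\<exists>m\<ge>2. ideal_power (path_algebra Q) (arrow_ideal Q) m \<subseteq> I) \<and>
     I \<subseteq> ideal_power (path_algebra Q) (arrow_ideal Q) 2"

text \<open>The pair (Q, I) presents the finite dimensional algebra kQ/I.\<close>

definition bound_quiver :: "('v, 'e) pre_digraph \<Rightarrow> (('v, 'e) path \<Rightarrow>\<^sub>0 'k::field) set \<Rightarrow> bool" where
  "bound_quiver Q I \<longleftrightarrow> quiver Q \<and> admissible Q I"


section \<open>Representations bound by I, i.e. finitely generated right modules over kQ/I\<close>

text \<open>A representation puts the space of column vectors of length \<open>rdim M v\<close> at the vertex v and
  lets the arrow a act as the matrix \<open>rmap M a\<close>. Every finite dimensional representation is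
  isomorphic to one of this form. The values of \<open>rdim\<close> and \<open>rmap\<close> outside the quiver are
  irrelevant: representations differing only there are isomorphic in the sense below.\<close>

datatype ('v, 'e, 'k) rep = Rep (rdim: "'v \<Rightarrow> nat") (rmap: "'e \<Rightarrow> 'k mat")

text \<open>Action of a path; the leftmost arrow acts first, as for right modules.\<close>

primrec path_map ::
  "('v, 'e) pre_digraph \<Rightarrow> ('v, 'e, 'k::field) rep \<Rightarrow> 'v \<Rightarrow> 'e list \<Rightarrow> 'k mat" where
  "path_map Q M u [] = 1\<^sub>m (rdim M u)"
| "path_map Q M u (a # p) = path_map Q M (head Q a) p * rmap M a"

text \<open>The (u,v)-component of the action of an element f of the path algebra.\<close>

definition elem_map ::
  "('v, 'e) pre_digraph \<Rightarrow> ('v, 'e, 'k::field) rep \<Rightarrow> (('v, 'e) path \<Rightarrow>\<^sub>0 'k) \<Rightarrow> 'v \<Rightarrow> 'v \<Rightarrow> 'k mat"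
where
  "elem_map Q M f u v = mat (rdim M v) (rdim M u) (\<lambda>ij.
     \<Sum>p\<in>{p. (u, p, v) \<in> Poly_Mapping.keys f}.
       Poly_Mapping.lookup f (u, p, v) * path_map Q M u p $$ ij)"

definition modules ::
  "('v, 'e) pre_digraph \<Rightarrow> (('v, 'e) path \<Rightarrow>\<^sub>0 'k::field) set \<Rightarrow> ('v, 'e, 'k) rep set" where
  "modules Q I = {M.
     (\<forall>a\<in>arcs Q. rmap M a \<in> carrier_mat (rdim M (head Q a)) (rdim M (tail Q a))) \<and>
     (\<forall>f\<in>I. \<forall>u\<in>verts Q. \<forall>v\<in>verts Q. elem_map Q M f u v = 0\<^sub>m (rdim M v) (rdim M u))}"

definition homs :: "('v, 'e) pre_digraph \<Rightarrow> ('v, 'e, 'k::field) rep \<Rightarrow> ('v, 'e, 'k) rep \<Rightarrow>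
    ('v \<Rightarrow> 'k mat) set" where
  "homs Q M N = {f.
     (\<forall>v\<in>verts Q. f v \<in> carrier_mat (rdim N v) (rdim M v)) \<and>
     (\<forall>a\<in>arcs Q. f (head Q a) * rmap M a = rmap N a * f (tail Q a))}"

definition hom_comp :: "('v \<Rightarrow> 'k::field mat) \<Rightarrow> ('v \<Rightarrow> 'k mat) \<Rightarrow> 'v \<Rightarrow> 'k mat" where
  "hom_comp g f = (\<lambda>v. g v * f v)"

definition hom_eq :: "('v, 'e) pre_digraph \<Rightarrow> ('v \<Rightarrow> 'k::field mat) \<Rightarrow> ('v \<Rightarrow> 'k mat) \<Rightarrow> bool" where
  "hom_eq Q f g \<longleftrightarrow> (\<forall>v\<in>verts Q. f v = g v)"

definition id_hom :: "('v, 'e, 'k::field) rep \<Rightarrow> 'v \<Rightarrow> 'k mat" where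
  "id_hom M = (\<lambda>v. 1\<^sub>m (rdim M v))"

definition isomorphic ::
  "('v, 'e) pre_digraph \<Rightarrow> ('v, 'e, 'k::field) rep \<Rightarrow> ('v, 'e, 'k) rep \<Rightarrow> bool" where
  "isomorphic Q M N \<longleftrightarrow> (\<exists>f\<in>homs Q M N. \<exists>g\<in>homs Q N M.
     hom_eq Q (hom_comp g f) (id_hom M) \<and> hom_eq Q (hom_comp f g) (id_hom N))"

definition injective ::
  "('v, 'e) pre_digraph \<Rightarrow> ('v, 'e, 'k::field) rep \<Rightarrow> ('v \<Rightarrow> 'k mat) \<Rightarrow> bool" where
  "injective Q M f \<longleftrightarrow> (\<forall>v\<in>verts Q. inj_on (\<lambda>x. f v *\<^sub>v x) (carrier_vec (rdim M v)))"

definition surjective ::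
  "('v, 'e) pre_digraph \<Rightarrow> ('v, 'e, 'k::field) rep \<Rightarrow> ('v, 'e, 'k) rep \<Rightarrow> ('v \<Rightarrow> 'k mat) \<Rightarrow> bool" where
  "surjective Q M N f \<longleftrightarrow>
     (\<forall>v\<in>verts Q. (\<lambda>x. f v *\<^sub>v x) ` carrier_vec (rdim M v) = carrier_vec (rdim N v))"

definition zero_rep :: "('v, 'e, 'k::field) rep" where
  "zero_rep = Rep (\<lambda>_. 0) (\<lambda>_. 0\<^sub>m 0 0)"

definition dsum :: "('v, 'e) pre_digraph \<Rightarrow> ('v, 'e, 'k::field) rep \<Rightarrow> ('v, 'e, 'k) rep \<Rightarrow>
    ('v, 'e, 'k) rep" where
  "dsum Q M N = Rep (\<lambda>v. rdim M v + rdim N v)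
     (\<lambda>a. four_block_mat (rmap M a) (0\<^sub>m (rdim M (head Q a)) (rdim N (tail Q a)))
                         (0\<^sub>m (rdim N (head Q a)) (rdim M (tail Q a))) (rmap N a))"

definition dsum_list ::
  "('v, 'e) pre_digraph \<Rightarrow> ('v, 'e, 'k::field) rep list \<Rightarrow> ('v, 'e, 'k) rep" where
  "dsum_list Q Ms = foldr (dsum Q) Ms zero_rep"

definition is_summand :: "('v, 'e) pre_digraph \<Rightarrow> (('v, 'e) path \<Rightarrow>\<^sub>0 'k::field) set \<Rightarrow>
    ('v, 'e, 'k) rep \<Rightarrow> ('v, 'e, 'k) rep \<Rightarrow> bool" where
  "is_summand Q I N M \<longleftrightarrow> N \<in> modules Q I \<and> (\<exists>N'\<in>modules Q I. isomorphic Q M (dsum Q N N'))"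

definition add_class :: "('v, 'e) pre_digraph \<Rightarrow> (('v, 'e) path \<Rightarrow>\<^sub>0 'k::field) set \<Rightarrow>
    ('v, 'e, 'k) rep set \<Rightarrow> ('v, 'e, 'k) rep set" where
  "add_class Q I \<C> = {M \<in> modules Q I. \<exists>Ns.
     (\<forall>N\<in>set Ns. \<exists>Y\<in>\<C>. is_summand Q I N Y) \<and> isomorphic Q M (dsum_list Q Ns)}"

definition nonzero_rep :: "('v, 'e) pre_digraph \<Rightarrow> ('v, 'e, 'k::field) rep \<Rightarrow> bool" where
  "nonzero_rep Q M \<longleftrightarrow> (\<exists>v\<in>verts Q. rdim M v \<noteq> 0)"

definition simple :: "('v, 'e) pre_digraph \<Rightarrow> (('v, 'e) path \<Rightarrow>\<^sub>0 'k::field) set \<Rightarrow>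
    ('v, 'e, 'k) rep \<Rightarrow> bool" where
  "simple Q I S \<longleftrightarrow> S \<in> modules Q I \<and> nonzero_rep Q S \<and>
     (\<forall>N\<in>modules Q I. \<forall>f\<in>homs Q N S.
        nonzero_rep Q N \<and> injective Q N f \<longrightarrow> surjective Q N S f)"

definition complete_simples :: "('v, 'e) pre_digraph \<Rightarrow> (('v, 'e) path \<Rightarrow>\<^sub>0 'k::field) set \<Rightarrow>
    ('v, 'e, 'k) rep list \<Rightarrow> bool" where
  "complete_simples Q I Ss \<longleftrightarrow>
     (\<forall>S\<in>set Ss. simple Q I S) \<and>
     (\<forall>i<length Ss. \<forall>j<length Ss. isomorphic Q (Ss ! i) (Ss ! j) \<longrightarrow> i = j) \<and>
     (\<forall>S. simple Q I S \<longrightarrow> (\<exists>T\<in>set Ss. isomorphic Q S T))"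


section \<open>Projective covers and syzygies\<close>

definition projective :: "('v, 'e) pre_digraph \<Rightarrow> (('v, 'e) path \<Rightarrow>\<^sub>0 'k::field) set \<Rightarrow>
    ('v, 'e, 'k) rep \<Rightarrow> bool" where
  "projective Q I P \<longleftrightarrow> P \<in> modules Q I \<and>
     (\<forall>M\<in>modules Q I. \<forall>N\<in>modules Q I. \<forall>g\<in>homs Q M N. \<forall>f\<in>homs Q P N.
        surjective Q M N g \<longrightarrow> (\<exists>h\<in>homs Q P M. hom_eq Q (hom_comp g h) f))"

text \<open>A projective cover is an essential epimorphism from a projective module.\<close>

definition projective_cover :: "('v, 'e) pre_digraph \<Rightarrow> (('v, 'e) path \<Rightarrow>\<^sub>0 'k::field) set \<Rightarrow>
    ('v, 'e, 'k) rep \<Rightarrow> ('v \<Rightarrow> 'k mat) \<Rightarrow> ('v, 'e, 'k) rep \<Rightarrow> bool" where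
  "projective_cover Q I P \<pi> M \<longleftrightarrow>
     projective Q I P \<and> M \<in> modules Q I \<and> \<pi> \<in> homs Q P M \<and> surjective Q P M \<pi> \<and>
     (\<forall>L\<in>modules Q I. \<forall>h\<in>homs Q L P.
        surjective Q L M (hom_comp \<pi> h) \<longrightarrow> surjective Q L P h)"

definition is_kernel :: "('v, 'e) pre_digraph \<Rightarrow> ('v, 'e, 'k::field) rep \<Rightarrow> ('v \<Rightarrow> 'k mat) \<Rightarrow>
    ('v, 'e, 'k) rep \<Rightarrow> ('v \<Rightarrow> 'k mat) \<Rightarrow> bool" where
  "is_kernel Q N \<iota> P \<pi> \<longleftrightarrow> \<iota> \<in> homs Q N P \<and> injective Q N \<iota> \<and>
     (\<forall>v\<in>verts Q. (\<lambda>x. \<iota> v *\<^sub>v x) ` carrier_vec (rdim N v) = mat_kernel (\<pi> v))"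

text \<open>The syzygy is determined up to isomorphism only; a representative is chosen.\<close>

definition syzygy :: "('v, 'e) pre_digraph \<Rightarrow> (('v, 'e) path \<Rightarrow>\<^sub>0 'k::field) set \<Rightarrow>
    ('v, 'e, 'k) rep \<Rightarrow> ('v, 'e, 'k) rep" where
  "syzygy Q I M = (SOME N. N \<in> modules Q I \<and>
     (\<exists>P \<pi> \<iota>. projective_cover Q I P \<pi> M \<and> is_kernel Q N \<iota> P \<pi>))"

definition syzygy_orbit :: "('v, 'e) pre_digraph \<Rightarrow> (('v, 'e) path \<Rightarrow>\<^sub>0 'k::field) set \<Rightarrow>
    ('v, 'e, 'k) rep \<Rightarrow> ('v, 'e, 'k) rep set" where
  "syzygy_orbit Q I M = range (\<lambda>n. (syzygy Q I ^^ n) M)"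


section \<open>The group \<open>K\<^sub>0\<close> and syzygy finiteness\<close>

definition K0_relations :: "('v, 'e) pre_digraph \<Rightarrow> (('v, 'e) path \<Rightarrow>\<^sub>0 'k::field) set \<Rightarrow>
    (('v, 'e, 'k) rep \<Rightarrow>\<^sub>0 int) set" where
  "K0_relations Q I = generate (free_Abelian_group (modules Q I))
     ({frag_of M - (frag_of M' + frag_of M'') | M M' M''.
         M \<in> modules Q I \<and> M' \<in> modules Q I \<and> M'' \<in> modules Q I \<and>
         isomorphic Q M (dsum Q M' M'')} \<union>
      {frag_of P | P. projective Q I P})"

definition K0 :: "('v, 'e) pre_digraph \<Rightarrow> (('v, 'e) path \<Rightarrow>\<^sub>0 'k::field) set \<Rightarrow>
    (('v, 'e, 'k) rep \<Rightarrow>\<^sub>0 int) set monoid" where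
  "K0 Q I = free_Abelian_group (modules Q I) Mod K0_relations Q I"

definition K0_class :: "('v, 'e) pre_digraph \<Rightarrow> (('v, 'e) path \<Rightarrow>\<^sub>0 'k::field) set \<Rightarrow>
    ('v, 'e, 'k) rep \<Rightarrow> (('v, 'e, 'k) rep \<Rightarrow>\<^sub>0 int) set" where
  "K0_class Q I M = K0_relations Q I #>\<^bsub>free_Abelian_group (modules Q I)\<^esub> frag_of M"

definition Omega_bar :: "('v, 'e) pre_digraph \<Rightarrow> (('v, 'e) path \<Rightarrow>\<^sub>0 'k::field) set \<Rightarrow>
    (('v, 'e, 'k) rep \<Rightarrow>\<^sub>0 int) set \<Rightarrow> (('v, 'e, 'k) rep \<Rightarrow>\<^sub>0 int) set" where
  "Omega_bar Q I = (THE h. h \<in> hom (K0 Q I) (K0 Q I) \<and> h \<in> extensional (carrier (K0 Q I)) \<and>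
     (\<forall>M\<in>modules Q I. h (K0_class Q I M) = K0_class Q I (syzygy Q I M)))"

definition fin_gen_subgroup :: "('a, 'm) monoid_scheme \<Rightarrow> 'a set \<Rightarrow> bool" where
  "fin_gen_subgroup G H \<longleftrightarrow> (\<exists>S. finite S \<and> S \<subseteq> carrier G \<and> H = generate G S)"

definition syzygy_finite ::
  "('v, 'e) pre_digraph \<Rightarrow> (('v, 'e) path \<Rightarrow>\<^sub>0 'k::field) set \<Rightarrow> bool" where
  "syzygy_finite Q I \<longleftrightarrow>
     (\<exists>n. fin_gen_subgroup (K0 Q I) ((Omega_bar Q I ^^ n) ` carrier (K0 Q I)))"


section \<open>Restriction to and extension from a subquiver\<close>

definition restrict_rep ::
  "('v, 'e) pre_digraph \<Rightarrow> ('v, 'e, 'k::field) rep \<Rightarrow> ('v, 'e, 'k) rep" where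
  "restrict_rep Q' M = Rep (\<lambda>v. if v \<in> verts Q' then rdim M v else 0)
     (\<lambda>a. if a \<in> arcs Q' then rmap M a else 0\<^sub>m 0 0)"

text \<open>Extension by zero of a representation of Q' to the larger quiver Q.\<close>

definition extend_rep :: "('v, 'e) pre_digraph \<Rightarrow> ('v, 'e) pre_digraph \<Rightarrow>
    ('v, 'e, 'k::field) rep \<Rightarrow> ('v, 'e, 'k) rep" where
  "extend_rep Q Q' M =
     (let d = (\<lambda>v. if v \<in> verts Q' then rdim M v else 0)
      in Rep d (\<lambda>a. if a \<in> arcs Q' then rmap M a else 0\<^sub>m (d (head Q a)) (d (tail Q a))))"

definition orbit_subgroup ::
  "('v, 'e) pre_digraph \<Rightarrow> (('v, 'e) path \<Rightarrow>\<^sub>0 'k::field) set \<Rightarrow>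
   ('v, 'e) pre_digraph \<Rightarrow> (('v, 'e) path \<Rightarrow>\<^sub>0 'k) set \<Rightarrow>
   ('v, 'e) pre_digraph \<Rightarrow> (('v, 'e) path \<Rightarrow>\<^sub>0 'k) set \<Rightarrow>
   ('v, 'e, 'k) rep \<Rightarrow> (('v, 'e, 'k) rep \<Rightarrow>\<^sub>0 int) set set" where
  "orbit_subgroup QC IC QA IA QB IB C0 = generate (K0 QC IC)
     (K0_class QC IC ` extend_rep QC QA `
        add_class QA IA (syzygy_orbit QA IA (restrict_rep QA (syzygy QC IC C0))) \<union>
      K0_class QC IC ` extend_rep QC QB `
        add_class QB IB (syzygy_orbit QB IB (restrict_rep QB (syzygy QC IC C0))))"

end

theory Submission
  imports Defs "HOL-Library.Function_Algebras"
begin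

text \<open>The connecting arrows \<open>\<alpha>j\<close>, \<open>\<beta>k\<close> compose to zero with every arrow that ends at their source.
  Hence they annihilate the radical of every C-module (\<open>connecting_kills_rad\<close>). A syzygy is
  contained in the radical of a projective module, so every syzygy over C is the direct sum of an
  A-module and a B-module (\<open>syz_isum\<close>), and it is enough to follow the syzygies over C of modules
  that live on one side.

  Let E be an A-module and P its projective cover over C. The B-part of P is mapped to zero in E, so
  it lies in the radical, and the arrows from B back to A vanish on P. Therefore the A-part of P is
  the projective cover of E over A, and the A-part of \<open>\<Omega>\<^sub>C E\<close> is \<open>\<Omega>\<^sub>A E\<close> (\<open>syz_ext\<close>). The B-part of
  \<open>\<Omega>\<^sub>C E\<close> is the whole B-part of P. It depends on the top of E only, because a module and its top
  have the same projective cover; and the top is a sum of simple modules. So this B-part is a sum of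
  summands of \<open>\<Pi>\<^sub>B(\<Omega>\<^sub>C(C\<^sub>0))\<close>, and its class lies in the orbit subgroup O. In \<open>K\<^sub>0(C)\<close> this reads
  \<open>[\<Omega>\<^sub>C E] = [\<Omega>\<^sub>A E]\<close> modulo O (\<open>syz_ext_class\<close>). For E in an orbit the right-hand side is in O, so O is
  stable under the syzygy endomorphism (\<open>Om_orb\<close>), and \<open>[\<Omega>\<^sub>C\<^sup>n E] = [\<Omega>\<^sub>A\<^sup>n E]\<close> modulo O for all n
  (\<open>Om_pow_ext\<close>).

  If A and B are syzygy finite, then by the splitting of \<open>\<Omega>\<^sub>C M\<close> the classes of high syzygies over C
  lie in O plus the subgroups that come from high syzygies over A and over B
  (\<open>syzygy_finite_C\<close>). A projective A-module need not be projective over C, so \<open>[E]\<close> in \<open>K\<^sub>0(A)\<close> does not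
  determine \<open>[E]\<close> in \<open>K\<^sub>0(C)\<close>; but it determines \<open>[\<Omega>\<^sub>A E]\<close> in \<open>K\<^sub>0(C)\<close>, which costs one more syzygy
  (\<open>ext_syz_finite\<close>).

  Conversely, let C be syzygy finite. Restriction need not send projective C-modules to projective
  A-modules, but the failure is finitely generated: the A-part of a projective C-module is the sum
  of a projective A-module and of the A-part of the syzygy of a semisimple module
  (\<open>res_projective\<close>). Modulo the classes of the A-parts of the syzygies of the simple modules,
  restriction is therefore a map from \<open>K\<^sub>0(C)\<close> to \<open>K\<^sub>0(A)\<close>. It sends \<open>[\<Omega>\<^sub>A\<^sup>n E]\<close>, which is
  \<open>[\<Omega>\<^sub>C\<^sup>n E]\<close> up to an element of O, back to \<open>[\<Omega>\<^sub>A\<^sup>n E]\<close>,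
  and the image of O is finitely generated (\<open>syzygy_finite_A\<close>).

  As a subgroup of a finitely generated abelian group is finitely generated, all finiteness
  conditions amount to finding finitely many modules whose classes generate a subgroup that is large
  enough (\<open>fin_gen_subgroupD\<close>, \<open>fin_gen_subgroupI\<close>). Projective covers are obtained without a
  description of the indecomposable projective modules: long paths act as zero, which bounds the
  dimension of the essential extensions of a module, and an essential extension of largest dimension
  is projective (\<open>cover_exists\<close>).\<close>

section \<open>Finite dimensional linear algebra in sequence spaces\<close>

definition scal :: "'k::field \<Rightarrow> (nat \<Rightarrow> 'k) \<Rightarrow> nat \<Rightarrow> 'k" where
  "scal c x = (\<lambda>i. c * x i)"

lemma scal_apply: "scal c x i = c * x i"
  by (simp add: scal_def)

global_interpretation fv: vector_space "scal :: 'k::field \<Rightarrow> (nat \<Rightarrow> 'k) \<Rightarrow> nat \<Rightarrow> 'k"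
  by unfold_locales (auto simp: scal_apply fun_eq_iff algebra_simps)

global_interpretation fvp: vector_space_pair
  "scal :: 'k::field \<Rightarrow> (nat \<Rightarrow> 'k) \<Rightarrow> nat \<Rightarrow> 'k" "scal :: 'k::field \<Rightarrow> (nat \<Rightarrow> 'k) \<Rightarrow> nat \<Rightarrow> 'k" ..

abbreviation lin :: "((nat \<Rightarrow> 'k::field) \<Rightarrow> nat \<Rightarrow> 'k) \<Rightarrow> bool" where
  "lin F \<equiv> Vector_Spaces.linear scal scal F"

lemma lin_iff: "lin F \<longleftrightarrow> (\<forall>x y. F (x + y) = F x + F y) \<and> (\<forall>c x. F (scal c x) = scal c (F x))"
  unfolding Vector_Spaces.linear_iff using fv.vector_space_axioms by blast

lemma linI:
  assumes "\<And>x y. F (x + y) = F x + F y" "\<And>c x. F (scal c x) = scal c (F x)"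
  shows "lin F"
  unfolding lin_iff using assms by blast

lemmas lin_add = fvp.linear_add
  and lin_scal = fvp.linear_scale
  and lin_0 = fvp.linear_0
  and lin_diff = fvp.linear_diff
  and lin_sum = fvp.linear_sum

lemma lin_comp: "lin F \<Longrightarrow> lin G \<Longrightarrow> lin (\<lambda>x. G (F x))"
  unfolding lin_iff by simp

lemma lin_id: "lin (\<lambda>x. x)"
  unfolding lin_iff by simp

lemma lin_plus: "lin F \<Longrightarrow> lin G \<Longrightarrow> lin (\<lambda>x. F x + G x)"
  unfolding lin_iff by (simp add: fv.scale_right_distrib)

lemma lin_minus: "lin F \<Longrightarrow> lin G \<Longrightarrow> lin (\<lambda>x. F x - G x)"
  unfolding lin_iff by (simp add: fv.scale_right_diff_distrib)

lemma lin_zero: "lin (\<lambda>x. 0)"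
  unfolding lin_iff by simp

text \<open>The coordinate space of dimension n is realised inside one fixed space of sequences, so
  that spaces of all dimensions, and the linear maps between them, have the same type.\<close>

definition V :: "nat \<Rightarrow> (nat \<Rightarrow> 'k::field) set" where
  "V n = {x. \<forall>i\<ge>n. x i = 0}"

lemma subspace_V [simp]: "fv.subspace (V n)"
  by (auto simp: fv.subspace_def V_def scal_apply)

lemma V_closed [simp]:
  "0 \<in> V n" "x \<in> V n \<Longrightarrow> y \<in> V n \<Longrightarrow> x + y \<in> V n" "x \<in> V n \<Longrightarrow> y \<in> V n \<Longrightarrow> x - y \<in> V n"
  "x \<in> V n \<Longrightarrow> scal c x \<in> V n"
  by (auto simp: V_def scal_apply)

lemma V_zero [simp]: "V 0 = {0}"
  by (auto simp: V_def fun_eq_iff)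

definition unit :: "nat \<Rightarrow> nat \<Rightarrow> 'k::field" where
  "unit i = (\<lambda>j. if j = i then 1 else 0)"

lemma unit_in_V [simp]: "unit i \<in> V n \<longleftrightarrow> i < n"
  by (auto simp: unit_def V_def not_le[symmetric])

lemma V_expand: "x \<in> V n \<Longrightarrow> x = (\<Sum>i<n. scal (x i) (unit i))"
proof
  fix j assume "x \<in> V n"
  have s: "(\<Sum>i\<in>A. f i) j = (\<Sum>i\<in>A. f i j)" if "finite A" for A and f :: "nat \<Rightarrow> nat \<Rightarrow> 'k::field"
    using that by (induction A) auto
  show "x j = (\<Sum>i<n. scal (x i) (unit i)) j"
    using \<open>x \<in> V n\<close> by (auto simp: s scal_apply unit_def V_def sum.delta if_distrib cong: if_cong)
qed

lemma span_unit: "fv.span (unit ` {..<n}) = V n"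
proof
  show "fv.span (unit ` {..<n}) \<subseteq> V n"
    by (rule fv.span_minimal) auto
  show "V n \<subseteq> fv.span (unit ` {..<n} :: (nat \<Rightarrow> 'a) set)"
  proof
    fix x :: "nat \<Rightarrow> 'a" assume "x \<in> V n"
    then have "x = (\<Sum>i<n. scal (x i) (unit i))" by (rule V_expand)
    also have "\<dots> \<in> fv.span (unit ` {..<n})"
      by (intro fv.span_sum fv.span_scale fv.span_base) auto
    finally show "x \<in> fv.span (unit ` {..<n})" .
  qed
qed

lemma inj_unit: "inj unit"
  by (rule injI) (metis unit_def zero_neq_one)

lemma independent_unit: "fv.independent (unit ` {..<n})"
proof (induction n)
  case (Suc n)
  have "unit n \<notin> fv.span (unit ` {..<n} :: (nat \<Rightarrow> 'a) set)" by (simp add: span_unit)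
  from fv.independent_insertI[OF this Suc] show ?case unfolding lessThan_Suc image_insert .
qed (simp add: fv.independent_empty)

lemma card_unit: "card (unit ` {..<n} :: (nat \<Rightarrow> 'k::field) set) = n"
  by (simp add: card_image inj_on_subset[OF inj_unit])

lemma dim_V: "fv.dim (V n :: (nat \<Rightarrow> 'k::field) set) = n"
  using fv.dim_span_eq_card_independent[OF independent_unit[of n]]
  by (simp only: span_unit card_unit)

lemma sub_V_basis:
  assumes "fv.subspace W" "W \<subseteq> V n"
  obtains B where "B \<subseteq> W" "fv.independent B" "fv.span B = W" "finite B" "card B \<le> n"
proof -
  obtain B where B: "B \<subseteq> W" "fv.independent B" "W \<subseteq> fv.span B"
    using fv.maximal_independent_subset by blast
  have "finite B \<and> card B \<le> card (unit ` {..<n} :: (nat \<Rightarrow> 'a) set)"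
    by (rule fv.independent_span_bound) (use B assms in \<open>auto simp: span_unit\<close>)
  then show ?thesis using that B assms by (metis card_unit fv.span_subspace)
qed

text \<open>This is what turns a subspace, hence later a subrepresentation, into a coordinate space.\<close>

lemma subspace_coordinates:
  assumes "fv.subspace W" "W \<subseteq> V n"
  obtains m B where "m \<le> n" "lin B" "B ` V m = W" "inj_on B (V m)"
proof -
  obtain b where b: "b \<subseteq> W" "fv.independent b" "fv.span b = W" "finite b" "card b \<le> n"
    using sub_V_basis[OF assms] .
  let ?u = "unit ` {..<card b} :: (nat \<Rightarrow> 'a) set"
  have d: "fv.dim W = card b" using b fv.dim_span_eq_card_independent by metis
  have "\<exists>f. lin f \<and> f ` ?u = b \<and> f ` V (card b) = W \<and> inj_on f (V (card b))"
    by (rule fvp.finite_basis_to_basis_subspace_isomorphism)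
       (use b assms d in \<open>auto simp: dim_V independent_unit span_unit card_unit\<close>)
  then show ?thesis using that b by metis
qed

lemma left_inverse_on:
  assumes "lin F" "fv.subspace W" "inj_on F W"
  obtains G where "lin G" "range G \<subseteq> W" "\<And>x. x \<in> W \<Longrightarrow> G (F x) = x"
  using fvp.linear_exists_left_inverse_on[OF assms] by blast

lemma right_inverse_on:
  assumes "lin F" "fv.subspace W"
  obtains G where "lin G" "range G \<subseteq> W" "\<And>x. x \<in> F ` W \<Longrightarrow> F (G x) = x"
  using fvp.linear_exists_right_inverse_on[OF assms] by blast

lemma subspace_projection:
  assumes "fv.subspace W"
  obtains E where "lin E" "range E \<subseteq> W" "\<And>x. x \<in> W \<Longrightarrow> E x = x"
  using left_inverse_on[OF lin_id assms] by (auto simp: inj_on_def)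

lemma lin_inj_on_iff:
  assumes F: "lin F" and W: "fv.subspace W"
  shows "inj_on F W \<longleftrightarrow> (\<forall>x\<in>W. F x = 0 \<longrightarrow> x = 0)"
proof
  assume inj: "inj_on F W"
  have "0 \<in> W" by (rule fv.subspace_0[OF W])
  then show "\<forall>x\<in>W. F x = 0 \<longrightarrow> x = 0"
    using inj lin_0[OF F] by (metis inj_onD)
next
  assume r: "\<forall>x\<in>W. F x = 0 \<longrightarrow> x = 0"
  show "inj_on F W"
  proof (rule inj_onI)
    fix x y assume "x \<in> W" "y \<in> W" "F x = F y"
    then have "x - y \<in> W" "F (x - y) = 0"
      using fv.subspace_diff[OF W] lin_diff[OF F] by simp_all
    with r have "x - y = 0" by blast
    then show "x = y" by simp
  qed
qed

text \<open>Membership in a radical or in a submodule will be tested by linear maps.\<close>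

lemma subspace_separation:
  assumes "fv.subspace W" "x \<notin> W"
  obtains F where "lin F" "\<And>y. y \<in> W \<Longrightarrow> F y = 0" "F x \<noteq> 0"
proof -
  obtain E where E: "lin E" "range E \<subseteq> W" "\<And>x. x \<in> W \<Longrightarrow> E x = x"
    using subspace_projection[OF assms(1)] by blast
  show thesis
    by (rule that[of "\<lambda>y. y - E y"])
       (use E assms in \<open>auto intro!: lin_minus lin_id\<close>)
qed

lemma quotient_coordinates:
  assumes "fv.subspace W" "W \<subseteq> V n"
  obtains m C where "lin C" "C ` V n = V m" "\<And>x. x \<in> V n \<Longrightarrow> C x = 0 \<longleftrightarrow> x \<in> W"
proof -
  obtain E where E: "lin E" "range E \<subseteq> W" "\<And>x. x \<in> W \<Longrightarrow> E x = x"
    using subspace_projection[OF assms(1)] by blast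
  let ?F = "\<lambda>x. x - E x"
  have F: "lin ?F" by (intro lin_minus lin_id E)
  have sub: "fv.subspace (?F ` V n)" by (rule fvp.linear_subspace_image[OF F]) simp
  have "?F ` V n \<subseteq> V n" using E assms by (auto intro!: V_closed)
  from subspace_coordinates[OF sub this] obtain m B where
    B: "m \<le> n" "lin B" "B ` V m = ?F ` V n" "inj_on B (V m)" .
  obtain G where G: "lin G" "range G \<subseteq> V m" "\<And>x. x \<in> V m \<Longrightarrow> G (B x) = x"
    using left_inverse_on[OF B(2) subspace_V B(4)] by blast
  have BG: "B (G (?F x)) = ?F x" if "x \<in> V n" for x
  proof -
    have "?F x \<in> B ` V m" using that B(3) by blast
    then show ?thesis using G by fastforce
  qed
  show thesis
  proof (rule that[of "\<lambda>x. G (?F x)" m])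
    show "lin (\<lambda>x. G (?F x))" by (rule lin_comp[OF F G(1)])
    have "(\<lambda>x. G (?F x)) ` V n = G ` (B ` V m)" by (simp only: B(3) image_image)
    also have "\<dots> = V m" using G by (auto simp: image_image)
    finally show "(\<lambda>x. G (?F x)) ` V n = V m" .
    show "G (?F x) = 0 \<longleftrightarrow> x \<in> W" if "x \<in> V n" for x
    proof
      assume "G (?F x) = 0"
      then have "?F x = 0" using BG[OF that] lin_0[OF B(2)] by simp
      then have "x = E x" by simp
      then show "x \<in> W" using E(2) by (metis rangeI subsetD)
    next
      assume "x \<in> W"
      then show "G (?F x) = 0" using E(3) lin_0[OF G(1)] by simp
    qed
  qed
qed

lemma inj_dim_le:
  assumes "lin F" "F ` V m \<subseteq> V n" "inj_on F (V m)"
  shows "m \<le> n" "m = n \<Longrightarrow> F ` V m = V n"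
proof -
  let ?u = "unit ` {..<m} :: (nat \<Rightarrow> 'a) set"
  have "?u \<subseteq> V m" by auto
  have i: "fv.independent (F ` ?u)"
    by (rule fvp.linear_independent_injective_image[OF assms(1) independent_unit])
       (simp only: span_unit assms(3))
  have c: "card (F ` ?u) = m"
    using card_image[OF inj_on_subset[OF assms(3), of ?u]] \<open>?u \<subseteq> V m\<close> by (simp only: card_unit)
  have s: "F ` ?u \<subseteq> V n" using assms(2) \<open>?u \<subseteq> V m\<close> by blast
  have "finite (F ` ?u) \<and> card (F ` ?u) \<le> card (unit ` {..<n} :: (nat \<Rightarrow> 'a) set)"
    by (rule fv.independent_span_bound[OF _ i]) (simp_all only: span_unit s finite_imageI finite_lessThan)
  then show "m \<le> n" by (simp only: c card_unit)
  assume mn: "m = n"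
  show "F ` V m = V n"
  proof (rule ccontr)
    assume "F ` V m \<noteq> V n"
    then obtain y where y: "y \<in> V n" "y \<notin> F ` V m" using assms(2) by blast
    have "F ` V m = fv.span (F ` ?u)" using assms(1) by (simp only: fvp.linear_span_image span_unit)
    with y(2) have ys: "y \<notin> fv.span (F ` ?u)" by metis
    then have i': "fv.independent (insert y (F ` ?u))" by (rule fv.independent_insertI) (rule i)
    have "y \<notin> F ` ?u" using ys fv.span_superset[of "F ` ?u"] by blast
    then have c': "card (insert y (F ` ?u)) = Suc n"
      using card_insert_disjoint[OF finite_imageI[OF finite_imageI[OF finite_lessThan]], of y F unit m] c mn
      by metis
    have "card (insert y (F ` ?u)) \<le> card (unit ` {..<n} :: (nat \<Rightarrow> 'a) set)"
      using fv.independent_span_bound[OF _ i', of "unit ` {..<n}"] s y(1)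
      by (simp only: span_unit finite_imageI finite_lessThan insert_subset)
    then show False by (simp only: c' card_unit)
  qed
qed

lemma surj_dim_le:
  assumes "lin F" "F ` V m = V n"
  shows "n \<le> m" "m = n \<Longrightarrow> inj_on F (V m)"
proof -
  obtain G where G: "lin G" "range G \<subseteq> V m" "\<And>x. x \<in> F ` V m \<Longrightarrow> F (G x) = x"
    using right_inverse_on[OF assms(1) subspace_V] by blast
  have inj: "inj_on G (V n)" by (rule inj_on_inverseI[of _ F]) (use G assms in auto)
  show "n \<le> m" by (rule inj_dim_le[OF G(1) _ inj]) (use G in auto)
  assume "m = n"
  then have "G ` V n = V m" using inj_dim_le(2)[OF G(1) _ inj, of m] G(2) by blast
  moreover have "F (G x) = x" if "x \<in> V n" for x using G(3) that assms(2) by blast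
  ultimately show "inj_on F (V m)" by (intro inj_on_inverseI[of _ G]) (metis imageE)
qed

lemma spanning_card:
  assumes "V n \<subseteq> fv.span S" "finite S"
  shows "n \<le> card S"
  using fv.dim_le_card[OF assms] by (simp only: dim_V)

section \<open>Representations as families of linear maps\<close>

text \<open>Matrices of all formats act on the same space of sequences.\<close>

definition mact :: "'k::field mat \<Rightarrow> (nat \<Rightarrow> 'k) \<Rightarrow> nat \<Rightarrow> 'k" where
  "mact A x = (\<lambda>i. if i < dim_row A then \<Sum>j<dim_col A. A $$ (i, j) * x j else 0)"

lemma lin_mact [simp]: "lin (mact A)"
  by (rule linI) (auto simp: mact_def scal_apply fun_eq_iff sum.distrib algebra_simps sum_distrib_left)

lemma mact_in_V: "A \<in> carrier_mat n m \<Longrightarrow> mact A x \<in> V n"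
  by (auto simp: mact_def V_def)

lemma mact_mult:
  assumes "A \<in> carrier_mat n m" "B \<in> carrier_mat m l"
  shows "mact (A * B) x = mact A (mact B x)"
proof
  fix i
  show "mact (A * B) x i = mact A (mact B x) i"
  proof (cases "i < n")
    case True
    have "mact (A * B) x i = (\<Sum>k<l. (\<Sum>j<m. A $$ (i, j) * B $$ (j, k)) * x k)"
      using True assms by (auto simp: mact_def scalar_prod_def lessThan_atLeast0 intro!: sum.cong)
    also have "\<dots> = (\<Sum>k<l. \<Sum>j<m. A $$ (i, j) * (B $$ (j, k) * x k))"
      by (simp add: sum_distrib_right mult.assoc)
    also have "\<dots> = (\<Sum>j<m. \<Sum>k<l. A $$ (i, j) * (B $$ (j, k) * x k))"
      by (rule sum.swap)
    also have "\<dots> = mact A (mact B x) i"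
      using True assms by (auto simp: mact_def sum_distrib_left intro!: sum.cong)
    finally show ?thesis .
  qed (use assms in \<open>auto simp: mact_def\<close>)
qed

lemma mact_one: "x \<in> V n \<Longrightarrow> mact (1\<^sub>m n) x = x"
  by (auto simp: mact_def V_def fun_eq_iff one_mat_def if_distrib[of "\<lambda>c. c * _"] sum.delta cong: if_cong)

lemma mact_zero [simp]: "mact (0\<^sub>m n m) x = 0"
  by (auto simp: mact_def fun_eq_iff)

lemma mact_unit:
  assumes "A \<in> carrier_mat n m" "j < m" "i < n"
  shows "mact A (unit j) i = A $$ (i, j)"
proof -
  have "mact A (unit j) i = (\<Sum>k<m. A $$ (i, k) * unit j k)"
    using assms by (simp add: mact_def)
  also have "\<dots> = (\<Sum>k<m. if k = j then A $$ (i, k) else 0)"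
    by (rule sum.cong) (auto simp: unit_def)
  finally show ?thesis using assms by (simp add: sum.delta)
qed

lemma mat_eq_iff_mact:
  assumes "A \<in> carrier_mat n m" "B \<in> carrier_mat n m"
  shows "A = B \<longleftrightarrow> (\<forall>x\<in>V m. mact A x = mact B x)"
proof
  assume r: "\<forall>x\<in>V m. mact A x = mact B x"
  show "A = B"
  proof (rule eq_matI)
    fix i j assume ij: "i < dim_row B" "j < dim_col B"
    then have "mact A (unit j) i = mact B (unit j) i" using assms r by simp
    then show "A $$ (i, j) = B $$ (i, j)"
      using ij mact_unit[OF assms(1)] mact_unit[OF assms(2)] assms by simp
  qed (use assms in auto)
qed simp

definition mat_of :: "nat \<Rightarrow> nat \<Rightarrow> ((nat \<Rightarrow> 'k::field) \<Rightarrow> nat \<Rightarrow> 'k) \<Rightarrow> 'k mat" where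
  "mat_of n m F = mat n m (\<lambda>(i, j). F (unit j) i)"

lemma mat_of_carrier [simp]: "mat_of n m F \<in> carrier_mat n m"
  by (simp add: mat_of_def)

lemma sum_fun_apply: "(\<Sum>i\<in>A. f i) j = (\<Sum>i\<in>A. f i j)"
  for f :: "'a \<Rightarrow> 'b \<Rightarrow> 'c::comm_monoid_add"
  by (induction A rule: infinite_finite_induct) auto

lemma mact_mat_of:
  assumes "lin F" "F ` V m \<subseteq> V n" "x \<in> V m"
  shows "mact (mat_of n m F) x = F x"
proof
  fix i
  have "F x = F (\<Sum>j<m. scal (x j) (unit j))"
    by (rule arg_cong[OF V_expand[OF assms(3)]])
  also have "\<dots> = (\<Sum>j<m. scal (x j) (F (unit j)))"
    by (simp only: lin_sum[OF assms(1)] lin_scal[OF assms(1)])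
  finally have "F x = (\<Sum>j<m. scal (x j) (F (unit j)))" .
  then have "F x i = (\<Sum>j<m. x j * F (unit j) i)" by (simp add: sum_fun_apply scal_apply)
  moreover have "F x i = 0" if "\<not> i < n"
  proof -
    have "F x \<in> V n" using assms(2,3) by blast
    then show ?thesis using that by (simp add: V_def)
  qed
  ultimately show "mact (mat_of n m F) x i = F x i"
    by (simp add: mact_def mat_of_def mult.commute)
qed

lemma mult_mat_vec_mact:
  assumes "A \<in> carrier_mat n m"
  shows "A *\<^sub>v vec m x = vec n (mact A x)"
  using assms by (auto simp: mact_def scalar_prod_def lessThan_atLeast0 intro!: sum.cong)

lemma vec_image_V: "vec n ` V n = carrier_vec n"
proof
  show "carrier_vec n \<subseteq> vec n ` (V n :: (nat \<Rightarrow> 'a) set)"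
  proof
    fix v :: "'a vec" assume "v \<in> carrier_vec n"
    then have v: "v = vec n (\<lambda>i. if i < n then v $ i else 0)" by (auto intro!: eq_vecI)
    have "(\<lambda>i. if i < n then v $ i else 0) \<in> V n" by (simp add: V_def)
    from imageI[OF this, of "vec n"] v show "v \<in> vec n ` V n" by simp
  qed
qed auto

lemma vec_eq_iff_V: "x \<in> V n \<Longrightarrow> y \<in> V n \<Longrightarrow> vec n x = vec n y \<longleftrightarrow> x = y"
proof
  assume xy: "x \<in> V n" "y \<in> V n" "vec n x = vec n y"
  have "x i = y i" for i
  proof (cases "i < n")
    case True
    then show ?thesis using xy(3) by (metis index_vec)
  qed (use xy in \<open>simp add: V_def\<close>)
  then show "x = y" by (rule ext)
qed simp

lemma mat_inj_iff:
  assumes "A \<in> carrier_mat n m"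
  shows "inj_on (\<lambda>x. A *\<^sub>v x) (carrier_vec m) \<longleftrightarrow> inj_on (mact A) (V m)"
proof -
  have "inj_on (\<lambda>x. A *\<^sub>v x) (vec m ` V m) \<longleftrightarrow> inj_on (mact A) (V m)"
    unfolding inj_on_def
    by (auto simp: mult_mat_vec_mact[OF assms] vec_eq_iff_V mact_in_V[OF assms])
  then show ?thesis by (simp add: vec_image_V)
qed

text \<open>Kernels of morphisms are specified by equality of a matrix image with a matrix kernel;
  this and the next lemma move that equation to coordinate spaces.\<close>

lemma mat_image_iff:
  assumes "A \<in> carrier_mat n m" "W \<subseteq> V n"
  shows "(\<lambda>x. A *\<^sub>v x) ` carrier_vec m = vec n ` W \<longleftrightarrow> mact A ` V m = W"
proof -
  have "(\<lambda>x. A *\<^sub>v x) ` carrier_vec m = (\<lambda>x. A *\<^sub>v x) ` (vec m ` V m)"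
    by (simp add: vec_image_V)
  also have "\<dots> = vec n ` (mact A ` V m)"
    by (simp add: image_image mult_mat_vec_mact[OF assms(1)])
  finally have e: "(\<lambda>x. A *\<^sub>v x) ` carrier_vec m = vec n ` (mact A ` V m)" .
  have inj: "inj_on (vec n) (V n :: (nat \<Rightarrow> 'a) set)" by (simp add: inj_on_def vec_eq_iff_V)
  show ?thesis unfolding e
    by (rule inj_on_image_eq_iff[OF inj]) (use assms mact_in_V[OF assms(1)] in auto)
qed

lemma mat_kernel_mact:
  assumes "A \<in> carrier_mat n m"
  shows "mat_kernel A = vec m ` {x \<in> V m. mact A x = 0}"
proof -
  have "mat_kernel A = {v \<in> vec m ` V m. A *\<^sub>v v = 0\<^sub>v n}"
    using assms by (auto simp: mat_kernel_def vec_image_V)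
  also have "\<dots> = vec m ` {x \<in> V m. A *\<^sub>v vec m x = 0\<^sub>v n}" by auto
  also have "0\<^sub>v n = vec n (0 :: nat \<Rightarrow> 'a)" by (auto simp: zero_vec_def)
  also have "{x \<in> V m. A *\<^sub>v vec m x = vec n 0} = {x \<in> V m. mact A x = 0}"
    by (auto simp: mult_mat_vec_mact[OF assms] vec_eq_iff_V mact_in_V[OF assms])
  finally show ?thesis .
qed

abbreviation space :: "('v, 'e, 'k::field) rep \<Rightarrow> 'v \<Rightarrow> (nat \<Rightarrow> 'k) set" where
  "space M v \<equiv> V (rdim M v)"

definition act :: "('v, 'e, 'k::field) rep \<Rightarrow> 'e \<Rightarrow> (nat \<Rightarrow> 'k) \<Rightarrow> nat \<Rightarrow> 'k" where
  "act M a = mact (rmap M a)"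

lemma lin_act [simp]: "lin (act M a)"
  by (simp add: act_def)

primrec pathact :: "('v, 'e, 'k::field) rep \<Rightarrow> 'e list \<Rightarrow> (nat \<Rightarrow> 'k) \<Rightarrow> nat \<Rightarrow> 'k" where
  "pathact M [] x = x"
| "pathact M (a # p) x = pathact M p (act M a x)"

lemma lin_pathact [simp]: "lin (pathact M p)"
proof (induction p)
  case Nil
  show ?case by (simp add: lin_id[unfolded id_def])
next
  case (Cons a p)
  have "lin (\<lambda>x. pathact M p (act M a x))" by (rule lin_comp[OF lin_act Cons])
  then show ?case by simp
qed

lemma pathact_append: "pathact M (p @ q) x = pathact M q (pathact M p x)"
  by (induction p arbitrary: x) auto

text \<open>The component from u to v of the action of an element f of the path algebra, that is,
  the action of \<open>e\<^sub>u f e\<^sub>v\<close>.\<close>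

definition elemact :: "('v, 'e, 'k::field) rep \<Rightarrow> (('v, 'e) path \<Rightarrow>\<^sub>0 'k) \<Rightarrow> 'v \<Rightarrow> 'v \<Rightarrow>
    (nat \<Rightarrow> 'k) \<Rightarrow> nat \<Rightarrow> 'k" where
  "elemact M f u v x = (\<Sum>p\<in>{p. (u, p, v) \<in> Poly_Mapping.keys f}.
     scal (Poly_Mapping.lookup f (u, p, v)) (pathact M p x))"

lemma finite_paths_in_keys: "finite {p. (u, p, v) \<in> Poly_Mapping.keys f}"
  by (rule finite_subset[OF _ finite_imageI[OF finite_imageI[OF finite_keys[of f]], of fst snd]]) force

lemma elemact_add: "elemact M f u v (x + y) = elemact M f u v x + elemact M f u v y"
  by (simp add: elemact_def lin_add[OF lin_pathact] fv.scale_right_distrib sum.distrib)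

definition dims_ok :: "('v, 'e) pre_digraph \<Rightarrow> ('v, 'e, 'k::field) rep \<Rightarrow> bool" where
  "dims_ok Q M \<longleftrightarrow> (\<forall>a\<in>arcs Q. rmap M a \<in> carrier_mat (rdim M (head Q a)) (rdim M (tail Q a)))"

text \<open>Morphisms are taken as families of total linear maps; only their values on the spaces at the
  vertices matter, and totality lets them be composed and added without side conditions.\<close>

definition fhom :: "('v, 'e) pre_digraph \<Rightarrow> ('v, 'e, 'k::field) rep \<Rightarrow> ('v, 'e, 'k) rep \<Rightarrow>
    ('v \<Rightarrow> (nat \<Rightarrow> 'k) \<Rightarrow> nat \<Rightarrow> 'k) \<Rightarrow> bool" where
  "fhom Q M N F \<longleftrightarrow> (\<forall>v\<in>verts Q. lin (F v) \<and> (\<forall>x\<in>space M v. F v x \<in> space N v)) \<and>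
     (\<forall>a\<in>arcs Q. \<forall>x\<in>space M (tail Q a).
        F (head Q a) (act M a x) = act N a (F (tail Q a) x))"

definition fsurj :: "('v, 'e) pre_digraph \<Rightarrow> ('v, 'e, 'k::field) rep \<Rightarrow> ('v, 'e, 'k) rep \<Rightarrow>
    ('v \<Rightarrow> (nat \<Rightarrow> 'k) \<Rightarrow> nat \<Rightarrow> 'k) \<Rightarrow> bool" where
  "fsurj Q M N F \<longleftrightarrow> (\<forall>v\<in>verts Q. F v ` space M v = space N v)"

definition finj :: "('v, 'e) pre_digraph \<Rightarrow> ('v, 'e, 'k::field) rep \<Rightarrow>
    ('v \<Rightarrow> (nat \<Rightarrow> 'k) \<Rightarrow> nat \<Rightarrow> 'k) \<Rightarrow> bool" where
  "finj Q M F \<longleftrightarrow> (\<forall>v\<in>verts Q. inj_on (F v) (space M v))"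

definition subrep :: "('v, 'e) pre_digraph \<Rightarrow> ('v, 'e, 'k::field) rep \<Rightarrow>
    ('v \<Rightarrow> (nat \<Rightarrow> 'k) set) \<Rightarrow> bool" where
  "subrep Q M W \<longleftrightarrow> (\<forall>v\<in>verts Q. fv.subspace (W v) \<and> W v \<subseteq> space M v) \<and>
     (\<forall>a\<in>arcs Q. \<forall>x\<in>W (tail Q a). act M a x \<in> W (head Q a))"

lemma fhomD:
  assumes F: "fhom Q M N F"
  shows "v \<in> verts Q \<Longrightarrow> lin (F v)"
    and "v \<in> verts Q \<Longrightarrow> x \<in> space M v \<Longrightarrow> F v x \<in> space N v"
    and "a \<in> arcs Q \<Longrightarrow> x \<in> space M (tail Q a) \<Longrightarrow>
      F (head Q a) (act M a x) = act N a (F (tail Q a) x)"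
proof -
  note A = conjunct1[OF F[unfolded fhom_def]] and B = conjunct2[OF F[unfolded fhom_def]]
  show "lin (F v)" if "v \<in> verts Q" by (rule conjunct1[OF bspec[OF A that]])
  show "F v x \<in> space N v" if "v \<in> verts Q" "x \<in> space M v"
    by (rule bspec[OF conjunct2[OF bspec[OF A that(1)]] that(2)])
  show "F (head Q a) (act M a x) = act N a (F (tail Q a) x)" if "a \<in> arcs Q" "x \<in> space M (tail Q a)"
    by (rule bspec[OF bspec[OF B that(1)] that(2)])
qed

lemma fhomI:
  assumes "\<And>v. v \<in> verts Q \<Longrightarrow> lin (F v)"
    "\<And>v x. v \<in> verts Q \<Longrightarrow> x \<in> space M v \<Longrightarrow> F v x \<in> space N v"
    "\<And>a x. a \<in> arcs Q \<Longrightarrow> x \<in> space M (tail Q a) \<Longrightarrow>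
      F (head Q a) (act M a x) = act N a (F (tail Q a) x)"
  shows "fhom Q M N F"
  unfolding fhom_def by (intro conjI ballI assms)

lemma fhom_id: "fhom Q M M (\<lambda>v x. x)"
  by (rule fhomI) (auto intro: lin_id)

lemma fsurjD: "fsurj Q M N F \<Longrightarrow> v \<in> verts Q \<Longrightarrow> y \<in> space N v \<Longrightarrow> \<exists>x\<in>space M v. F v x = y"
  unfolding fsurj_def by (metis imageE)

lemma finj_iff:
  assumes "fhom Q M N F"
  shows "finj Q M F \<longleftrightarrow> (\<forall>v\<in>verts Q. \<forall>x\<in>space M v. F v x = 0 \<longrightarrow> x = 0)"
  unfolding finj_def using lin_inj_on_iff[OF fhomD(1)[OF assms] subspace_V] by blast

context wf_digraph
begin

lemma act_in: "dims_ok G M \<Longrightarrow> a \<in> arcs G \<Longrightarrow> act M a x \<in> space M (head G a)"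
  by (auto simp: dims_ok_def act_def intro: mact_in_V)

lemma fhom_comp:
  assumes "dims_ok G M" "fhom G L M F" "fhom G M N H"
  shows "fhom G L N (\<lambda>v x. H v (F v x))"
  by (rule fhomI) (simp_all add: lin_comp fhomD[OF assms(2)] fhomD[OF assms(3)])

lemma pathact_in:
  assumes "dims_ok G M" "awalk u p v" "x \<in> space M u"
  shows "pathact M p x \<in> space M v"
  using assms(2,3)
proof (induction p arbitrary: u x)
  case Nil
  then show ?case by (auto simp: awalk_Nil_iff)
next
  case (Cons a p)
  then show ?case using act_in[OF assms(1)] by (auto simp: awalk_Cons_iff)
qed

lemma fhom_pathact:
  assumes "dims_ok G M" "fhom G M N F" "awalk u p v" "x \<in> space M u"
  shows "F v (pathact M p x) = pathact N p (F u x)"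
  using assms(3,4)
proof (induction p arbitrary: u x)
  case Nil
  then show ?case by (auto simp: awalk_Nil_iff)
next
  case (Cons a p)
  then show ?case using act_in[OF assms(1)] fhomD(3)[OF assms(2)] by (auto simp: awalk_Cons_iff)
qed

lemma subrep_pathact:
  assumes "subrep G M W" "awalk u p v" "x \<in> W u"
  shows "pathact M p x \<in> W v"
  using assms(2,3)
proof (induction p arbitrary: u x)
  case Nil
  then show ?case by (auto simp: awalk_Nil_iff)
next
  case (Cons a p)
  then show ?case using assms(1) by (auto simp: awalk_Cons_iff subrep_def)
qed

lemma path_map_carrier:
  assumes "dims_ok G M" "awalk u p v"
  shows "path_map G M u p \<in> carrier_mat (rdim M v) (rdim M u)"
  using assms(2)
proof (induction p arbitrary: u)
  case Nil
  then show ?case by (auto simp: awalk_Nil_iff)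
next
  case (Cons a p)
  then have "path_map G M (head G a) p \<in> carrier_mat (rdim M v) (rdim M (head G a))"
    by (auto simp: awalk_Cons_iff)
  moreover have "rmap M a \<in> carrier_mat (rdim M (head G a)) (rdim M u)"
    using Cons assms(1) by (auto simp: awalk_Cons_iff dims_ok_def)
  ultimately show ?case by simp
qed

lemma mact_path_map:
  assumes "dims_ok G M" "awalk u p v" "x \<in> space M u"
  shows "mact (path_map G M u p) x = pathact M p x"
  using assms(2,3)
proof (induction p arbitrary: u x)
  case Nil
  then show ?case by (simp add: mact_one)
next
  case (Cons a p)
  from Cons.prems have p: "awalk (head G a) p v" and a: "a \<in> arcs G" "tail G a = u"
    by (auto simp: awalk_Cons_iff)
  have "mact (path_map G M (head G a) p * rmap M a) x = mact (path_map G M (head G a) p) (act M a x)"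
    unfolding act_def
    by (rule mact_mult[OF path_map_carrier[OF assms(1) p], of _ "rdim M u"])
       (use a assms(1) in \<open>auto simp: dims_ok_def\<close>)
  then show ?case using Cons.IH[OF p] act_in[OF assms(1) a(1)] by simp
qed

lemma mact_elem_map:
  assumes M: "dims_ok G M" and f: "Poly_Mapping.keys f \<subseteq> paths G" and x: "x \<in> space M u"
  shows "mact (elem_map G M f u v) x = elemact M f u v x"
proof
  fix i
  let ?S = "{p. (u, p, v) \<in> Poly_Mapping.keys f}"
  let ?c = "\<lambda>p. Poly_Mapping.lookup f (u, p, v)"
  have w: "awalk u p v" if "p \<in> ?S" for p using that f by (auto simp: paths_def)
  have d: "dim_row (path_map G M u p) = rdim M v" "dim_col (path_map G M u p) = rdim M u" if "p \<in> ?S" for p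
    using path_map_carrier[OF M w[OF that]] by auto
  show "mact (elem_map G M f u v) x i = elemact M f u v x i"
  proof (cases "i < rdim M v")
    case True
    have "mact (elem_map G M f u v) x i
      = (\<Sum>j<rdim M u. \<Sum>p\<in>?S. ?c p * (path_map G M u p $$ (i, j) * x j))"
      using True by (auto simp: mact_def elem_map_def sum_distrib_right mult.assoc)
    also have "\<dots> = (\<Sum>p\<in>?S. \<Sum>j<rdim M u. ?c p * (path_map G M u p $$ (i, j) * x j))"
      by (rule sum.swap)
    also have "\<dots> = (\<Sum>p\<in>?S. ?c p * mact (path_map G M u p) x i)"
      using True d by (auto simp: mact_def sum_distrib_left intro!: sum.cong)
    also have "\<dots> = (\<Sum>p\<in>?S. ?c p * pathact M p x i)"
      by (intro sum.cong refl) (simp add: mact_path_map[OF M w x])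
    finally show ?thesis by (simp add: elemact_def sum_fun_apply scal_apply)
  next
    case False
    have "pathact M p x i = 0" if "p \<in> ?S" for p
      using pathact_in[OF M w[OF that] x] False by (simp add: V_def)
    then show ?thesis using False by (simp add: mact_def elem_map_def elemact_def sum_fun_apply scal_apply)
  qed
qed

lemma elem_map_zero_iff:
  assumes "dims_ok G M" "Poly_Mapping.keys f \<subseteq> paths G"
  shows "elem_map G M f u v = 0\<^sub>m (rdim M v) (rdim M u) \<longleftrightarrow> (\<forall>x\<in>space M u. elemact M f u v x = 0)"
proof -
  have "elem_map G M f u v \<in> carrier_mat (rdim M v) (rdim M u)" by (simp add: elem_map_def)
  from mat_eq_iff_mact[OF this, of "0\<^sub>m (rdim M v) (rdim M u)"] show ?thesis
    by (simp add: mact_elem_map[OF assms])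
qed

lemma fhom_elemact:
  assumes "dims_ok G M" "fhom G M N F" "v \<in> verts G" "Poly_Mapping.keys f \<subseteq> paths G" "x \<in> space M u"
  shows "F v (elemact M f u v x) = elemact N f u v (F u x)"
proof -
  have "F v (pathact M p x) = pathact N p (F u x)" if "(u, p, v) \<in> Poly_Mapping.keys f" for p
    by (rule fhom_pathact[OF assms(1,2) _ assms(5)]) (use that assms(4) in \<open>auto simp: paths_def\<close>)
  then show ?thesis
    using fhomD(1)[OF assms(2,3)]
    by (simp add: elemact_def lin_sum lin_scal)
qed

lemma homs_fhom:
  assumes "dims_ok G M" "dims_ok G N" "f \<in> homs G M N"
  shows "fhom G M N (\<lambda>v. mact (f v))"
proof (rule fhomI)
  fix v x assume "v \<in> verts G"
  then have "f v \<in> carrier_mat (rdim N v) (rdim M v)" using assms(3) by (simp add: homs_def)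
  then show "mact (f v) x \<in> space N v" by (rule mact_in_V)
next
  fix a x assume a: "a \<in> arcs G" and "x \<in> space M (tail G a)"
  have "f (head G a) \<in> carrier_mat (rdim N (head G a)) (rdim M (head G a))"
    "f (tail G a) \<in> carrier_mat (rdim N (tail G a)) (rdim M (tail G a))"
    "f (head G a) * rmap M a = rmap N a * f (tail G a)"
    using a assms(3) by (auto simp: homs_def)
  then show "mact (f (head G a)) (act M a x) = act N a (mact (f (tail G a)) x)"
    using a assms(1,2) unfolding act_def dims_ok_def by (metis mact_mult)
qed simp

text \<open>On the coordinate spaces every linear map is given by a matrix, so morphisms as families
  of linear maps agree with morphisms as families of matrices.\<close>

lemma fhom_homs:
  assumes M: "dims_ok G M" and N: "dims_ok G N" and F: "fhom G M N F"
  obtains f where "f \<in> homs G M N" "\<And>v x. v \<in> verts G \<Longrightarrow> x \<in> space M v \<Longrightarrow> mact (f v) x = F v x"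
proof -
  let ?f = "\<lambda>v. mat_of (rdim N v) (rdim M v) (F v)"
  have e: "mact (?f v) x = F v x" if "v \<in> verts G" "x \<in> space M v" for v x
    by (rule mact_mat_of) (use that fhomD[OF F] in auto)
  have "?f (head G a) * rmap M a = rmap N a * ?f (tail G a)" if a: "a \<in> arcs G" for a
  proof -
    have c: "rmap M a \<in> carrier_mat (rdim M (head G a)) (rdim M (tail G a))"
      "rmap N a \<in> carrier_mat (rdim N (head G a)) (rdim N (tail G a))"
      using a M N by (auto simp: dims_ok_def)
    have "?f (head G a) * rmap M a \<in> carrier_mat (rdim N (head G a)) (rdim M (tail G a))"
      "rmap N a * ?f (tail G a) \<in> carrier_mat (rdim N (head G a)) (rdim M (tail G a))"
      by (rule mult_carrier_mat[OF mat_of_carrier c(1)], rule mult_carrier_mat[OF c(2) mat_of_carrier])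
    note iff = mat_eq_iff_mact[OF this]
    show ?thesis unfolding iff
    proof
      fix x assume x: "x \<in> space M (tail G a)"
      have "mact (?f (head G a) * rmap M a) x = mact (?f (head G a)) (act M a x)"
        unfolding act_def by (rule mact_mult[OF mat_of_carrier c(1)])
      also have "\<dots> = F (head G a) (act M a x)" using a act_in[OF M a] by (intro e) auto
      also have "\<dots> = act N a (mact (?f (tail G a)) x)" using e[of "tail G a" x] x a fhomD(3)[OF F a x] by simp
      also have "\<dots> = mact (rmap N a * ?f (tail G a)) x"
        unfolding act_def by (rule mact_mult[OF c(2) mat_of_carrier, symmetric])
      finally show "mact (?f (head G a) * rmap M a) x = mact (rmap N a * ?f (tail G a)) x" .
    qed
  qed
  then have "?f \<in> homs G M N" by (simp add: homs_def)
  then show thesis using that e by blast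
qed

lemma injective_iff:
  assumes "f \<in> homs G M N"
  shows "injective G M f \<longleftrightarrow> finj G M (\<lambda>v. mact (f v))"
  unfolding injective_def finj_def
  by (intro ball_cong refl mat_inj_iff[of _ "rdim N _"]) (use assms in \<open>auto simp: homs_def\<close>)

lemma surjective_iff:
  assumes "\<And>v. v \<in> verts G \<Longrightarrow> f v \<in> carrier_mat (rdim N v) (rdim M v)"
  shows "surjective G M N f \<longleftrightarrow> fsurj G M N (\<lambda>v. mact (f v))"
  unfolding surjective_def fsurj_def
proof (rule ball_cong[OF refl])
  fix v assume v: "v \<in> verts G"
  show "((*\<^sub>v) (f v) ` carrier_vec (rdim M v) = carrier_vec (rdim N v)) = (mact (f v) ` space M v = space N v)"
    using mat_image_iff[OF assms[OF v] order_refl] by (simp add: vec_image_V)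
qed

lemma fhom_inverse:
  assumes M: "dims_ok G M" and F: "fhom G M N F" and inj: "finj G M F" and surj: "fsurj G M N F"
  obtains H where "fhom G N M H" "\<And>v x. v \<in> verts G \<Longrightarrow> x \<in> space M v \<Longrightarrow> H v (F v x) = x"
    "\<And>v y. v \<in> verts G \<Longrightarrow> y \<in> space N v \<Longrightarrow> F v (H v y) = y"
proof -
  have "\<exists>H. lin H \<and> range H \<subseteq> space M v \<and> (\<forall>x\<in>space M v. H (F v x) = x)" if "v \<in> verts G" for v
    using left_inverse_on[OF fhomD(1)[OF F that] subspace_V, of "rdim M v"] inj that
    unfolding finj_def by metis
  then obtain H where H: "\<And>v. v \<in> verts G \<Longrightarrow> lin (H v)" "\<And>v. v \<in> verts G \<Longrightarrow> range (H v) \<subseteq> space M v"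
      "\<And>v x. v \<in> verts G \<Longrightarrow> x \<in> space M v \<Longrightarrow> H v (F v x) = x"
    by metis
  have FH: "F v (H v y) = y" if "v \<in> verts G" "y \<in> space N v" for v y
    using fsurjD[OF surj that] H(3) that by metis
  have "fhom G N M H"
  proof (rule fhomI)
    fix a x assume a: "a \<in> arcs G" and x: "x \<in> space N (tail G a)"
    then obtain y where y: "y \<in> space M (tail G a)" "x = F (tail G a) y"
      using fsurjD[OF surj _ x] by auto
    have "act N a x = F (head G a) (act M a y)" using fhomD(3)[OF F a y(1)] y(2) by simp
    then show "H (head G a) (act N a x) = act M a (H (tail G a) x)"
      using H(3) y a act_in[OF M a] by simp
  qed (use H in blast)+
  then show thesis using that H(3) FH by blast
qed

lemma isomorphic_iff:
  assumes "dims_ok G M" "dims_ok G N"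
  shows "isomorphic G M N \<longleftrightarrow> (\<exists>F. fhom G M N F \<and> finj G M F \<and> fsurj G M N F)"
proof
  assume "isomorphic G M N"
  then obtain f g where fg: "f \<in> homs G M N" "g \<in> homs G N M"
    "hom_eq G (hom_comp g f) (id_hom M)" "hom_eq G (hom_comp f g) (id_hom N)"
    by (auto simp: isomorphic_def)
  have c: "f v \<in> carrier_mat (rdim N v) (rdim M v)" "g v \<in> carrier_mat (rdim M v) (rdim N v)"
      "g v * f v = 1\<^sub>m (rdim M v)" "f v * g v = 1\<^sub>m (rdim N v)" if "v \<in> verts G" for v
    using that fg by (auto simp: homs_def hom_eq_def hom_comp_def id_hom_def)
  have gf: "mact (g v) (mact (f v) x) = x" if "v \<in> verts G" "x \<in> space M v" for v x
    using c[OF that(1)] mact_mult mact_one that(2) by metis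
  have fg': "mact (f v) (mact (g v) x) = x" if "v \<in> verts G" "x \<in> space N v" for v x
    using c[OF that(1)] mact_mult mact_one that(2) by metis
  have "finj G M (\<lambda>v. mact (f v))"
    unfolding finj_def by (metis gf inj_on_inverseI)
  moreover have "fsurj G M N (\<lambda>v. mact (f v))"
    unfolding fsurj_def
  proof (intro ballI equalityI subsetI)
    fix v y assume v: "v \<in> verts G" and "y \<in> space N v"
    then show "y \<in> mact (f v) ` space M v"
      using fg'[OF v] mact_in_V[OF c(2)[OF v]] by (metis imageI)
  qed (use c(1) mact_in_V in blast)
  ultimately show "\<exists>F. fhom G M N F \<and> finj G M F \<and> fsurj G M N F"
    using homs_fhom[OF assms fg(1)] by blast
next
  assume "\<exists>F. fhom G M N F \<and> finj G M F \<and> fsurj G M N F"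
  then obtain F where F: "fhom G M N F" "finj G M F" "fsurj G M N F" by blast
  obtain H where H: "fhom G N M H" "\<And>v x. v \<in> verts G \<Longrightarrow> x \<in> space M v \<Longrightarrow> H v (F v x) = x"
    "\<And>v y. v \<in> verts G \<Longrightarrow> y \<in> space N v \<Longrightarrow> F v (H v y) = y"
    using fhom_inverse[OF assms(1) F] by blast
  obtain f where f: "f \<in> homs G M N" "\<And>v x. v \<in> verts G \<Longrightarrow> x \<in> space M v \<Longrightarrow> mact (f v) x = F v x"
    using fhom_homs[OF assms F(1)] by blast
  obtain g where g: "g \<in> homs G N M" "\<And>v x. v \<in> verts G \<Longrightarrow> x \<in> space N v \<Longrightarrow> mact (g v) x = H v x"
    using fhom_homs[OF assms(2,1) H(1)] by blast
  have c: "f v \<in> carrier_mat (rdim N v) (rdim M v)" "g v \<in> carrier_mat (rdim M v) (rdim N v)"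
    if "v \<in> verts G" for v
    using that f(1) g(1) by (auto simp: homs_def)
  have "g v * f v = 1\<^sub>m (rdim M v)" if v: "v \<in> verts G" for v
    using c[OF v] v fhomD(2)[OF F(1) v]
    by (subst mat_eq_iff_mact[of _ "rdim M v" "rdim M v"])
       (auto simp: mact_mult[OF c(2,1)] f g H mact_one)
  moreover have "f v * g v = 1\<^sub>m (rdim N v)" if v: "v \<in> verts G" for v
    using c[OF v] v fhomD(2)[OF H(1) v]
    by (subst mat_eq_iff_mact[of _ "rdim N v" "rdim N v"])
       (auto simp: mact_mult[OF c(1,2)] f g H mact_one)
  ultimately show "isomorphic G M N"
    using f(1) g(1) by (auto simp: isomorphic_def hom_eq_def hom_comp_def id_hom_def)
qed

end

text \<open>From here on vectors are used without looking at their entries, except in the coordinates of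
  direct sums. Evaluating \<open>0\<close> or \<open>x + y\<close> at an index would only destroy eta-expanded occurrences.\<close>

declare plus_fun_apply [simp del] zero_fun_apply [simp del] minus_apply [simp del]

section \<open>Modules over a bound quiver algebra\<close>

locale bound_quiver_algebra =
  fixes Q :: "('v, 'e) pre_digraph" and I :: "(('v, 'e) path \<Rightarrow>\<^sub>0 'k::field) set"
  assumes bq: "bound_quiver Q I"
begin

sublocale fin_digraph Q
  using bq by (simp add: bound_quiver_def quiver_def)

abbreviation kQ :: "(('v, 'e) path \<Rightarrow>\<^sub>0 'k) ring" where
  "kQ \<equiv> path_algebra Q"

lemma ring_kQ: "ring kQ"
  by (rule ring_path_algebra) (rule fin_digraph_axioms)

lemma ideal_I: "ideal I kQ"
  using bq by (simp add: bound_quiver_def admissible_def)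

lemma carrier_kQ: "f \<in> carrier kQ \<longleftrightarrow> Poly_Mapping.keys f \<subseteq> paths Q"
  by (simp add: path_algebra_def)

lemma mult_kQ: "f \<otimes>\<^bsub>kQ\<^esub> g = palg_mult f g"
  by (simp add: path_algebra_def)

lemma add_kQ: "f \<oplus>\<^bsub>kQ\<^esub> g = f + g"
  by (simp add: path_algebra_def)

lemma I_keys: "f \<in> I \<Longrightarrow> Poly_Mapping.keys f \<subseteq> paths Q"
  using ideal.Icarr[OF ideal_I] carrier_kQ by blast

lemma modules_iff: "M \<in> modules Q I \<longleftrightarrow> dims_ok Q M \<and>
    (\<forall>f\<in>I. \<forall>u\<in>verts Q. \<forall>v\<in>verts Q. \<forall>x\<in>space M u. elemact M f u v x = 0)"
proof (cases "dims_ok Q M")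
  case True
  then show ?thesis
    using elem_map_zero_iff[OF True I_keys] by (simp add: modules_def dims_ok_def)
next
  case False
  then show ?thesis unfolding modules_def dims_ok_def by blast
qed

lemma modules_dims: "M \<in> modules Q I \<Longrightarrow> dims_ok Q M"
  by (simp add: modules_iff)

subsection \<open>Consequences of admissibility\<close>

text \<open>An ideal that contains the arrows, hence the arrow ideal. This is how trivial paths are
  excluded from the relations.\<close>

definition no_trivial_part :: "(('v, 'e) path \<Rightarrow>\<^sub>0 'k) set" where
  "no_trivial_part = {f. Poly_Mapping.keys f \<subseteq> paths Q \<and> (\<forall>v. (v, [], v) \<notin> Poly_Mapping.keys f)}"

lemma keys_palg_mult_subset:
  "Poly_Mapping.keys (palg_mult f g) \<subseteq>
    {(u, p @ q, w) | u p v q w. (u, p, v) \<in> Poly_Mapping.keys f \<and> (v, q, w) \<in> Poly_Mapping.keys g}"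
  (is "_ \<subseteq> ?R")
proof -
  have "Poly_Mapping.keys (palg_mult f g) \<subseteq> (\<Union>x\<in>Poly_Mapping.keys f. \<Union>y\<in>Poly_Mapping.keys g.
      Poly_Mapping.keys (path_times x y (Poly_Mapping.lookup f x * Poly_Mapping.lookup g y)))"
    unfolding palg_mult_def
    by (rule order.trans[OF keys_sum UN_mono[OF order_refl keys_sum]])
  also have "\<dots> \<subseteq> ?R"
  proof (intro UN_least)
    fix x y assume xy: "x \<in> Poly_Mapping.keys f" "y \<in> Poly_Mapping.keys g"
    obtain u p v where x: "x = (u, p, v)" by (cases x)
    obtain v' q w where y: "y = (v', q, w)" by (cases y)
    show "Poly_Mapping.keys (path_times x y (Poly_Mapping.lookup f x * Poly_Mapping.lookup g y)) \<subseteq> ?R"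
      using xy unfolding x y by (cases "v = v'") auto
  qed
  finally show ?thesis .
qed

lemma no_trivial_part_ideal: "ideal no_trivial_part kQ"
proof (rule idealI[OF ring_kQ])
  interpret ring kQ by (rule ring_kQ)
  show "subgroup no_trivial_part (add_monoid kQ)"
  proof (rule group.subgroupI)
    show "group (add_monoid kQ)" by (rule a_group)
    show "no_trivial_part \<subseteq> carrier (add_monoid kQ)"
      by (auto simp: no_trivial_part_def path_algebra_def)
    have "(0 :: ('v, 'e) path \<Rightarrow>\<^sub>0 'k) \<in> no_trivial_part" by (simp add: no_trivial_part_def)
    then show "no_trivial_part \<noteq> {}" by blast
    fix a assume a: "a \<in> no_trivial_part"
    then have a': "a \<in> carrier kQ" by (simp add: carrier_kQ no_trivial_part_def)
    have "(-a) \<oplus>\<^bsub>kQ\<^esub> a = \<zero>\<^bsub>kQ\<^esub>" by (simp add: path_algebra_def)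
    moreover have "-a \<in> carrier kQ" using a' by (simp add: carrier_kQ in_keys_iff subset_iff)
    ultimately have "\<ominus>\<^bsub>kQ\<^esub> a = -a" using a' by (metis minus_equality)
    then have "inv\<^bsub>add_monoid kQ\<^esub> a = -a" by (simp add: a_inv_def)
    then show "inv\<^bsub>add_monoid kQ\<^esub> a \<in> no_trivial_part"
      using a by (simp add: no_trivial_part_def in_keys_iff subset_iff)
    fix b assume b: "b \<in> no_trivial_part"
    have "a + b \<in> no_trivial_part"
      using Poly_Mapping.keys_add[of a b] a b by (auto simp: no_trivial_part_def)
    then show "a \<otimes>\<^bsub>add_monoid kQ\<^esub> b \<in> no_trivial_part" by (simp add: add_kQ)
  qed
  fix a x assume a: "a \<in> no_trivial_part" and x: "x \<in> carrier kQ"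
  have k: "Poly_Mapping.keys a \<subseteq> paths Q" "Poly_Mapping.keys x \<subseteq> paths Q"
    using a x by (auto simp: no_trivial_part_def carrier_kQ)
  have triv: "u = v" if "(u, [], v) \<in> Poly_Mapping.keys x \<union> Poly_Mapping.keys a" for u v
    using that k by (auto simp: paths_def awalk_Nil_iff)
  show "x \<otimes>\<^bsub>kQ\<^esub> a \<in> no_trivial_part"
    unfolding mult_kQ no_trivial_part_def
    using keys_palg_mult[OF wf_digraph_axioms k(2,1)] keys_palg_mult_subset[of x a] a triv
    by (fastforce simp: no_trivial_part_def)
  show "a \<otimes>\<^bsub>kQ\<^esub> x \<in> no_trivial_part"
    unfolding mult_kQ no_trivial_part_def
    using keys_palg_mult[OF wf_digraph_axioms k(1,2)] keys_palg_mult_subset[of a x] a triv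
    by (fastforce simp: no_trivial_part_def)
qed

lemma arrow_ideal_subset: "arrow_ideal Q \<subseteq> (no_trivial_part :: (('v, 'e) path \<Rightarrow>\<^sub>0 'k) set)"
  unfolding arrow_ideal_def
proof (rule ring.genideal_minimal[OF ring_kQ no_trivial_part_ideal])
  show "arrow Q ` arcs Q \<subseteq> (no_trivial_part :: (('v, 'e) path \<Rightarrow>\<^sub>0 'k) set)"
    by (auto simp: no_trivial_part_def arrow_def paths_def awalk_Cons_iff awalk_Nil_iff)
qed

lemma arrow_ideal_ideal: "ideal (arrow_ideal Q) kQ"
  unfolding arrow_ideal_def
  by (rule ring.genideal_ideal[OF ring_kQ])
     (auto simp: carrier_kQ arrow_def paths_def awalk_Cons_iff awalk_Nil_iff)

text \<open>Admissibility puts the relations into the square of the arrow ideal; lying in the arrow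
  ideal already excludes trivial paths. Thus the simple representations at the vertices are
  modules.\<close>

lemma I_no_trivial:
  assumes "f \<in> I"
  shows "(v, [], v) \<notin> Poly_Mapping.keys f"
proof -
  let ?J = "arrow_ideal Q :: (('v, 'e) path \<Rightarrow>\<^sub>0 'k) set"
  interpret J: ideal ?J kQ by (rule arrow_ideal_ideal)
  have J1: "x \<in> ?J" if "x \<in> ideal_prod kQ (carrier kQ) ?J" for x
    using that by (induction rule: ideal_prod.induct) (auto intro: J.I_l_closed)
  have J2: "x \<in> ?J" if "x \<in> ideal_prod kQ (ideal_prod kQ (carrier kQ) ?J) ?J" for x
    using that
  proof (induction rule: ideal_prod.induct)
    case (prod i j)
    then have "i \<in> carrier kQ" using J1 J.Icarr by blast
    with prod show ?case by (auto intro: J.I_l_closed)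
  qed auto
  have "f \<in> ideal_power kQ ?J 2"
    using assms bq by (auto simp: bound_quiver_def admissible_def)
  then have "f \<in> ?J" using J2 by (simp add: numeral_2_eq_2)
  then show ?thesis using arrow_ideal_subset by (auto simp: no_trivial_part_def)
qed

lemma path_in_ideal_power:
  assumes "awalk u p v"
  shows "Poly_Mapping.single (u, p, v) 1 \<in> ideal_power kQ (arrow_ideal Q) (length p)"
  using assms
proof (induction p arbitrary: v rule: rev_induct)
  case Nil
  then show ?case by (auto simp: carrier_kQ paths_def)
next
  case (snoc a p)
  then have p: "awalk u p (tail Q a)" and a: "a \<in> arcs Q" "head Q a = v"
    by (auto simp: awalk_append_iff awalk_Cons_iff awalk_Nil_iff)
  have "arrow Q a \<in> (arrow_ideal Q :: (('v, 'e) path \<Rightarrow>\<^sub>0 'k) set)"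
    unfolding arrow_ideal_def
    by (rule subsetD[OF ring.genideal_self[OF ring_kQ]])
       (use a in \<open>auto simp: carrier_kQ arrow_def paths_def awalk_Cons_iff awalk_Nil_iff intro!: imageI\<close>)
  from ideal_prod.prod[OF snoc.IH[OF p] this, of kQ]
  show ?case using a by (simp add: mult_kQ arrow_def palg_mult_single)
qed

lemma long_paths_in_I: "\<exists>m. \<forall>u p v. awalk u p v \<and> length p = m \<longrightarrow> Poly_Mapping.single (u, p, v) 1 \<in> I"
proof -
  obtain m where "ideal_power kQ (arrow_ideal Q) m \<subseteq> I"
    using bq by (auto simp: bound_quiver_def admissible_def)
  then have "awalk u p v \<and> length p = m \<longrightarrow> Poly_Mapping.single (u, p, v) 1 \<in> I" for u p v
    using path_in_ideal_power[of u p v] by auto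
  then show ?thesis by blast
qed

lemma elemact_single: "elemact M (Poly_Mapping.single (u, p, v) c) u v x = scal c (pathact M p x)"
  by (cases "c = 0") (simp_all add: elemact_def)

text \<open>A nilpotency bound for the radical of the algebra: by admissibility, all paths of some
  fixed length are relations.\<close>

definition nilp :: nat where
  "nilp = (SOME m. \<forall>u p v. awalk u p v \<and> length p = m \<longrightarrow> Poly_Mapping.single (u, p, v) 1 \<in> I)"

lemma pathact_zero:
  assumes M: "M \<in> modules Q I" and p: "awalk u p v" "length p \<ge> nilp" and x: "x \<in> space M u"
  shows "pathact M p x = 0"
proof -
  have "\<forall>u p v. awalk u p v \<and> length p = nilp \<longrightarrow> Poly_Mapping.single (u, p, v) 1 \<in> I"
    unfolding nilp_def by (rule someI_ex[OF long_paths_in_I])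
  moreover obtain w where q: "awalk u (take nilp p) w" and r: "awalk w (drop nilp p) v"
    using p(1) awalk_append_iff[of u "take nilp p" "drop nilp p" v] by auto
  ultimately have "Poly_Mapping.single (u, take nilp p, w) 1 \<in> I" using p(2) by simp
  moreover have "u \<in> verts Q" "w \<in> verts Q" using q by auto
  ultimately have "elemact M (Poly_Mapping.single (u, take nilp p, w) 1) u w x = 0"
    using M x unfolding modules_iff by blast
  then have "pathact M (take nilp p) x = 0" by (simp add: elemact_single)
  then show ?thesis
    using pathact_append[of M "take nilp p" "drop nilp p" x] lin_0[OF lin_pathact] by simp
qed

lemma zero_arrows_module:
  assumes "dims_ok Q M" "\<And>a x. a \<in> arcs Q \<Longrightarrow> x \<in> space M (tail Q a) \<Longrightarrow> act M a x = 0"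
  shows "M \<in> modules Q I"
  unfolding modules_iff
proof (intro conjI ballI assms(1))
  fix f u v x assume f: "f \<in> I" and x: "x \<in> space M u"
  have "pathact M p x = 0" if k: "(u, p, v) \<in> Poly_Mapping.keys f" for p
  proof (cases p)
    case Nil
    then have "u = v" using I_keys[OF f] k by (auto simp: paths_def awalk_Nil_iff)
    then show ?thesis using I_no_trivial[OF f] k Nil by blast
  next
    case (Cons a q)
    then have "a \<in> arcs Q" "tail Q a = u" using I_keys[OF f] k by (auto simp: paths_def awalk_Cons_iff)
    then have "act M a x = 0" using assms(2) x by blast
    then show ?thesis using Cons lin_0[OF lin_pathact] by simp
  qed
  then show "elemact M f u v x = 0" by (simp add: elemact_def)
qed

subsection \<open>Submodules, quotients and direct sums\<close>

text \<open>The property of being bound by I passes to subobjects and quotients, because morphisms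
  commute with the action of every element of the path algebra.\<close>

lemma modules_inj:
  assumes N: "N \<in> modules Q I" and M: "dims_ok Q M" and F: "fhom Q M N F" and inj: "finj Q M F"
  shows "M \<in> modules Q I"
  unfolding modules_iff
proof (intro conjI ballI M)
  fix f u v x assume f: "f \<in> I" and uv: "u \<in> verts Q" "v \<in> verts Q" and x: "x \<in> space M u"
  have "F v (elemact M f u v x) = elemact N f u v (F u x)"
    by (rule fhom_elemact[OF M F uv(2) I_keys[OF f] x])
  also have "\<dots> = 0" using N f uv fhomD(2)[OF F uv(1) x] unfolding modules_iff by blast
  finally have "F v (elemact M f u v x) = 0" .
  moreover have "elemact M f u v x \<in> space M v"
    unfolding mact_elem_map[OF M I_keys[OF f] x, symmetric]
    by (rule mact_in_V[of _ _ "rdim M u"]) (simp add: elem_map_def)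
  ultimately show "elemact M f u v x = 0"
    using inj uv(2) unfolding finj_iff[OF F] by blast
qed

lemma modules_surj:
  assumes M: "M \<in> modules Q I" and N: "dims_ok Q N" and F: "fhom Q M N F" and surj: "fsurj Q M N F"
  shows "N \<in> modules Q I"
  unfolding modules_iff
proof (intro conjI ballI N)
  fix f u v y assume f: "f \<in> I" and uv: "u \<in> verts Q" "v \<in> verts Q" and y: "y \<in> space N u"
  obtain x where x: "x \<in> space M u" "F u x = y" using fsurjD[OF surj uv(1) y] by blast
  have "elemact N f u v y = F v (elemact M f u v x)"
    using fhom_elemact[OF modules_dims[OF M] F uv(2) I_keys[OF f] x(1)] x(2) by simp
  also have "elemact M f u v x = 0" using M f uv x(1) unfolding modules_iff by blast
  finally show "elemact N f u v y = 0" using lin_0[OF fhomD(1)[OF F uv(2)]] by simp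
qed

text \<open>A basis of each of the subspaces turns a subrepresentation into a representation by
  matrices; the arrows act through a left inverse of the inclusion.\<close>

lemma subrep_module:
  assumes M: "M \<in> modules Q I" and W: "subrep Q M W"
  obtains N F where "N \<in> modules Q I" "fhom Q N M F" "finj Q N F"
    "\<And>v. v \<in> verts Q \<Longrightarrow> F v ` space N v = W v"
proof -
  have "\<exists>m B. lin B \<and> B ` V m = W v \<and> inj_on B (V m)" if v: "v \<in> verts Q" for v
    using W v subspace_coordinates[of "W v" "rdim M v"] unfolding subrep_def by metis
  then obtain m B where B: "\<And>v. v \<in> verts Q \<Longrightarrow> lin (B v)" "\<And>v. v \<in> verts Q \<Longrightarrow> B v ` V (m v) = W v"
    "\<And>v. v \<in> verts Q \<Longrightarrow> inj_on (B v) (V (m v))" by metis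
  have "\<exists>G. lin G \<and> range G \<subseteq> V (m v) \<and> (\<forall>x\<in>V (m v). G (B v x) = x)" if v: "v \<in> verts Q" for v
    using left_inverse_on[OF B(1)[OF v] subspace_V B(3)[OF v]] by metis
  then obtain G where G: "\<And>v. v \<in> verts Q \<Longrightarrow> lin (G v)" "\<And>v x. v \<in> verts Q \<Longrightarrow> G v x \<in> V (m v)"
    "\<And>v x. v \<in> verts Q \<Longrightarrow> x \<in> V (m v) \<Longrightarrow> G v (B v x) = x"
    by (metis rangeI subsetD)
  have BW: "B v x \<in> W v" if "v \<in> verts Q" "x \<in> V (m v)" for v x
    using B(2)[OF that(1)] that(2) by blast
  have WM: "x \<in> space M v" if "v \<in> verts Q" "x \<in> W v" for v x
    using W that unfolding subrep_def by blast
  have BG: "B v (G v y) = y" if v: "v \<in> verts Q" and y: "y \<in> W v" for v y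
  proof -
    obtain x where "x \<in> V (m v)" "y = B v x" using B(2)[OF v] y by blast
    then show ?thesis using G(3)[OF v] by simp
  qed
  define N where "N = Rep m (\<lambda>a. mat_of (m (head Q a)) (m (tail Q a))
     (\<lambda>x. G (head Q a) (act M a (B (tail Q a) x))))"
  have dims: "dims_ok Q N" by (simp add: dims_ok_def N_def)
  have act: "act N a x = G (head Q a) (act M a (B (tail Q a) x))" if a: "a \<in> arcs Q" and x: "x \<in> V (m (tail Q a))" for a x
  proof -
    have "lin (\<lambda>x. G (head Q a) (act M a (B (tail Q a) x)))"
      by (rule lin_comp[OF lin_comp[OF B(1) lin_act] G(1)]) (use a in auto)
    then show ?thesis
      unfolding act_def N_def rep.sel by (rule mact_mat_of) (use G(2) a x in auto)
  qed
  have F: "fhom Q N M B"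
  proof (rule fhomI)
    fix a x assume a: "a \<in> arcs Q" and x: "x \<in> space N (tail Q a)"
    then have x': "x \<in> V (m (tail Q a))" by (simp add: N_def)
    have "act M a (B (tail Q a) x) \<in> W (head Q a)"
      using W a BW[OF _ x'] unfolding subrep_def by simp
    then show "B (head Q a) (act N a x) = act M a (B (tail Q a) x)"
      using act[OF a x'] BG a by simp
  qed (use B(1) BW WM in \<open>auto simp: N_def\<close>)
  have inj: "finj Q N B" using B(3) by (simp add: finj_def N_def)
  show thesis
    by (rule that[OF modules_inj[OF M dims F inj] F inj]) (use B(2) in \<open>simp add: N_def\<close>)
qed

text \<open>Dually, each quotient space is identified with a coordinate space, and the arrows act on
  chosen representatives. The choice does not matter since the subspaces are stable under the
  arrows.\<close>

lemma quotient_module: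
  assumes M: "M \<in> modules Q I" and W: "subrep Q M W"
  obtains N F where "N \<in> modules Q I" "fhom Q M N F" "fsurj Q M N F"
    "\<And>v x. v \<in> verts Q \<Longrightarrow> x \<in> space M v \<Longrightarrow> F v x = 0 \<longleftrightarrow> x \<in> W v"
proof -
  have "\<exists>m C. lin C \<and> C ` space M v = V m \<and> (\<forall>x\<in>space M v. C x = 0 \<longleftrightarrow> x \<in> W v)" if v: "v \<in> verts Q" for v
    using W v quotient_coordinates[of "W v" "rdim M v"] unfolding subrep_def by metis
  then obtain m C where C: "\<And>v. v \<in> verts Q \<Longrightarrow> lin (C v)" "\<And>v. v \<in> verts Q \<Longrightarrow> C v ` space M v = V (m v)"
    "\<And>v x. v \<in> verts Q \<Longrightarrow> x \<in> space M v \<Longrightarrow> C v x = 0 \<longleftrightarrow> x \<in> W v" by metis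
  have "\<exists>G. lin G \<and> range G \<subseteq> space M v \<and> (\<forall>y\<in>V (m v). C v (G y) = y)" if v: "v \<in> verts Q" for v
    using right_inverse_on[OF C(1)[OF v] subspace_V, of "rdim M v"] C(2)[OF v] by metis
  then obtain G where G: "\<And>v. v \<in> verts Q \<Longrightarrow> lin (G v)" "\<And>v x. v \<in> verts Q \<Longrightarrow> G v x \<in> space M v"
    "\<And>v y. v \<in> verts Q \<Longrightarrow> y \<in> V (m v) \<Longrightarrow> C v (G v y) = y"
    by (metis rangeI subsetD)
  have CV: "C v x \<in> V (m v)" if "v \<in> verts Q" "x \<in> space M v" for v x
    using C(2)[OF that(1)] that(2) by blast
  define N where "N = Rep m (\<lambda>a. mat_of (m (head Q a)) (m (tail Q a))
     (\<lambda>x. C (head Q a) (act M a (G (tail Q a) x))))"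
  have dims: "dims_ok Q N" by (simp add: dims_ok_def N_def)
  have act: "act N a y = C (head Q a) (act M a (G (tail Q a) y))" if a: "a \<in> arcs Q" and y: "y \<in> V (m (tail Q a))" for a y
  proof -
    have "lin (\<lambda>x. C (head Q a) (act M a (G (tail Q a) x)))"
      by (rule lin_comp[OF lin_comp[OF G(1) lin_act] C(1)]) (use a in auto)
    then show ?thesis
      unfolding act_def N_def rep.sel
      by (rule mact_mat_of) (use CV act_in[OF modules_dims[OF M]] a y in \<open>auto simp flip: act_def\<close>)
  qed
  have F: "fhom Q M N C"
  proof (rule fhomI)
    fix a x assume a: "a \<in> arcs Q" and x: "x \<in> space M (tail Q a)"
    let ?y = "G (tail Q a) (C (tail Q a) x)"
    have y: "?y \<in> space M (tail Q a)" "C (tail Q a) ?y = C (tail Q a) x"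
      using a x CV G by auto
    have "C (tail Q a) (x - ?y) = 0" using lin_diff[OF C(1)[of "tail Q a"]] a y(2) by simp
    then have "x - ?y \<in> W (tail Q a)" using C(3)[of "tail Q a" "x - ?y"] a x y(1) by simp
    then have "act M a (x - ?y) \<in> W (head Q a)" using W a unfolding subrep_def by blast
    moreover have "act M a (x - ?y) \<in> space M (head Q a)" by (rule act_in[OF modules_dims[OF M] a])
    ultimately have "C (head Q a) (act M a (x - ?y)) = 0" using C(3) a by simp
    then have "C (head Q a) (act M a x) = C (head Q a) (act M a ?y)"
      using a by (simp add: lin_diff[OF lin_act] lin_diff[OF C(1)])
    then show "C (head Q a) (act M a x) = act N a (C (tail Q a) x)"
      using act[OF a] CV a x by simp
  qed (use C(1) CV in \<open>auto simp: N_def\<close>)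
  have surj: "fsurj Q M N C" using C(2) by (simp add: fsurj_def N_def)
  show thesis
    by (rule that[OF modules_surj[OF M dims F surj] F surj C(3)])
qed

end

section \<open>Biproducts\<close>

text \<open>Direct sums are described by their inclusions and projections, a description that is
  preserved by all additive functors and is independent of coordinates.\<close>

definition biprod :: "('v, 'e) pre_digraph \<Rightarrow> ('v, 'e, 'k::field) rep \<Rightarrow> ('v, 'e, 'k) rep \<Rightarrow> ('v, 'e, 'k) rep \<Rightarrow>
    ('v \<Rightarrow> (nat \<Rightarrow> 'k) \<Rightarrow> nat \<Rightarrow> 'k) \<Rightarrow> ('v \<Rightarrow> (nat \<Rightarrow> 'k) \<Rightarrow> nat \<Rightarrow> 'k) \<Rightarrow>
    ('v \<Rightarrow> (nat \<Rightarrow> 'k) \<Rightarrow> nat \<Rightarrow> 'k) \<Rightarrow> ('v \<Rightarrow> (nat \<Rightarrow> 'k) \<Rightarrow> nat \<Rightarrow> 'k) \<Rightarrow> bool" where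
  "biprod Q S M N i1 i2 p1 p2 \<longleftrightarrow>
     fhom Q M S i1 \<and> fhom Q N S i2 \<and> fhom Q S M p1 \<and> fhom Q S N p2 \<and>
     (\<forall>v\<in>verts Q. (\<forall>x\<in>space M v. p1 v (i1 v x) = x \<and> p2 v (i1 v x) = 0) \<and>
        (\<forall>y\<in>space N v. p2 v (i2 v y) = y \<and> p1 v (i2 v y) = 0) \<and>
        (\<forall>z\<in>space S v. i1 v (p1 v z) + i2 v (p2 v z) = z))"

definition isum :: "('v, 'e) pre_digraph \<Rightarrow> ('v, 'e, 'k::field) rep \<Rightarrow> ('v, 'e, 'k) rep \<Rightarrow> ('v, 'e, 'k) rep \<Rightarrow> bool" where
  "isum Q S M N \<longleftrightarrow> (\<exists>i1 i2 p1 p2. biprod Q S M N i1 i2 p1 p2)"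

definition riso :: "('v, 'e) pre_digraph \<Rightarrow> ('v, 'e, 'k::field) rep \<Rightarrow> ('v, 'e, 'k) rep \<Rightarrow> bool" where
  "riso Q M N \<longleftrightarrow> (\<exists>F. fhom Q M N F \<and> finj Q M F \<and> fsurj Q M N F)"

lemma biprodD:
  assumes "biprod Q S M N i1 i2 p1 p2"
  shows "fhom Q M S i1" "fhom Q N S i2" "fhom Q S M p1" "fhom Q S N p2"
    "\<And>v x. v \<in> verts Q \<Longrightarrow> x \<in> space M v \<Longrightarrow> p1 v (i1 v x) = x"
    "\<And>v x. v \<in> verts Q \<Longrightarrow> x \<in> space M v \<Longrightarrow> p2 v (i1 v x) = 0"
    "\<And>v x. v \<in> verts Q \<Longrightarrow> x \<in> space N v \<Longrightarrow> p2 v (i2 v x) = x"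
    "\<And>v x. v \<in> verts Q \<Longrightarrow> x \<in> space N v \<Longrightarrow> p1 v (i2 v x) = 0"
    "\<And>v x. v \<in> verts Q \<Longrightarrow> x \<in> space S v \<Longrightarrow> i1 v (p1 v x) + i2 v (p2 v x) = x"
  using assms unfolding biprod_def by simp_all

lemma biprodI:
  assumes "fhom Q M S i1" "fhom Q N S i2" "fhom Q S M p1" "fhom Q S N p2"
    "\<And>v x. v \<in> verts Q \<Longrightarrow> x \<in> space M v \<Longrightarrow> p1 v (i1 v x) = x"
    "\<And>v x. v \<in> verts Q \<Longrightarrow> x \<in> space M v \<Longrightarrow> p2 v (i1 v x) = 0"
    "\<And>v x. v \<in> verts Q \<Longrightarrow> x \<in> space N v \<Longrightarrow> p2 v (i2 v x) = x"
    "\<And>v x. v \<in> verts Q \<Longrightarrow> x \<in> space N v \<Longrightarrow> p1 v (i2 v x) = 0"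
    "\<And>v x. v \<in> verts Q \<Longrightarrow> x \<in> space S v \<Longrightarrow> i1 v (p1 v x) + i2 v (p2 v x) = x"
  shows "biprod Q S M N i1 i2 p1 p2"
  unfolding biprod_def using assms by simp

lemma isoI:
  assumes F: "fhom Q M N F" and H: "\<And>v y. v \<in> verts Q \<Longrightarrow> y \<in> space N v \<Longrightarrow> H v y \<in> space M v"
    and "\<And>v x. v \<in> verts Q \<Longrightarrow> x \<in> space M v \<Longrightarrow> H v (F v x) = x"
    and "\<And>v y. v \<in> verts Q \<Longrightarrow> y \<in> space N v \<Longrightarrow> F v (H v y) = y"
  shows "riso Q M N"
proof -
  have "finj Q M F" unfolding finj_def
    by (intro ballI) (rule inj_on_inverseI[of _ "H _"], rule assms)
  moreover have "fsurj Q M N F"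
    unfolding fsurj_def
  proof (intro ballI equalityI subsetI)
    fix v y assume v: "v \<in> verts Q" and y: "y \<in> space N v"
    from imageI[OF H[OF this], of "F v"] show "y \<in> F v ` space M v" using assms(4)[OF v y] by simp
  next
    fix v y assume "v \<in> verts Q" "y \<in> F v ` space M v"
    then show "y \<in> space N v" using fhomD(2)[OF F] by (elim imageE) simp
  qed
  ultimately show ?thesis using F unfolding riso_def by (intro exI conjI)
qed

lemma isoE:
  assumes "wf_digraph Q" "dims_ok Q M" "riso Q M N"
  obtains F H where "fhom Q M N F" "fhom Q N M H"
    "\<And>v x. v \<in> verts Q \<Longrightarrow> x \<in> space M v \<Longrightarrow> H v (F v x) = x"
    "\<And>v y. v \<in> verts Q \<Longrightarrow> y \<in> space N v \<Longrightarrow> F v (H v y) = y"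
proof -
  from assms(3) obtain F where F: "fhom Q M N F" "finj Q M F" "fsurj Q M N F"
    unfolding riso_def by (elim exE conjE)
  show thesis
    by (rule wf_digraph.fhom_inverse[OF assms(1,2) F]) (rule that[OF F(1)])
qed

lemma fsurjI:
  assumes F: "fhom Q M N F" and "\<And>v y. v \<in> verts Q \<Longrightarrow> y \<in> space N v \<Longrightarrow> \<exists>x\<in>space M v. F v x = y"
  shows "fsurj Q M N F"
  unfolding fsurj_def
proof (intro ballI equalityI subsetI)
  fix v y assume "v \<in> verts Q" "y \<in> space N v"
  then obtain x where "x \<in> space M v" "F v x = y" using assms(2) by metis
  then show "y \<in> F v ` space M v" by (metis imageI)
next
  fix v y assume "v \<in> verts Q" "y \<in> F v ` space M v"
  then show "y \<in> space N v" using fhomD(2)[OF F] by (elim imageE) simp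
qed

text \<open>In a direct sum of coordinate spaces, the first summand occupies the first n coordinates
  and the second one is shifted by n. The first inclusion is the identity.\<close>

definition inr :: "nat \<Rightarrow> (nat \<Rightarrow> 'k::field) \<Rightarrow> nat \<Rightarrow> 'k" where
  "inr n x = (\<lambda>i. if i < n then 0 else x (i - n))"

definition prl :: "nat \<Rightarrow> (nat \<Rightarrow> 'k::field) \<Rightarrow> nat \<Rightarrow> 'k" where
  "prl n x = (\<lambda>i. if i < n then x i else 0)"

definition prr :: "nat \<Rightarrow> (nat \<Rightarrow> 'k::field) \<Rightarrow> nat \<Rightarrow> 'k" where
  "prr n x = (\<lambda>i. x (i + n))"

lemma lin_inr: "lin (inr n)" and lin_prl: "lin (prl n)" and lin_prr: "lin (prr n)"
  by (rule linI; auto simp: inr_def prl_def prr_def scal_apply fun_eq_iff plus_fun_apply)+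

lemma sum_coords:
  "x \<in> V n \<Longrightarrow> x \<in> V (n + m)" "y \<in> V m \<Longrightarrow> inr n y \<in> V (n + m)"
  "prl n z \<in> V n" "z \<in> V (n + m) \<Longrightarrow> prr n z \<in> V m"
  "x \<in> V n \<Longrightarrow> prl n x = x" "x \<in> V n \<Longrightarrow> prr n x = 0" "prr n (inr n y) = y" "prl n (inr n y) = 0"
  "prl n z + inr n (prr n z) = z"
  by (auto simp: V_def inr_def prl_def prr_def fun_eq_iff plus_fun_apply zero_fun_apply)

lemma mact_block_diagonal:
  assumes A: "A \<in> carrier_mat n m" and D: "D \<in> carrier_mat n' m'"
  shows "mact (four_block_mat A (0\<^sub>m n m') (0\<^sub>m n' m) D) x = mact A (prl m x) + inr n (mact D (prr m x))"
proof
  fix i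
  have split: "(\<Sum>j<m + m'. f j) = (\<Sum>j<m. f j) + (\<Sum>j<m'. f (j + m))" for f :: "nat \<Rightarrow> 'a"
    by (induction m') (simp_all add: add.assoc add.commute)
  show "mact (four_block_mat A (0\<^sub>m n m') (0\<^sub>m n' m) D) x i = (mact A (prl m x) + inr n (mact D (prr m x))) i"
    using A D by (auto simp: mact_def split inr_def prl_def prr_def plus_fun_apply)
qed

context wf_digraph
begin

lemma dims_dsum: "dims_ok G M \<Longrightarrow> dims_ok G N \<Longrightarrow> dims_ok G (dsum G M N)"
  by (auto simp: dims_ok_def dsum_def)

lemma act_dsum:
  assumes "dims_ok G M" "dims_ok G N" "a \<in> arcs G"
  shows "act (dsum G M N) a x = act M a (prl (rdim M (tail G a)) x) +
    inr (rdim M (head G a)) (act N a (prr (rdim M (tail G a)) x))"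
  unfolding act_def dsum_def rep.sel
  by (rule mact_block_diagonal) (use assms in \<open>auto simp: dims_ok_def\<close>)

lemma biprod_dsum:
  assumes M: "dims_ok G M" and N: "dims_ok G N"
  shows "biprod G (dsum G M N) M N (\<lambda>v x. x) (\<lambda>v. inr (rdim M v)) (\<lambda>v. prl (rdim M v)) (\<lambda>v. prr (rdim M v))"
proof -
  have sp: "rdim (dsum G M N) v = rdim M v + rdim N v" for v by (simp add: dsum_def)
  have pl: "prl (rdim M (head G a)) (act M a z) = act M a z" "prr (rdim M (head G a)) (act M a z) = 0"
    if "a \<in> arcs G" for a z using act_in[OF M that] sum_coords by blast+
  show ?thesis
    by (rule biprodI; (rule fhomI)?)
       (simp_all add: sp sum_coords act_dsum[OF M N] lin_0[OF lin_act] lin_0[OF lin_inr] lin_inr lin_prl lin_prr lin_id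
          lin_add[OF lin_prl] lin_add[OF lin_prr] pl)
qed

lemma fhom_plus:
  assumes "fhom G M N F" "fhom G M N H"
  shows "fhom G M N (\<lambda>v x. F v x + H v x)"
  by (rule fhomI) (simp_all add: fhomD[OF assms(1)] fhomD[OF assms(2)] lin_plus lin_add[OF lin_act])

lemma isum_iso:
  assumes S: "dims_ok G S" and M: "dims_ok G M" and N: "dims_ok G N" and T: "dims_ok G T"
    and M': "dims_ok G M'" and N': "dims_ok G N'"
    and SMN: "isum G S M N" and TMN: "isum G T M' N'" and "riso G M M'" "riso G N N'"
  shows "riso G S T"
proof -
  obtain i1 i2 p1 p2 where b: "biprod G S M N i1 i2 p1 p2" using SMN unfolding isum_def by blast
  obtain j1 j2 q1 q2 where c: "biprod G T M' N' j1 j2 q1 q2" using TMN unfolding isum_def by blast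
  note b = biprodD[OF b] and c = biprodD[OF c]
  obtain F H where F: "fhom G M M' F" "fhom G M' M H"
    "\<And>v x. v \<in> verts G \<Longrightarrow> x \<in> space M v \<Longrightarrow> H v (F v x) = x"
    "\<And>v y. v \<in> verts G \<Longrightarrow> y \<in> space M' v \<Longrightarrow> F v (H v y) = y"
    using isoE[OF wf_digraph_axioms M assms(9)] by blast
  obtain F' H' where F': "fhom G N N' F'" "fhom G N' N H'"
    "\<And>v x. v \<in> verts G \<Longrightarrow> x \<in> space N v \<Longrightarrow> H' v (F' v x) = x"
    "\<And>v y. v \<in> verts G \<Longrightarrow> y \<in> space N' v \<Longrightarrow> F' v (H' v y) = y"
    using isoE[OF wf_digraph_axioms N assms(10)] by blast
  note in_rules = fhomD(2)[OF b(1)] fhomD(2)[OF b(2)] fhomD(2)[OF b(3)] fhomD(2)[OF b(4)]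
    fhomD(2)[OF c(1)] fhomD(2)[OF c(2)] fhomD(2)[OF c(3)] fhomD(2)[OF c(4)]
    fhomD(2)[OF F(1)] fhomD(2)[OF F(2)] fhomD(2)[OF F'(1)] fhomD(2)[OF F'(2)]
  note lins = lin_add[OF fhomD(1)[OF b(3)]] lin_add[OF fhomD(1)[OF b(4)]]
     lin_add[OF fhomD(1)[OF c(3)]] lin_add[OF fhomD(1)[OF c(4)]]
  show ?thesis
  proof (rule isoI[of G S T "\<lambda>v z. j1 v (F v (p1 v z)) + j2 v (F' v (p2 v z))"
        "\<lambda>v z. i1 v (H v (q1 v z)) + i2 v (H' v (q2 v z))"])
    show "fhom G S T (\<lambda>v z. j1 v (F v (p1 v z)) + j2 v (F' v (p2 v z)))"
      by (rule fhom_plus[OF fhom_comp[OF M' fhom_comp[OF M b(3) F(1)] c(1)]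
            fhom_comp[OF N' fhom_comp[OF N b(4) F'(1)] c(2)]])
  qed (simp_all add: in_rules b c lins F F')
qed

lemma iso_refl: "riso G M M"
  by (rule isoI[OF fhom_id, of _ _ "\<lambda>v x. x"]) simp_all

lemma iso_sym: "dims_ok G M \<Longrightarrow> riso G M N \<Longrightarrow> riso G N M"
proof -
  assume M: "dims_ok G M" and MN: "riso G M N"
  obtain F H where F: "fhom G M N F" "fhom G N M H"
    "\<And>v x. v \<in> verts G \<Longrightarrow> x \<in> space M v \<Longrightarrow> H v (F v x) = x"
    "\<And>v y. v \<in> verts G \<Longrightarrow> y \<in> space N v \<Longrightarrow> F v (H v y) = y"
    using isoE[OF wf_digraph_axioms M MN] by blast
  show "riso G N M" by (rule isoI[OF F(2), of F]) (simp_all add: F fhomD(2)[OF F(1)])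
qed

lemma iso_trans:
  assumes "dims_ok G L" "dims_ok G M" "riso G L M" "riso G M N"
  shows "riso G L N"
proof -
  obtain F H where F: "fhom G L M F" "fhom G M L H"
    "\<And>v x. v \<in> verts G \<Longrightarrow> x \<in> space L v \<Longrightarrow> H v (F v x) = x"
    "\<And>v y. v \<in> verts G \<Longrightarrow> y \<in> space M v \<Longrightarrow> F v (H v y) = y"
    using isoE[OF wf_digraph_axioms assms(1,3)] by blast
  obtain F' H' where F': "fhom G M N F'" "fhom G N M H'"
    "\<And>v x. v \<in> verts G \<Longrightarrow> x \<in> space M v \<Longrightarrow> H' v (F' v x) = x"
    "\<And>v y. v \<in> verts G \<Longrightarrow> y \<in> space N v \<Longrightarrow> F' v (H' v y) = y"
    using isoE[OF wf_digraph_axioms assms(2,4)] by blast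
  show ?thesis
    by (rule isoI[OF fhom_comp[OF assms(2) F(1) F'(1)], of "\<lambda>v x. H v (H' v x)"])
       (simp_all add: F F' fhomD(2)[OF F(1)] fhomD(2)[OF F(2)] fhomD(2)[OF F'(2)])
qed

lemma isomorphic_iff_iso: "dims_ok G M \<Longrightarrow> dims_ok G N \<Longrightarrow> isomorphic G M N \<longleftrightarrow> riso G M N"
  unfolding riso_def by (rule isomorphic_iff)

lemma isum_dsum: "dims_ok G M \<Longrightarrow> dims_ok G N \<Longrightarrow> isum G (dsum G M N) M N"
  unfolding isum_def using biprod_dsum by blast

lemma isum_transport:
  assumes "dims_ok G S" "dims_ok G M" "dims_ok G N" "isum G S M N" "riso G T S" "dims_ok G T"
  shows "isum G T M N"
proof -
  obtain i1 i2 p1 p2 where b: "biprod G S M N i1 i2 p1 p2" using assms(4) unfolding isum_def by blast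
  note b = biprodD[OF b]
  obtain F H where F: "fhom G T S F" "fhom G S T H"
    "\<And>v x. v \<in> verts G \<Longrightarrow> x \<in> space T v \<Longrightarrow> H v (F v x) = x"
    "\<And>v y. v \<in> verts G \<Longrightarrow> y \<in> space S v \<Longrightarrow> F v (H v y) = y"
    using isoE[OF wf_digraph_axioms assms(6,5)] by blast
  have add: "H v (x + y) = H v x + H v y" if "v \<in> verts G" for v x y
    by (rule lin_add[OF fhomD(1)[OF F(2) that]])
  have "biprod G T M N (\<lambda>v x. H v (i1 v x)) (\<lambda>v x. H v (i2 v x)) (\<lambda>v x. p1 v (F v x)) (\<lambda>v x. p2 v (F v x))"
    by (rule biprodI; (rule fhom_comp, rule assms, rule b F, rule b F)?)
       (simp_all add: b F fhomD(2)[OF b(1)] fhomD(2)[OF b(2)] fhomD(2)[OF F(1)] flip: add)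
  then show ?thesis unfolding isum_def by blast
qed

lemma isomorphic_dsum_iff:
  assumes "dims_ok G S" "dims_ok G M" "dims_ok G N"
  shows "isomorphic G S (dsum G M N) \<longleftrightarrow> isum G S M N"
  unfolding isomorphic_iff_iso[OF assms(1) dims_dsum[OF assms(2,3)]]
  using isum_transport[OF dims_dsum[OF assms(2,3)] assms(2,3) isum_dsum[OF assms(2,3)] _ assms(1)]
    isum_iso[OF assms dims_dsum[OF assms(2,3)] assms(2,3) _ isum_dsum[OF assms(2,3)] iso_refl iso_refl]
  by blast

lemma isum_commute: "isum G S M N \<Longrightarrow> isum G S N M"
  unfolding isum_def biprod_def by (metis add.commute)

end

context bound_quiver_algebra
begin

lemma isum_module:
  assumes S: "dims_ok Q S" and M: "M \<in> modules Q I" and N: "N \<in> modules Q I" and s: "isum Q S M N"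
  shows "S \<in> modules Q I"
  unfolding modules_iff
proof (intro conjI ballI S)
  obtain i1 i2 p1 p2 where b: "biprod Q S M N i1 i2 p1 p2" using s unfolding isum_def by blast
  note b = biprodD[OF b]
  fix f u v z assume f: "f \<in> I" and uv: "u \<in> verts Q" "v \<in> verts Q" and z: "z \<in> space S u"
  have 1: "elemact S f u v (i1 u (p1 u z)) = 0"
  proof -
    have y: "p1 u z \<in> space M u" using fhomD(2)[OF b(3) uv(1) z] .
    then have "elemact M f u v (p1 u z) = 0" using M f uv unfolding modules_iff by blast
    then show ?thesis
      using fhom_elemact[OF modules_dims[OF M] b(1) uv(2) I_keys[OF f] y] lin_0[OF fhomD(1)[OF b(1) uv(2)]]
      by simp
  qed
  have 2: "elemact S f u v (i2 u (p2 u z)) = 0"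
  proof -
    have y: "p2 u z \<in> space N u" using fhomD(2)[OF b(4) uv(1) z] .
    then have "elemact N f u v (p2 u z) = 0" using N f uv unfolding modules_iff by blast
    then show ?thesis
      using fhom_elemact[OF modules_dims[OF N] b(2) uv(2) I_keys[OF f] y] lin_0[OF fhomD(1)[OF b(2) uv(2)]]
      by simp
  qed
  show "elemact S f u v z = 0"
    using elemact_add[of S f u v "i1 u (p1 u z)" "i2 u (p2 u z)"] b(9)[OF uv(1) z] 1 2 by simp
qed

lemma dsum_module: "M \<in> modules Q I \<Longrightarrow> N \<in> modules Q I \<Longrightarrow> dsum Q M N \<in> modules Q I"
  by (meson isum_module dims_dsum isum_dsum modules_dims)

end

section \<open>The radical\<close>

text \<open>The radical of a module is the sum of the images of the arrows, since the radical of the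
  algebra is generated by the arrows.\<close>

definition rad :: "('v, 'e) pre_digraph \<Rightarrow> ('v, 'e, 'k::field) rep \<Rightarrow> 'v \<Rightarrow> (nat \<Rightarrow> 'k) set" where
  "rad Q M v = fv.span (\<Union>a\<in>{a \<in> arcs Q. head Q a = v}. act M a ` space M (tail Q a))"

text \<open>For a surjective morphism this says that it is essential.\<close>

definition rad_ker :: "('v, 'e) pre_digraph \<Rightarrow> ('v, 'e, 'k::field) rep \<Rightarrow>
    ('v \<Rightarrow> (nat \<Rightarrow> 'k) \<Rightarrow> nat \<Rightarrow> 'k) \<Rightarrow> bool" where
  "rad_ker Q P \<pi> \<longleftrightarrow> (\<forall>v\<in>verts Q. \<forall>x\<in>space P v. \<pi> v x = 0 \<longrightarrow> x \<in> rad Q P v)"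

lemma subspace_rad: "fv.subspace (rad Q M v)"
  unfolding rad_def by (rule fv.subspace_span)

lemma act_in_rad: "a \<in> arcs Q \<Longrightarrow> x \<in> space M (tail Q a) \<Longrightarrow> act M a x \<in> rad Q M (head Q a)"
  unfolding rad_def by (rule subsetD[OF fv.span_superset]) blast

text \<open>To check that a linear map annihilates the radical, or that the radical lies in a
  subspace, it is enough to look at the images of the arrows.\<close>

lemma rad_subset:
  assumes "fv.subspace W" "\<And>a x. a \<in> arcs Q \<Longrightarrow> head Q a = v \<Longrightarrow> x \<in> space M (tail Q a) \<Longrightarrow> act M a x \<in> W"
  shows "rad Q M v \<subseteq> W"
  unfolding rad_def by (rule fv.span_minimal) (use assms in auto)

lemma rad_induct:
  assumes x: "x \<in> rad Q M v" and "P 0" "\<And>c x y. P x \<Longrightarrow> P y \<Longrightarrow> P (x + y)" "\<And>c x. P x \<Longrightarrow> P (scal c x)"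
    "\<And>a y. a \<in> arcs Q \<Longrightarrow> head Q a = v \<Longrightarrow> y \<in> space M (tail Q a) \<Longrightarrow> P (act M a y)"
  shows "P x"
proof -
  have "rad Q M v \<subseteq> {x. P x}"
    by (rule rad_subset) (use assms in \<open>auto simp: fv.subspace_def\<close>)
  then show ?thesis using x by auto
qed

lemma rad_kill:
  assumes F: "lin F" "\<And>a x. a \<in> arcs Q \<Longrightarrow> head Q a = v \<Longrightarrow> x \<in> space M (tail Q a) \<Longrightarrow> F (act M a x) = 0"
    and x: "x \<in> rad Q M v"
  shows "F x = 0"
  using x by (rule rad_induct) (simp_all add: F(2) lin_0[OF F(1)] lin_add[OF F(1)] lin_scal[OF F(1)])

lemma fhom_rad:
  assumes F: "fhom Q M N F" and v: "v \<in> verts Q" and Q: "wf_digraph Q" and x: "x \<in> rad Q M v"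
  shows "F v x \<in> rad Q N v"
proof -
  note lin = fhomD(1)[OF F v]
  show ?thesis
    using x
  proof (rule rad_induct)
    fix a y assume a: "a \<in> arcs Q" "head Q a = v" and y: "y \<in> space M (tail Q a)"
    have "F v (act M a y) = act N a (F (tail Q a) y)" using fhomD(3)[OF F a(1) y] a(2) by simp
    also have "\<dots> \<in> rad Q N v"
      using act_in_rad[OF a(1)] fhomD(2)[OF F _ y] a wf_digraph.tail_in_verts[OF Q] by metis
    finally show "F v (act M a y) \<in> rad Q N v" .
  qed (simp_all add: lin_0[OF lin] lin_add[OF lin] lin_scal[OF lin]
      fv.subspace_0[OF subspace_rad] fv.subspace_add[OF subspace_rad] fv.subspace_scale[OF subspace_rad])
qed

text \<open>A surjection maps radical onto radical: arrow images have preimages that are arrow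
  images.\<close>

lemma fhom_rad_lift:
  assumes F: "fhom Q M N F" and surj: "fsurj Q M N F" and v: "v \<in> verts Q" and Q: "wf_digraph Q"
    and y: "y \<in> rad Q N v"
  shows "\<exists>x\<in>rad Q M v. F v x = y"
proof -
  note lin = fhomD(1)[OF F v]
  show ?thesis
    using y
  proof (rule rad_induct)
    show "\<exists>x\<in>rad Q M v. F v x = 0"
      by (intro bexI[of _ 0]) (simp_all add: lin_0[OF lin] fv.subspace_0[OF subspace_rad])
  next
    fix y z assume "\<exists>x\<in>rad Q M v. F v x = y" "\<exists>x\<in>rad Q M v. F v x = z"
    then obtain x x' where "x \<in> rad Q M v" "x' \<in> rad Q M v" "F v x = y" "F v x' = z" by blast
    then show "\<exists>x\<in>rad Q M v. F v x = y + z"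
      by (intro bexI[of _ "x + x'"]) (simp_all add: lin_add[OF lin] fv.subspace_add[OF subspace_rad])
  next
    fix c y assume "\<exists>x\<in>rad Q M v. F v x = y"
    then obtain x where "x \<in> rad Q M v" "F v x = y" by blast
    then show "\<exists>x\<in>rad Q M v. F v x = scal c y"
      by (intro bexI[of _ "scal c x"]) (simp_all add: lin_scal[OF lin] fv.subspace_scale[OF subspace_rad])
  next
    fix a y assume a: "a \<in> arcs Q" "head Q a = v" and y: "y \<in> space N (tail Q a)"
    obtain x where x: "x \<in> space M (tail Q a)" "F (tail Q a) x = y"
      using fsurjD[OF surj wf_digraph.tail_in_verts[OF Q a(1)] y] by blast
    then have "F v (act M a x) = act N a y" using fhomD(3)[OF F a(1) x(1)] a(2) by simp
    then show "\<exists>x\<in>rad Q M v. F v x = act N a y" using act_in_rad[OF a(1) x(1)] a(2) by blast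
  qed
qed

lemma (in wf_digraph) rad_in_space: "dims_ok G M \<Longrightarrow> x \<in> rad G M v \<Longrightarrow> x \<in> space M v"
  by (erule rad_induct) (auto intro: act_in)

lemma (in wf_digraph) subrep_rad: "dims_ok G M \<Longrightarrow> subrep G M (rad G M)"
  unfolding subrep_def by (auto simp: subspace_rad intro: rad_in_space act_in_rad)

context bound_quiver_algebra
begin

text \<open>Nakayama's lemma. A linear map at v that kills W but not everything can be pulled back along
  a longest path that it does not kill; the result kills the arrow images, hence the radical, and
  still kills W.\<close>

lemma Nakayama:
  assumes M: "M \<in> modules Q I" and W: "subrep Q M W"
    and gen: "\<And>v x. v \<in> verts Q \<Longrightarrow> x \<in> space M v \<Longrightarrow> \<exists>w\<in>W v. x - w \<in> rad Q M v"
    and v: "v \<in> verts Q"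
  shows "W v = space M v"
proof (rule ccontr)
  assume "W v \<noteq> space M v"
  then obtain x where x: "x \<in> space M v" "x \<notin> W v" using W v unfolding subrep_def by blast
  have "fv.subspace (W v)" using W v unfolding subrep_def by blast
  then obtain F where F: "lin F" "\<And>y. y \<in> W v \<Longrightarrow> F y = 0" "F x \<noteq> 0"
    by (rule subspace_separation[OF _ x(2)]) blast
  \<comment> \<open>The lengths of paths along which F pulls back to a nonzero map.\<close>
  define R where "R n \<longleftrightarrow> (\<exists>u p y. awalk u p v \<and> length p = n \<and> y \<in> space M u \<and> F (pathact M p y) \<noteq> 0)" for n
  have "R 0" using x F v by (auto simp: R_def awalk_Nil_iff)
  moreover have bound: "n \<le> nilp" if "R n" for n
  proof (rule ccontr)
    assume "\<not> n \<le> nilp"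
    then show False using that pathact_zero[OF M] lin_0[OF F(1)] unfolding R_def by force
  qed
  ultimately obtain k where k: "R k" and great: "\<And>n. R n \<Longrightarrow> n \<le> k"
    using GreatestI_nat[of R 0 nilp] Greatest_le_nat[of R _ nilp] by blast
  from k obtain u p y where p: "awalk u p v" "length p = k" and y: "y \<in> space M u" "F (pathact M p y) \<noteq> 0"
    unfolding R_def by blast
  have u: "u \<in> verts Q" using p(1) by auto
  obtain w where w: "w \<in> W u" "y - w \<in> rad Q M u" using gen[OF u y(1)] by blast
  have lp: "lin (\<lambda>z. F (pathact M p z))" by (rule lin_comp[OF lin_pathact F(1)])
  have "F (pathact M p (y - w)) = 0"
  proof (rule rad_kill[OF lp _ w(2)])
    fix a z assume a: "a \<in> arcs Q" "head Q a = u" and z: "z \<in> space M (tail Q a)"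
    show "F (pathact M p (act M a z)) = 0"
    proof (rule ccontr)
      assume "F (pathact M p (act M a z)) \<noteq> 0"
      moreover have "awalk (tail Q a) (a # p) v" using a p(1) by (simp add: awalk_Cons_iff)
      ultimately have "R (Suc k)"
        unfolding R_def using z p(2) by (intro exI[of _ "tail Q a"] exI[of _ "a # p"] exI[of _ z]) simp
      then show False using great[of "Suc k"] by simp
    qed
  qed
  moreover have "F (pathact M p w) = 0" by (rule F(2)[OF subrep_pathact[OF W p(1) w(1)]])
  ultimately show False using y(2) lin_diff[OF lp, of y w] by simp
qed

end

section \<open>Projective covers\<close>

definition fproj :: "('v, 'e) pre_digraph \<Rightarrow> (('v, 'e) path \<Rightarrow>\<^sub>0 'k::field) set \<Rightarrow> ('v, 'e, 'k) rep \<Rightarrow> bool" where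
  "fproj Q I P \<longleftrightarrow> P \<in> modules Q I \<and>
     (\<forall>M\<in>modules Q I. \<forall>N\<in>modules Q I. \<forall>G F.
        fhom Q M N G \<longrightarrow> fsurj Q M N G \<longrightarrow> fhom Q P N F \<longrightarrow>
        (\<exists>H. fhom Q P M H \<and> (\<forall>v\<in>verts Q. \<forall>x\<in>space P v. G v (H v x) = F v x)))"

text \<open>Essential epimorphisms from a projective are described by their kernel lying in the radical.\<close>

definition fcover :: "('v, 'e) pre_digraph \<Rightarrow> (('v, 'e) path \<Rightarrow>\<^sub>0 'k::field) set \<Rightarrow> ('v, 'e, 'k) rep \<Rightarrow>
    ('v \<Rightarrow> (nat \<Rightarrow> 'k) \<Rightarrow> nat \<Rightarrow> 'k) \<Rightarrow> ('v, 'e, 'k) rep \<Rightarrow> bool" where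
  "fcover Q I P \<pi> M \<longleftrightarrow> fproj Q I P \<and> M \<in> modules Q I \<and> fhom Q P M \<pi> \<and> fsurj Q P M \<pi> \<and> rad_ker Q P \<pi>"

definition fker :: "('v, 'e) pre_digraph \<Rightarrow> ('v, 'e, 'k::field) rep \<Rightarrow> ('v \<Rightarrow> (nat \<Rightarrow> 'k) \<Rightarrow> nat \<Rightarrow> 'k) \<Rightarrow>
    ('v, 'e, 'k) rep \<Rightarrow> ('v \<Rightarrow> (nat \<Rightarrow> 'k) \<Rightarrow> nat \<Rightarrow> 'k) \<Rightarrow> bool" where
  "fker Q N \<iota> P \<pi> \<longleftrightarrow> fhom Q N P \<iota> \<and> finj Q N \<iota> \<and>
     (\<forall>v\<in>verts Q. \<iota> v ` space N v = {x \<in> space P v. \<pi> v x = 0})"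

lemma image_eqD: "f ` A = B \<Longrightarrow> y \<in> B \<Longrightarrow> \<exists>x\<in>A. f x = y"
  by auto

lemma rad_kerD:
  assumes "rad_ker Q P \<pi>" "v \<in> verts Q" "x \<in> space P v" "\<pi> v x = 0"
  shows "x \<in> rad Q P v"
  using assms unfolding rad_ker_def by simp

lemma fprojD:
  assumes "fproj Q I P"
  shows "P \<in> modules Q I"
    and "M \<in> modules Q I \<Longrightarrow> N \<in> modules Q I \<Longrightarrow> fhom Q M N G \<Longrightarrow> fsurj Q M N G \<Longrightarrow> fhom Q P N F \<Longrightarrow>
      \<exists>H. fhom Q P M H \<and> (\<forall>v\<in>verts Q. \<forall>x\<in>space P v. G v (H v x) = F v x)"
  using assms unfolding fproj_def by simp_all

lemma fcoverD:
  assumes "fcover Q I P \<pi> M"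
  shows "fproj Q I P" "P \<in> modules Q I" "M \<in> modules Q I" "fhom Q P M \<pi>" "fsurj Q P M \<pi>" "rad_ker Q P \<pi>"
  using assms unfolding fcover_def fproj_def by simp_all

lemma fsurj_cong:
  assumes "\<And>v x. v \<in> verts Q \<Longrightarrow> x \<in> space M v \<Longrightarrow> F v x = H v x"
  shows "fsurj Q M N F \<longleftrightarrow> fsurj Q M N H"
proof -
  have "F v ` space M v = H v ` space M v" if "v \<in> verts Q" for v
    by (rule image_cong[OF refl assms[OF that]])
  then show ?thesis unfolding fsurj_def by simp
qed

lemma fsurj_comp:
  assumes "fsurj Q L M F" "fsurj Q M N H"
  shows "fsurj Q L N (\<lambda>v x. H v (F v x))"
  unfolding fsurj_def
proof
  fix v assume v: "v \<in> verts Q"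
  have "(\<lambda>x. H v (F v x)) ` space L v = H v ` (F v ` space L v)" by (simp add: image_image)
  also have "\<dots> = space N v" using assms v unfolding fsurj_def by simp
  finally show "(\<lambda>x. H v (F v x)) ` space L v = space N v" .
qed

lemma (in wf_digraph) subrep_image:
  assumes "fhom G L M F"  "dims_ok G L"
  shows "subrep G M (\<lambda>v. F v ` space L v)"
  unfolding subrep_def
proof (intro conjI ballI)
  fix v assume v: "v \<in> verts G"
  show "fv.subspace (F v ` space L v)"
    by (rule fvp.linear_subspace_image[OF fhomD(1)[OF assms(1) v] subspace_V])
  show "F v ` space L v \<subseteq> space M v" using fhomD(2)[OF assms(1) v] by (rule image_subsetI)
next
  fix a x assume a: "a \<in> arcs G" and "x \<in> F (tail G a) ` space L (tail G a)"
  then obtain y where y: "y \<in> space L (tail G a)" "x = F (tail G a) y" by blast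
  then have "act M a x = F (head G a) (act L a y)" using fhomD(3)[OF assms(1) a y(1)] by simp
  then show "act M a x \<in> F (head G a) ` space L (head G a)"
    using act_in[OF assms(2) a] by (metis imageI)
qed

text \<open>The universal property of a kernel: the factorisation is obtained from left inverses of
  the inclusion, and commutes with the arrows because the inclusion is injective.\<close>

lemma (in wf_digraph) inj_factor:
  assumes N: "dims_ok G N" and L: "dims_ok G L" and \<iota>: "fhom G N P \<iota>" "finj G N \<iota>" and F: "fhom G L P F"
    and im: "\<And>v x. v \<in> verts G \<Longrightarrow> x \<in> space L v \<Longrightarrow> F v x \<in> \<iota> v ` space N v"
  obtains H where "fhom G L N H" "\<And>v x. v \<in> verts G \<Longrightarrow> x \<in> space L v \<Longrightarrow> \<iota> v (H v x) = F v x"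
proof -
  have "\<exists>G'. lin G' \<and> (\<forall>y. G' y \<in> space N v) \<and> (\<forall>x\<in>space N v. G' (\<iota> v x) = x)" if v: "v \<in> verts G" for v
  proof -
    have "inj_on (\<iota> v) (space N v)" using \<iota>(2) v unfolding finj_def by simp
    from left_inverse_on[OF fhomD(1)[OF \<iota>(1) v] subspace_V this]
    obtain G' where "lin G'" "range G' \<subseteq> space N v" "\<And>x. x \<in> space N v \<Longrightarrow> G' (\<iota> v x) = x" by metis
    then show ?thesis by (intro exI[of _ G']) (simp add: image_subset_iff)
  qed
  then obtain G' where G': "\<And>v. v \<in> verts G \<Longrightarrow> lin (G' v)" "\<And>v y. v \<in> verts G \<Longrightarrow> G' v y \<in> space N v"
    "\<And>v x. v \<in> verts G \<Longrightarrow> x \<in> space N v \<Longrightarrow> G' v (\<iota> v x) = x" by metis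
  have e: "\<iota> v (G' v (F v x)) = F v x" if v: "v \<in> verts G" and x: "x \<in> space L v" for v x
  proof -
    obtain y where "y \<in> space N v" "F v x = \<iota> v y" using im[OF v x] by blast
    then show ?thesis using G'(3)[OF v] by simp
  qed
  have "fhom G L N (\<lambda>v x. G' v (F v x))"
  proof (rule fhomI)
    fix a x assume a: "a \<in> arcs G" and x: "x \<in> space L (tail G a)"
    have v: "tail G a \<in> verts G" "head G a \<in> verts G" using a by auto
    have "\<iota> (head G a) (G' (head G a) (F (head G a) (act L a x))) = F (head G a) (act L a x)"
      by (rule e[OF v(2) act_in[OF L a]])
    also have "\<dots> = act P a (\<iota> (tail G a) (G' (tail G a) (F (tail G a) x)))"
      using fhomD(3)[OF F a x] e[OF v(1) x] by simp
    also have "\<dots> = \<iota> (head G a) (act N a (G' (tail G a) (F (tail G a) x)))"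
      using fhomD(3)[OF \<iota>(1) a G'(2)[OF v(1)]] by simp
    finally show "G' (head G a) (F (head G a) (act L a x)) = act N a (G' (tail G a) (F (tail G a) x))"
      using G'(3)[OF v(2)] G'(2)[OF v(2)] act_in[OF N a] by metis
  qed (simp_all add: G' lin_comp[OF fhomD(1)[OF F]])
  then show thesis by (rule that) (rule e)
qed

context bound_quiver_algebra
begin

text \<open>Essential epimorphisms are those with kernel in the radical. One direction is Nakayama's
  lemma; for the other, an element of the kernel outside the radical is missed by a hyperplane
  containing the radical, which is a proper submodule that still surjects.\<close>

lemma rad_ker_essential:
  assumes P: "P \<in> modules Q I" and \<pi>: "fhom Q P M \<pi>" "rad_ker Q P \<pi>"
    and L: "dims_ok Q L" and h: "fhom Q L P h" and surj: "fsurj Q L M (\<lambda>v x. \<pi> v (h v x))"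
  shows "fsurj Q L P h"
  unfolding fsurj_def
proof
  fix v assume v: "v \<in> verts Q"
  show "h v ` space L v = space P v"
  proof (rule Nakayama[OF P subrep_image[OF h L] _ v])
    fix u x assume u: "u \<in> verts Q" and x: "x \<in> space P u"
    obtain y where y: "y \<in> space L u" "\<pi> u (h u y) = \<pi> u x"
      using fsurjD[OF surj u fhomD(2)[OF \<pi>(1) u x]] by blast
    have "\<pi> u (x - h u y) = 0" using lin_diff[OF fhomD(1)[OF \<pi>(1) u]] y(2) by simp
    moreover have "x - h u y \<in> space P u" using x fhomD(2)[OF h u y(1)] by simp
    ultimately have "x - h u y \<in> rad Q P u" by (intro rad_kerD[OF \<pi>(2) u])
    then show "\<exists>w\<in>h u ` space L u. x - w \<in> rad Q P u" using y(1) by blast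
  qed
qed

lemma essential_rad_ker:
  assumes P: "P \<in> modules Q I" and \<pi>: "fhom Q P M \<pi>" "fsurj Q P M \<pi>"
    and ess: "\<And>L h. L \<in> modules Q I \<Longrightarrow> fhom Q L P h \<Longrightarrow> fsurj Q L M (\<lambda>v x. \<pi> v (h v x)) \<Longrightarrow> fsurj Q L P h"
  shows "rad_ker Q P \<pi>"
  unfolding rad_ker_def
proof (intro ballI impI)
  fix w x assume w: "w \<in> verts Q" and x: "x \<in> space P w" and \<pi>x: "\<pi> w x = 0"
  show "x \<in> rad Q P w"
  proof (rule ccontr)
    assume "x \<notin> rad Q P w"
    then obtain F where F: "lin F" "\<And>y. y \<in> rad Q P w \<Longrightarrow> F y = 0" "F x \<noteq> 0"
      using subspace_separation[OF subspace_rad] by metis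
    then obtain i where i: "F x i \<noteq> 0" by (metis ext zero_fun_def)
    \<comment> \<open>The hyperplane at w; it is a subrepresentation since it contains all images of
      arrows.\<close>
    define W where "W u = (if u = w then {y \<in> space P u. F y i = 0} else space P u)" for u
    have W: "subrep Q P W"
      unfolding subrep_def
    proof (intro conjI ballI)
      fix u
      show "fv.subspace (W u)"
        by (auto simp: W_def fv.subspace_def lin_0[OF F(1)] lin_add[OF F(1)] lin_scal[OF F(1)]
              plus_fun_apply zero_fun_apply scal_apply)
      show "W u \<subseteq> space P u" by (auto simp: W_def)
    next
      fix a y assume a: "a \<in> arcs Q" and "y \<in> W (tail Q a)"
      then have y: "y \<in> space P (tail Q a)" by (auto simp: W_def split: if_splits)
      have "F (act P a y) = 0" if "head Q a = w" using F(2) act_in_rad[OF a y] that by simp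
      then show "act P a y \<in> W (head Q a)"
        using act_in[OF modules_dims[OF P] a, of y] by (auto simp: W_def zero_fun_apply)
    qed
    obtain L h where L: "L \<in> modules Q I" "fhom Q L P h" "finj Q L h" "\<And>v. v \<in> verts Q \<Longrightarrow> h v ` space L v = W v"
      using subrep_module[OF P W] by metis
    have "fsurj Q L M (\<lambda>v z. \<pi> v (h v z))"
    proof (rule fsurjI[OF fhom_comp[OF modules_dims[OF P] L(2) \<pi>(1)]])
      fix v y assume v: "v \<in> verts Q" and "y \<in> space M v"
      then obtain z where z: "z \<in> space P v" "\<pi> v z = y" using fsurjD[OF \<pi>(2)] by blast
      have "\<exists>z'\<in>W v. \<pi> v z' = y"
      proof (cases "v = w")
        case True
        \<comment> \<open>The lift z of y is corrected by a multiple of x, which lies in the kernel,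
          to make its i-th coordinate under F vanish.\<close>
        let ?z = "z - scal (F z i / F x i) x"
        have "?z \<in> W v"
          using z(1) x True i
          by (simp add: W_def lin_diff[OF F(1)] lin_scal[OF F(1)] minus_apply scal_apply)
        moreover have "\<pi> v ?z = y"
          using z(2) \<pi>x True by (simp add: lin_diff[OF fhomD(1)[OF \<pi>(1) w]] lin_scal[OF fhomD(1)[OF \<pi>(1) w]])
        ultimately show ?thesis by blast
      next
        case False
        then show ?thesis using z by (auto simp: W_def)
      qed
      then obtain z' where "z' \<in> W v" "\<pi> v z' = y" by blast
      moreover obtain t where "t \<in> space L v" "h v t = z'"
        using image_eqD[OF L(4)[OF v] \<open>z' \<in> W v\<close>] by blast
      ultimately show "\<exists>t\<in>space L v. \<pi> v (h v t) = y" by blast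
    qed
    then have "fsurj Q L P h" by (rule ess[OF L(1,2)])
    then have "W w = space P w" using L(4)[OF w] w unfolding fsurj_def by simp
    then have "x \<in> W w" using x by simp
    then show False using i by (simp add: W_def)
  qed
qed

text \<open>Essential epimorphisms compose. The kernel of the composite consists of elements whose
  image lies in the radical; modulo the kernel of the first map these can be lifted to radical
  elements.\<close>

lemma rad_ker_comp:
  assumes \<pi>: "fhom Q P M \<pi>" "fsurj Q P M \<pi>" "rad_ker Q P \<pi>" and t: "rad_ker Q M t" and P: "dims_ok Q P"
  shows "rad_ker Q P (\<lambda>v x. t v (\<pi> v x))"
  unfolding rad_ker_def
proof (intro ballI impI)
  fix v x assume v: "v \<in> verts Q" and x: "x \<in> space P v" and z: "t v (\<pi> v x) = 0"
  have "\<pi> v x \<in> rad Q M v" by (rule rad_kerD[OF t v fhomD(2)[OF \<pi>(1) v x] z])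
  from fhom_rad_lift[OF \<pi>(1,2) v wf_digraph_axioms this]
  obtain y where y: "y \<in> rad Q P v" "\<pi> v y = \<pi> v x" by (elim bexE)
  have "x - y \<in> space P v" using x rad_in_space[OF P y(1)] by simp
  moreover have "\<pi> v (x - y) = 0" using y(2) lin_diff[OF fhomD(1)[OF \<pi>(1) v]] by simp
  ultimately have "x - y \<in> rad Q P v" by (intro rad_kerD[OF \<pi>(3) v])
  from fv.subspace_add[OF subspace_rad this y(1)] show "x \<in> rad Q P v" by simp
qed

subsection \<open>Existence of projective covers\<close>

text \<open>The index set for the generators of an essential extension: a start vertex, a path that
  is short enough to act nontrivially, and a basis vector of M at the start vertex.\<close>

definition path_index :: "('v, 'e, 'k) rep \<Rightarrow> ('v \<times> 'e list \<times> nat) set" where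
  "path_index M = (SIGMA u:verts Q. {p. set p \<subseteq> arcs Q \<and> length p \<le> nilp} \<times> {..<rdim M u})"

lemma finite_path_index: "finite (path_index M)"
  unfolding path_index_def
  by (intro finite_SigmaI finite_cartesian_product finite_lists_length_le) auto

text \<open>An essential extension of M is generated by lifts of the basis vectors of M, hence spanned by
  their images under the finitely many paths that can act nontrivially. This bounds its size.\<close>

lemma essential_dim_bound:
  assumes L: "L \<in> modules Q I" and \<pi>: "fhom Q L M \<pi>" "fsurj Q L M \<pi>" "rad_ker Q L \<pi>" and v: "v \<in> verts Q"
  shows "rdim L v \<le> Suc (card (path_index M))"
proof -
  have "\<exists>s. lin s \<and> (\<forall>y. s y \<in> space L u) \<and> (\<forall>y\<in>space M u. \<pi> u (s y) = y)" if u: "u \<in> verts Q" for u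
  proof -
    have im: "\<pi> u ` space L u = space M u" using \<pi>(2) u unfolding fsurj_def by simp
    from right_inverse_on[OF fhomD(1)[OF \<pi>(1) u] subspace_V, of "rdim L u"] obtain s where
      "lin s" "range s \<subseteq> space L u" "\<And>y. y \<in> \<pi> u ` space L u \<Longrightarrow> \<pi> u (s y) = y" by metis
    then show ?thesis unfolding im by (intro exI[of _ s]) (simp add: image_subset_iff)
  qed
  then obtain s where s: "\<And>u. u \<in> verts Q \<Longrightarrow> lin (s u)" "\<And>u y. u \<in> verts Q \<Longrightarrow> s u y \<in> space L u"
    "\<And>u y. u \<in> verts Q \<Longrightarrow> y \<in> space M u \<Longrightarrow> \<pi> u (s u y) = y" by metis
  define S where "S w = {pathact L p (s u (unit i)) | u p i. awalk u p w \<and> i < rdim M u}" for w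
  have Ssp: "x \<in> space L w" if "x \<in> S w" for x w
  proof -
    obtain u p i where "awalk u p w" "x = pathact L p (s u (unit i))" using \<open>x \<in> S w\<close> unfolding S_def by blast
    then show ?thesis using pathact_in[OF modules_dims[OF L]] s(2) by (metis awalk_hd_in_verts)
  qed
  have sub: "subrep Q L (\<lambda>w. fv.span (S w))"
    unfolding subrep_def
  proof (intro conjI ballI)
    fix w show "fv.subspace (fv.span (S w))" by (rule fv.subspace_span)
    show "fv.span (S w) \<subseteq> space L w" by (rule fv.span_minimal[OF _ subspace_V]) (use Ssp in blast)
  next
    fix a x assume a: "a \<in> arcs Q" and x: "x \<in> fv.span (S (tail Q a))"
    have "act L a ` S (tail Q a) \<subseteq> S (head Q a)"
    proof (rule image_subsetI)
      fix y assume "y \<in> S (tail Q a)"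
      then obtain u p i where p: "awalk u p (tail Q a)" "i < rdim M u" "y = pathact L p (s u (unit i))"
        unfolding S_def by blast
      have "awalk u (p @ [a]) (head Q a)" using p(1) a by (auto simp: awalk_append_iff awalk_Cons_iff awalk_Nil_iff)
      moreover have "act L a y = pathact L (p @ [a]) (s u (unit i))" using p(3) by (simp add: pathact_append)
      ultimately show "act L a y \<in> S (head Q a)" using p(2) unfolding S_def by blast
    qed
    then have "fv.span (act L a ` S (tail Q a)) \<subseteq> fv.span (S (head Q a))" by (rule fv.span_mono)
    moreover have "act L a x \<in> fv.span (act L a ` S (tail Q a))"
      using imageI[OF x, of "act L a"] by (simp add: fvp.linear_span_image[OF lin_act])
    ultimately show "act L a x \<in> fv.span (S (head Q a))" by blast
  qed
  have "fv.span (S v) = space L v"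
  proof (rule Nakayama[OF L sub _ v])
    fix w x assume w: "w \<in> verts Q" and x: "x \<in> space L w"
    let ?y = "s w (\<pi> w x)"
    have "\<pi> w x = (\<Sum>i<rdim M w. scal (\<pi> w x i) (unit i))"
      by (rule V_expand[OF fhomD(2)[OF \<pi>(1) w x]])
    then have "?y = s w (\<Sum>i<rdim M w. scal (\<pi> w x i) (unit i))" by (rule arg_cong)
    also have "\<dots> = (\<Sum>i<rdim M w. scal (\<pi> w x i) (s w (unit i)))"
      by (simp only: lin_sum[OF s(1)[OF w]] lin_scal[OF s(1)[OF w]])
    also have "\<dots> \<in> fv.span (S w)"
    proof (intro fv.span_sum fv.span_scale)
      fix i assume "i \<in> {..<rdim M w}"
      then have "pathact L [] (s w (unit i)) \<in> S w"
        unfolding S_def using w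
        by (intro CollectI exI[of _ w] exI[of _ "[]"] exI[of _ i] conjI) (simp_all add: awalk_Nil_iff)
      then show "s w (unit i) \<in> fv.span (S w)" using fv.span_superset[of "S w"] by auto
    qed
    finally have y: "?y \<in> fv.span (S w)" .
    have "\<pi> w (x - ?y) = 0"
      using lin_diff[OF fhomD(1)[OF \<pi>(1) w]] s(3)[OF w fhomD(2)[OF \<pi>(1) w x]] by simp
    moreover have "x - ?y \<in> space L w" using x s(2)[OF w] by simp
    ultimately have "x - ?y \<in> rad Q L w" by (intro rad_kerD[OF \<pi>(3) w])
    then show "\<exists>y\<in>fv.span (S w). x - y \<in> rad Q L w" using y by blast
  qed
  \<comment> \<open>Paths longer than the nilpotency bound contribute only 0, which is added to keep
    the index set finite.\<close>
  moreover define T where "T = insert 0 ((\<lambda>(u, p, i). pathact L p (s u (unit i))) ` path_index M)"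
  have "S v \<subseteq> T"
  proof
    fix x assume "x \<in> S v"
    then obtain u p i where p: "awalk u p v" "i < rdim M u" "x = pathact L p (s u (unit i))" unfolding S_def by blast
    then have u: "u \<in> verts Q" by auto
    show "x \<in> T"
    proof (cases "length p \<le> nilp")
      case True
      then have "(u, p, i) \<in> path_index M" using p u by (auto simp: path_index_def)
      then show ?thesis using p(3) unfolding T_def by force
    next
      case False
      then show ?thesis using pathact_zero[OF L p(1) _ s(2)[OF u]] p(3) by (simp add: T_def)
    qed
  qed
  ultimately have "space L v \<subseteq> fv.span T" using fv.span_mono[of "S v" T] by simp
  moreover have "finite T" by (simp add: T_def finite_path_index)
  ultimately have "rdim L v \<le> card T" by (rule spanning_card)
  also have "\<dots> \<le> Suc (card ((\<lambda>(u, p, i). pathact L p (s u (unit i))) ` path_index M))"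
    unfolding T_def by (rule card_insert_le_m1[of "Suc _", simplified]) simp_all
  also have "\<dots> \<le> Suc (card (path_index M))"
    using card_image_le[OF finite_path_index, of "\<lambda>(u, p, i). pathact L p (s u (unit i))"] by simp
  finally show ?thesis .
qed

text \<open>The total dimension serves as the measure for all maximality and minimality
  arguments.\<close>

definition tdim :: "('v, 'e, 'k) rep \<Rightarrow> nat" where
  "tdim M = (\<Sum>v\<in>verts Q. rdim M v)"

lemma tdim_inj:
  assumes h: "fhom Q L M h" "finj Q L h"
  shows "tdim L \<le> tdim M" "tdim M \<le> tdim L \<Longrightarrow> fsurj Q L M h"
proof -
  have sub: "h v ` space L v \<subseteq> space M v" if "v \<in> verts Q" for v
    using fhomD(2)[OF h(1) that] by (rule image_subsetI)
  have inj: "inj_on (h v) (space L v)" if "v \<in> verts Q" for v using h(2) that unfolding finj_def by simp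
  have le: "rdim L v \<le> rdim M v" if "v \<in> verts Q" for v
    by (rule inj_dim_le(1)[OF fhomD(1)[OF h(1) that] sub[OF that] inj[OF that]])
  then show "tdim L \<le> tdim M" unfolding tdim_def by (rule sum_mono)
  assume "tdim M \<le> tdim L"
  then have eq: "rdim L v = rdim M v" if "v \<in> verts Q" for v
    using le sum_strict_mono_ex1[of "verts Q" "rdim L" "rdim M"] that unfolding tdim_def by fastforce
  show "fsurj Q L M h"
    unfolding fsurj_def
    by (intro ballI) (rule inj_dim_le(2)[OF fhomD(1)[OF h(1)] sub inj eq])
qed

lemma tdim_surj:
  assumes h: "fhom Q L M h" "fsurj Q L M h"
  shows "tdim M \<le> tdim L" "tdim L \<le> tdim M \<Longrightarrow> finj Q L h"
proof -
  have im: "h v ` space L v = space M v" if "v \<in> verts Q" for v using h(2) that unfolding fsurj_def by simp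
  have le: "rdim M v \<le> rdim L v" if "v \<in> verts Q" for v
    by (rule surj_dim_le(1)[OF fhomD(1)[OF h(1) that] im[OF that]])
  then show "tdim M \<le> tdim L" unfolding tdim_def by (rule sum_mono)
  assume "tdim L \<le> tdim M"
  then have eq: "rdim L v = rdim M v" if "v \<in> verts Q" for v
    using le sum_strict_mono_ex1[of "verts Q" "rdim M" "rdim L"] that unfolding tdim_def by fastforce
  show "finj Q L h"
    unfolding finj_def
    by (intro ballI) (rule surj_dim_le(2)[OF fhomD(1)[OF h(1)] im eq])
qed

text \<open>Every surjection onto P becomes essential after restriction to a suitable subobject,
  namely to one of least dimension that still surjects.\<close>

lemma essential_restriction:
  assumes T: "T \<in> modules Q I" and q: "fhom Q T P q" "fsurj Q T P q"
  obtains L l where "L \<in> modules Q I" "fhom Q L T l" "fsurj Q L P (\<lambda>v x. q v (l v x))"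
    "rad_ker Q L (\<lambda>v x. q v (l v x))"
proof -
  define R where "R = (\<lambda>(L, l). L \<in> modules Q I \<and> fhom Q L T l \<and> fsurj Q L P (\<lambda>v x. q v (l v x)))"
  have "R (T, \<lambda>v x. x)" using T q fhom_id unfolding R_def by simp
  from ex_has_least_nat[of R, OF this, of "\<lambda>z. tdim (fst z)"]
  obtain z where "R z" and least0: "\<And>z'. R z' \<Longrightarrow> tdim (fst z) \<le> tdim (fst z')" by blast
  obtain L l where z: "z = (L, l)" by (cases z)
  with \<open>R z\<close> have L: "L \<in> modules Q I" "fhom Q L T l" "fsurj Q L P (\<lambda>v x. q v (l v x))" unfolding R_def by simp_all
  have least: "tdim L \<le> tdim N" if "N \<in> modules Q I" "fhom Q N T k" "fsurj Q N P (\<lambda>v x. q v (k v x))" for N k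
    using least0[of "(N, k)"] that unfolding R_def z by simp
  note ql = fhom_comp[OF modules_dims[OF T] L(2) q(1)]
  have "rad_ker Q L (\<lambda>v x. q v (l v x))"
  proof (rule essential_rad_ker[OF L(1) ql L(3)])
    fix K h assume K: "K \<in> modules Q I" and h: "fhom Q K L h" and surj: "fsurj Q K P (\<lambda>v x. q v (l v (h v x)))"
    obtain N j where N: "N \<in> modules Q I" "fhom Q N L j" "finj Q N j"
      "\<And>v. v \<in> verts Q \<Longrightarrow> j v ` space N v = h v ` space K v"
      using subrep_module[OF L(1) subrep_image[OF h modules_dims[OF K]]] by metis
    note lj = fhom_comp[OF modules_dims[OF L(1)] N(2) L(2)]
    have "fsurj Q N P (\<lambda>v x. q v (l v (j v x)))"
    proof (rule fsurjI[OF fhom_comp[OF modules_dims[OF T] lj q(1)]])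
      fix v y assume v: "v \<in> verts Q" and "y \<in> space P v"
      then obtain x where x: "x \<in> space K v" "q v (l v (h v x)) = y" using fsurjD[OF surj] by blast
      obtain x' where "x' \<in> space N v" "j v x' = h v x" 
        using image_eqD[OF N(4)[OF v] imageI[OF x(1)]] by blast
      then show "\<exists>x\<in>space N v. q v (l v (j v x)) = y" using x(2) by (intro bexI[of _ x']) simp_all
    qed
    then have "tdim L \<le> tdim N" by (rule least[OF N(1) lj])
    then have "fsurj Q N L j" by (rule tdim_inj(2)[OF N(2,3)])
    then show "fsurj Q K L h" using N(4) unfolding fsurj_def by simp
  qed
  then show thesis by (rule that[OF L])
qed

text \<open>An essential extension of M of largest dimension is projective. A lifting problem for it has
  a pullback, some submodule of which maps onto it essentially; by maximality this map is bijective, and its inverse provides the lift.\<close>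

lemma cover_exists:
  assumes M: "M \<in> modules Q I"
  obtains P \<pi> where "fcover Q I P \<pi> M"
proof -
  define R where "R = (\<lambda>(L, l). L \<in> modules Q I \<and> fhom Q L M l \<and> fsurj Q L M l \<and> rad_ker Q L l)"
  have "rad_ker Q M (\<lambda>v x. x)" unfolding rad_ker_def by (simp add: fv.subspace_0[OF subspace_rad])
  moreover have "fsurj Q M M (\<lambda>v x. x)" unfolding fsurj_def by simp
  ultimately have R0: "R (M, \<lambda>v x. x)" using M fhom_id unfolding R_def by simp
  have bound: "tdim (fst z) \<le> card (verts Q) * Suc (card (path_index M))" if "R z" for z
  proof -
    obtain L l where z: "z = (L, l)" by (cases z)
    with \<open>R z\<close> have L: "L \<in> modules Q I" "fhom Q L M l" "fsurj Q L M l" "rad_ker Q L l"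
      unfolding R_def by simp_all
    show ?thesis
      unfolding z tdim_def fst_conv
      using sum_bounded_above[of "verts Q" "rdim L" "Suc (card (path_index M))"] essential_dim_bound[OF L] by simp
  qed
  have "\<exists>z. R z \<and> (\<forall>z'. R z' \<longrightarrow> tdim (fst z') \<le> tdim (fst z))"
  proof (rule ex_has_greatest_nat[of R])
    show "\<forall>z. R z \<longrightarrow> tdim (fst z) < Suc (card (verts Q) * Suc (card (path_index M)))"
      using bound by (simp only: less_Suc_eq_le) blast
  qed (rule R0)
  then obtain z where "R z" and great0: "\<And>z'. R z' \<Longrightarrow> tdim (fst z') \<le> tdim (fst z)" by blast
  obtain P \<pi> where z: "z = (P, \<pi>)" by (cases z)
  with \<open>R z\<close> have P: "P \<in> modules Q I" "fhom Q P M \<pi>" "fsurj Q P M \<pi>" "rad_ker Q P \<pi>" unfolding R_def by simp_all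
  have great: "tdim L \<le> tdim P" if "L \<in> modules Q I" "fhom Q L M l" "fsurj Q L M l" "rad_ker Q L l" for L l
    using great0[of "(L, l)"] that unfolding R_def z by simp
  note dP = modules_dims[OF P(1)]
  have "fproj Q I P"
    unfolding fproj_def
  proof (intro conjI ballI allI impI P(1))
    fix U Y G F assume U: "U \<in> modules Q I" and Y: "Y \<in> modules Q I"
      and G: "fhom Q U Y G" "fsurj Q U Y G" and F: "fhom Q P Y F"
    note dU = modules_dims[OF U]
    let ?D = "dsum Q P U"
    have D: "?D \<in> modules Q I" by (rule dsum_module[OF P(1) U])
    obtain i1 i2 p1 p2 where b: "biprod Q ?D P U i1 i2 p1 p2"
      using isum_dsum[OF dP dU] unfolding isum_def by (elim exE)
    note b = biprodD[OF b]
    \<comment> \<open>The pullback of F and G, as a subrepresentation of the direct sum.\<close>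
    define W where "W v = {z \<in> space ?D v. F v (p1 v z) = G v (p2 v z)}" for v
    have W: "subrep Q ?D W"
      unfolding subrep_def
    proof (intro conjI ballI)
      fix v assume v: "v \<in> verts Q"
      show "fv.subspace (W v)"
        unfolding W_def fv.subspace_def
        by (auto simp: lin_0[OF fhomD(1)[OF b(3) v]] lin_0[OF fhomD(1)[OF b(4) v]] lin_0[OF fhomD(1)[OF F v]]
              lin_0[OF fhomD(1)[OF G(1) v]] lin_add[OF fhomD(1)[OF b(3) v]] lin_add[OF fhomD(1)[OF b(4) v]]
              lin_add[OF fhomD(1)[OF F v]] lin_add[OF fhomD(1)[OF G(1) v]] lin_scal[OF fhomD(1)[OF b(3) v]]
              lin_scal[OF fhomD(1)[OF b(4) v]] lin_scal[OF fhomD(1)[OF F v]] lin_scal[OF fhomD(1)[OF G(1) v]])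
      show "W v \<subseteq> space ?D v" unfolding W_def by blast
    next
      fix a z assume a: "a \<in> arcs Q" and "z \<in> W (tail Q a)"
      then have z: "z \<in> space ?D (tail Q a)" "F (tail Q a) (p1 (tail Q a) z) = G (tail Q a) (p2 (tail Q a) z)"
        unfolding W_def by simp_all
      have t: "tail Q a \<in> verts Q" using a by simp
      show "act ?D a z \<in> W (head Q a)"
        unfolding W_def
        using act_in[OF modules_dims[OF D] a] z(2) fhomD(3)[OF b(3) a z(1)] fhomD(3)[OF b(4) a z(1)]
          fhomD(3)[OF F a fhomD(2)[OF b(3) t z(1)]] fhomD(3)[OF G(1) a fhomD(2)[OF b(4) t z(1)]] by simp
    qed
    obtain T \<iota> where T: "T \<in> modules Q I" "fhom Q T ?D \<iota>" "finj Q T \<iota>" "\<And>v. v \<in> verts Q \<Longrightarrow> \<iota> v ` space T v = W v"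
      using subrep_module[OF D W] by metis
    have TW: "F v (p1 v (\<iota> v x)) = G v (p2 v (\<iota> v x))" if "v \<in> verts Q" "x \<in> space T v" for v x
      using T(4)[OF that(1)] imageI[OF that(2), of "\<iota> v"] unfolding W_def by simp
    note q = fhom_comp[OF modules_dims[OF D] T(2) b(3)]
    have qs: "fsurj Q T P (\<lambda>v x. p1 v (\<iota> v x))"
    proof (rule fsurjI[OF q])
      fix v y assume v: "v \<in> verts Q" and y: "y \<in> space P v"
      obtain x where x: "x \<in> space U v" "G v x = F v y" using fsurjD[OF G(2) v fhomD(2)[OF F v y]] by blast
      let ?z = "i1 v y + i2 v x"
      have "?z \<in> W v"
        unfolding W_def
        using fhomD(2)[OF b(1) v y] fhomD(2)[OF b(2) v x(1)] x(2) v y x(1)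
        by (simp add: lin_add[OF fhomD(1)[OF b(3) v]] lin_add[OF fhomD(1)[OF b(4) v]] b(5-8))
      then obtain t where t: "t \<in> space T v" "\<iota> v t = ?z" 
        using image_eqD[OF T(4)[OF v]] by blast
      have "p1 v ?z = y" using v y x(1) by (simp add: lin_add[OF fhomD(1)[OF b(3) v]] b(5-8))
      then show "\<exists>t\<in>space T v. p1 v (\<iota> v t) = y" using t by (intro bexI[of _ t]) simp_all
    qed
    obtain L l where L: "L \<in> modules Q I" "fhom Q L T l" "fsurj Q L P (\<lambda>v x. p1 v (\<iota> v (l v x)))"
      "rad_ker Q L (\<lambda>v x. p1 v (\<iota> v (l v x)))"
      using essential_restriction[OF T(1) q qs] .
    note dL = modules_dims[OF L(1)]
    note h = fhom_comp[OF modules_dims[OF T(1)] L(2) q]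
    have "tdim L \<le> tdim P"
      by (rule great[OF L(1) fhom_comp[OF dP h P(2)] fsurj_comp[OF L(3) P(3)] rad_ker_comp[OF h L(3,4) P(4) dL]])
    then have "finj Q L (\<lambda>v x. p1 v (\<iota> v (l v x)))" by (rule tdim_surj(2)[OF h L(3)])
    note inv = fhom_inverse[OF dL h this L(3)]
    obtain k where k: "fhom Q P L k"
      "\<And>v x. v \<in> verts Q \<Longrightarrow> x \<in> space L v \<Longrightarrow> k v (p1 v (\<iota> v (l v x))) = x"
      "\<And>v y. v \<in> verts Q \<Longrightarrow> y \<in> space P v \<Longrightarrow> p1 v (\<iota> v (l v (k v y))) = y"
      using inv by blast
    show "\<exists>H. fhom Q P U H \<and> (\<forall>v\<in>verts Q. \<forall>x\<in>space P v. G v (H v x) = F v x)"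
    proof (intro exI conjI ballI)
      show "fhom Q P U (\<lambda>v x. p2 v (\<iota> v (l v (k v x))))"
        by (rule fhom_comp[OF dL k(1) fhom_comp[OF modules_dims[OF T(1)] L(2) fhom_comp[OF modules_dims[OF D] T(2) b(4)]]])
      fix v x assume v: "v \<in> verts Q" and x: "x \<in> space P v"
      have "F v (p1 v (\<iota> v (l v (k v x)))) = G v (p2 v (\<iota> v (l v (k v x))))"
        by (rule TW[OF v fhomD(2)[OF L(2) v fhomD(2)[OF k(1) v x]]])
      then show "G v (p2 v (\<iota> v (l v (k v x)))) = F v x" by (simp only: k(3)[OF v x])
    qed
  qed
  then have "fcover Q I P \<pi> M" unfolding fcover_def using P M by simp
  then show thesis by (rule that)
qed

end

section \<open>Syzygies\<close>

definition is_syz :: "('v, 'e) pre_digraph \<Rightarrow> (('v, 'e) path \<Rightarrow>\<^sub>0 'k::field) set \<Rightarrow> ('v, 'e, 'k) rep \<Rightarrow>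
    ('v, 'e, 'k) rep \<Rightarrow> bool" where
  "is_syz Q I N M \<longleftrightarrow> N \<in> modules Q I \<and> (\<exists>P \<pi> \<iota>. fcover Q I P \<pi> M \<and> fker Q N \<iota> P \<pi>)"

lemma fkerD:
  assumes "fker Q N \<iota> P \<pi>"
  shows "fhom Q N P \<iota>" "finj Q N \<iota>"
    and "v \<in> verts Q \<Longrightarrow> x \<in> space N v \<Longrightarrow> \<pi> v (\<iota> v x) = 0"
    and "v \<in> verts Q \<Longrightarrow> y \<in> space P v \<Longrightarrow> \<pi> v y = 0 \<Longrightarrow> \<exists>x\<in>space N v. \<iota> v x = y"
proof -
  show "fhom Q N P \<iota>" "finj Q N \<iota>" using assms unfolding fker_def by simp_all
  have im: "\<iota> v ` space N v = {x \<in> space P v. \<pi> v x = 0}" if "v \<in> verts Q" for v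
    using assms that unfolding fker_def by simp
  show "\<pi> v (\<iota> v x) = 0" if "v \<in> verts Q" "x \<in> space N v"
    using imageI[OF that(2), of "\<iota> v"] unfolding im[OF that(1)] by simp
  show "\<exists>x\<in>space N v. \<iota> v x = y" if "v \<in> verts Q" "y \<in> space P v" "\<pi> v y = 0"
    by (rule image_eqD[OF im[OF that(1)]]) (simp add: that)
qed

lemma fkerI:
  assumes \<iota>: "fhom Q N P \<iota>"
    and "\<And>v x. v \<in> verts Q \<Longrightarrow> x \<in> space N v \<Longrightarrow> \<iota> v x = 0 \<Longrightarrow> x = 0"
    and z: "\<And>v x. v \<in> verts Q \<Longrightarrow> x \<in> space N v \<Longrightarrow> \<pi> v (\<iota> v x) = 0"
    and s: "\<And>v y. v \<in> verts Q \<Longrightarrow> y \<in> space P v \<Longrightarrow> \<pi> v y = 0 \<Longrightarrow> \<exists>x\<in>space N v. \<iota> v x = y"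
  shows "fker Q N \<iota> P \<pi>"
  unfolding fker_def
proof (intro conjI ballI)
  show "finj Q N \<iota>" unfolding finj_iff[OF \<iota>] using assms(2) by simp
  fix v assume v: "v \<in> verts Q"
  show "\<iota> v ` space N v = {x \<in> space P v. \<pi> v x = 0}"
  proof (intro equalityI subsetI)
    fix y assume "y \<in> \<iota> v ` space N v"
    then show "y \<in> {x \<in> space P v. \<pi> v x = 0}"
      using fhomD(2)[OF \<iota> v] z[OF v] by (elim imageE) simp
  next
    fix y assume "y \<in> {x \<in> space P v. \<pi> v x = 0}"
    then obtain x where "x \<in> space N v" "\<iota> v x = y" using s[OF v] by auto
    then show "y \<in> \<iota> v ` space N v" by (metis imageI)
  qed
qed (rule \<iota>)

context bound_quiver_algebra
begin

subsection \<open>Agreement with the matrix level notions\<close>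

lemma homs_carrier: "f \<in> homs Q M N \<Longrightarrow> v \<in> verts Q \<Longrightarrow> f v \<in> carrier_mat (rdim N v) (rdim M v)"
  by (simp add: homs_def)

lemma surjective_hom_iff: "f \<in> homs Q M N \<Longrightarrow> surjective Q M N f \<longleftrightarrow> fsurj Q M N (\<lambda>v. mact (f v))"
  by (rule surjective_iff) (rule homs_carrier)

lemma projective_iff: "projective Q I P \<longleftrightarrow> fproj Q I P"
proof
  assume P: "projective Q I P"
  then have PM: "P \<in> modules Q I" by (simp add: projective_def)
  show "fproj Q I P"
    unfolding fproj_def
  proof (intro conjI ballI allI impI PM)
    fix M N G F assume M: "M \<in> modules Q I" and N: "N \<in> modules Q I"
      and G: "fhom Q M N G" "fsurj Q M N G" and F: "fhom Q P N F"
    note d = modules_dims[OF M] modules_dims[OF N] modules_dims[OF PM]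
    obtain g where g: "g \<in> homs Q M N" "\<And>v x. v \<in> verts Q \<Longrightarrow> x \<in> space M v \<Longrightarrow> mact (g v) x = G v x"
      using fhom_homs[OF d(1,2) G(1)] by blast
    obtain f where f: "f \<in> homs Q P N" "\<And>v x. v \<in> verts Q \<Longrightarrow> x \<in> space P v \<Longrightarrow> mact (f v) x = F v x"
      using fhom_homs[OF d(3,2) F] by blast
    have "surjective Q M N g"
      unfolding surjective_hom_iff[OF g(1)]
      using G(2) fsurj_cong[of Q M "\<lambda>v. mact (g v)" G N] g(2) by simp
    then obtain h where h: "h \<in> homs Q P M" "hom_eq Q (hom_comp g h) f"
      using P M N g(1) f(1) unfolding projective_def by blast
    show "\<exists>H. fhom Q P M H \<and> (\<forall>v\<in>verts Q. \<forall>x\<in>space P v. G v (H v x) = F v x)"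
    proof (intro exI conjI ballI)
      show "fhom Q P M (\<lambda>v. mact (h v))" by (rule homs_fhom[OF d(3,1) h(1)])
      fix v x assume v: "v \<in> verts Q" and x: "x \<in> space P v"
      have "G v (mact (h v) x) = mact (g v) (mact (h v) x)"
        using g(2)[OF v mact_in_V[OF homs_carrier[OF h(1) v]]] by simp
      also have "\<dots> = mact (g v * h v) x"
        by (rule mact_mult[OF homs_carrier[OF g(1) v] homs_carrier[OF h(1) v], symmetric])
      also have "\<dots> = F v x" using h(2) v f(2)[OF v x] by (simp add: hom_eq_def hom_comp_def)
      finally show "G v (mact (h v) x) = F v x" .
    qed
  qed
next
  assume P: "fproj Q I P"
  note PM = fprojD(1)[OF P]
  show "projective Q I P"
    unfolding projective_def
  proof (intro conjI ballI impI PM)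
    fix M N g f assume M: "M \<in> modules Q I" and N: "N \<in> modules Q I" and g: "g \<in> homs Q M N"
      and f: "f \<in> homs Q P N" and surj: "surjective Q M N g"
    note d = modules_dims[OF M] modules_dims[OF N] modules_dims[OF PM]
    have "fsurj Q M N (\<lambda>v. mact (g v))"
      using surj unfolding surjective_hom_iff[OF g] .
    from fprojD(2)[OF P M N homs_fhom[OF d(1,2) g] this homs_fhom[OF d(3,2) f]]
    obtain H where H: "fhom Q P M H" "\<And>v x. v \<in> verts Q \<Longrightarrow> x \<in> space P v \<Longrightarrow> mact (g v) (H v x) = mact (f v) x"
      by blast
    obtain h where h: "h \<in> homs Q P M" "\<And>v x. v \<in> verts Q \<Longrightarrow> x \<in> space P v \<Longrightarrow> mact (h v) x = H v x"
      using fhom_homs[OF d(3,1) H(1)] by blast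
    have "g v * h v = f v" if v: "v \<in> verts Q" for v
    proof -
      note c = homs_carrier[OF g v] homs_carrier[OF h(1) v]
      show ?thesis
        unfolding mat_eq_iff_mact[OF mult_carrier_mat[OF c] homs_carrier[OF f v]]
        using H(2)[OF v] h(2)[OF v] by (simp add: mact_mult[OF c])
    qed
    then show "\<exists>h\<in>homs Q P M. hom_eq Q (hom_comp g h) f"
      by (intro bexI[OF _ h(1)]) (simp add: hom_eq_def hom_comp_def)
  qed
qed

lemma fsurj_hom_comp:
  assumes "\<pi> \<in> homs Q P M" "h \<in> homs Q L P"
  shows "surjective Q L M (hom_comp \<pi> h) \<longleftrightarrow> fsurj Q L M (\<lambda>v x. mact (\<pi> v) (mact (h v) x))"
proof -
  have "surjective Q L M (hom_comp \<pi> h) \<longleftrightarrow> fsurj Q L M (\<lambda>v. mact (hom_comp \<pi> h v))"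
    by (rule surjective_iff) (auto simp: hom_comp_def intro!: mult_carrier_mat homs_carrier[OF assms(1)] homs_carrier[OF assms(2)])
  also have "\<dots> \<longleftrightarrow> fsurj Q L M (\<lambda>v x. mact (\<pi> v) (mact (h v) x))"
    by (rule fsurj_cong) (simp add: hom_comp_def mact_mult[OF homs_carrier[OF assms(1)] homs_carrier[OF assms(2)]])
  finally show ?thesis .
qed

text \<open>In a projective cover the defining condition, that a map which surjects after
  composition with the cover is surjective itself, is equivalent to the kernel being
  radical.\<close>

lemma projective_cover_fcover:
  assumes c: "projective_cover Q I P \<pi> M"
  shows "\<pi> \<in> homs Q P M" "fcover Q I P (\<lambda>v. mact (\<pi> v)) M"
proof -
  have P: "fproj Q I P" and M: "M \<in> modules Q I" and \<pi>: "\<pi> \<in> homs Q P M" and surj: "surjective Q P M \<pi>"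
    and ess: "\<And>L h. L \<in> modules Q I \<Longrightarrow> h \<in> homs Q L P \<Longrightarrow> surjective Q L M (hom_comp \<pi> h) \<Longrightarrow> surjective Q L P h"
    using c unfolding projective_cover_def projective_iff by simp_all
  show "\<pi> \<in> homs Q P M" by (rule \<pi>)
  note PM = fprojD(1)[OF P]
  note d = modules_dims[OF PM] modules_dims[OF M]
  have \<pi>': "fhom Q P M (\<lambda>v. mact (\<pi> v))" "fsurj Q P M (\<lambda>v. mact (\<pi> v))"
    using homs_fhom[OF d \<pi>] surj surjective_hom_iff[OF \<pi>] by simp_all
  have "rad_ker Q P (\<lambda>v. mact (\<pi> v))"
  proof (rule essential_rad_ker[OF PM \<pi>'])
    fix L F assume L: "L \<in> modules Q I" and F: "fhom Q L P F" and s: "fsurj Q L M (\<lambda>v x. mact (\<pi> v) (F v x))"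
    obtain h where h: "h \<in> homs Q L P" "\<And>v x. v \<in> verts Q \<Longrightarrow> x \<in> space L v \<Longrightarrow> mact (h v) x = F v x"
      using fhom_homs[OF modules_dims[OF L] d(1) F] by blast
    have "fsurj Q L M (\<lambda>v x. mact (\<pi> v) (mact (h v) x))"
      using s fsurj_cong[of Q L "\<lambda>v x. mact (\<pi> v) (mact (h v) x)" "\<lambda>v x. mact (\<pi> v) (F v x)" M] h(2) by simp
    then have "surjective Q L P h" by (intro ess[OF L h(1)]) (simp only: fsurj_hom_comp[OF \<pi> h(1)])
    then have "fsurj Q L P (\<lambda>v. mact (h v))" by (simp only: surjective_hom_iff[OF h(1)])
    then show "fsurj Q L P F" using fsurj_cong[of Q L "\<lambda>v. mact (h v)" F P] h(2) by simp
  qed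
  then show "fcover Q I P (\<lambda>v. mact (\<pi> v)) M" unfolding fcover_def using P M \<pi>' by simp
qed

lemma fcover_projective_cover:
  assumes c: "fcover Q I P F M" and \<pi>: "\<pi> \<in> homs Q P M"
    and e: "\<And>v x. v \<in> verts Q \<Longrightarrow> x \<in> space P v \<Longrightarrow> mact (\<pi> v) x = F v x"
  shows "projective_cover Q I P \<pi> M"
proof -
  note c = fcoverD[OF c]
  note d = modules_dims[OF c(2)] modules_dims[OF c(3)]
  have "fsurj Q P M (\<lambda>v. mact (\<pi> v))" using c(5) fsurj_cong[of Q P "\<lambda>v. mact (\<pi> v)" F M] e by simp
  then have surj: "surjective Q P M \<pi>" by (simp only: surjective_hom_iff[OF \<pi>])
  have rk: "rad_ker Q P (\<lambda>v. mact (\<pi> v))" using c(6) e unfolding rad_ker_def by simp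
  have "surjective Q L P h" if L: "L \<in> modules Q I" and h: "h \<in> homs Q L P"
    and s: "surjective Q L M (hom_comp \<pi> h)" for L h
    unfolding surjective_hom_iff[OF h]
    by (rule rad_ker_essential[OF c(2) homs_fhom[OF d \<pi>] rk modules_dims[OF L]
          homs_fhom[OF modules_dims[OF L] d(1) h] s[unfolded fsurj_hom_comp[OF \<pi> h]]])
  then show ?thesis unfolding projective_cover_def projective_iff using c \<pi> surj by simp
qed

lemma is_kernel_iff:
  assumes \<pi>: "\<pi> \<in> homs Q P M" and \<iota>: "\<iota> \<in> homs Q N P" and d: "dims_ok Q N" "dims_ok Q P"
  shows "is_kernel Q N \<iota> P \<pi> \<longleftrightarrow> fker Q N (\<lambda>v. mact (\<iota> v)) P (\<lambda>v. mact (\<pi> v))"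
proof -
  have "(\<lambda>x. \<iota> v *\<^sub>v x) ` carrier_vec (rdim N v) = mat_kernel (\<pi> v) \<longleftrightarrow>
      mact (\<iota> v) ` space N v = {x \<in> space P v. mact (\<pi> v) x = 0}" if v: "v \<in> verts Q" for v
    unfolding mat_kernel_mact[OF homs_carrier[OF \<pi> v]]
    by (rule mat_image_iff[OF homs_carrier[OF \<iota> v]]) simp
  then show ?thesis
    unfolding is_kernel_def fker_def injective_iff[OF \<iota>] using \<iota> homs_fhom[OF d \<iota>] by simp
qed

lemma syzygy_iff: "(N \<in> modules Q I \<and> (\<exists>P \<pi> \<iota>. projective_cover Q I P \<pi> M \<and> is_kernel Q N \<iota> P \<pi>))
    \<longleftrightarrow> is_syz Q I N M"
proof
  assume "N \<in> modules Q I \<and> (\<exists>P \<pi> \<iota>. projective_cover Q I P \<pi> M \<and> is_kernel Q N \<iota> P \<pi>)"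
  then obtain P \<pi> \<iota> where N: "N \<in> modules Q I" and c: "projective_cover Q I P \<pi> M" and k: "is_kernel Q N \<iota> P \<pi>"
    by blast
  note c = projective_cover_fcover[OF c]
  have "\<iota> \<in> homs Q N P" using k by (simp add: is_kernel_def)
  from k[unfolded is_kernel_iff[OF c(1) this modules_dims[OF N] modules_dims[OF fcoverD(2)[OF c(2)]]]]
  show "is_syz Q I N M" unfolding is_syz_def using N c(2) by blast
next
  assume "is_syz Q I N M"
  then obtain P F K where N: "N \<in> modules Q I" and c: "fcover Q I P F M" and k: "fker Q N K P F"
    unfolding is_syz_def by (elim conjE exE)
  note cd = fcoverD[OF c]
  note d = modules_dims[OF cd(2)] modules_dims[OF cd(3)] modules_dims[OF N]
  obtain \<pi> where \<pi>: "\<pi> \<in> homs Q P M" "\<And>v x. v \<in> verts Q \<Longrightarrow> x \<in> space P v \<Longrightarrow> mact (\<pi> v) x = F v x"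
    using fhom_homs[OF d(1,2) cd(4)] by blast
  obtain \<iota> where \<iota>: "\<iota> \<in> homs Q N P" "\<And>v x. v \<in> verts Q \<Longrightarrow> x \<in> space N v \<Longrightarrow> mact (\<iota> v) x = K v x"
    using fhom_homs[OF d(3,1) fkerD(1)[OF k]] by blast
  have "fker Q N (\<lambda>v. mact (\<iota> v)) P (\<lambda>v. mact (\<pi> v))"
  proof (rule fkerI[OF homs_fhom[OF d(3,1) \<iota>(1)]])
    fix v x assume v: "v \<in> verts Q" and x: "x \<in> space N v"
    show "mact (\<pi> v) (mact (\<iota> v) x) = 0"
      using \<iota>(2)[OF v x] \<pi>(2)[OF v fhomD(2)[OF fkerD(1)[OF k] v x]] fkerD(3)[OF k v x] by simp
    assume "mact (\<iota> v) x = 0"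
    then show "x = 0" using \<iota>(2)[OF v x] fkerD(2)[OF k] v x unfolding finj_iff[OF fkerD(1)[OF k]] by simp
  next
    fix v y assume v: "v \<in> verts Q" and y: "y \<in> space P v" and z: "mact (\<pi> v) y = 0"
    obtain x where "x \<in> space N v" "K v x = y" using fkerD(4)[OF k v y] z \<pi>(2)[OF v y] by auto
    then show "\<exists>x\<in>space N v. mact (\<iota> v) x = y" using \<iota>(2)[OF v] by (intro bexI[of _ x]) simp_all
  qed
  then have "is_kernel Q N \<iota> P \<pi>" by (simp only: is_kernel_iff[OF \<pi>(1) \<iota>(1) d(3,1)])
  then show "N \<in> modules Q I \<and> (\<exists>P \<pi> \<iota>. projective_cover Q I P \<pi> M \<and> is_kernel Q N \<iota> P \<pi>)"
    using N fcover_projective_cover[OF c \<pi>] by (intro conjI exI)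
qed

lemma kernel_exists:
  assumes P: "P \<in> modules Q I" and \<pi>: "fhom Q P M \<pi>"
  obtains N \<iota> where "N \<in> modules Q I" "fker Q N \<iota> P \<pi>"
proof -
  have W: "subrep Q P (\<lambda>v. {x \<in> space P v. \<pi> v x = 0})"
    unfolding subrep_def
  proof (intro conjI ballI)
    fix v assume v: "v \<in> verts Q"
    note l = fhomD(1)[OF \<pi> v]
    show "fv.subspace {x \<in> space P v. \<pi> v x = 0}"
      by (auto simp: fv.subspace_def lin_0[OF l] lin_add[OF l] lin_scal[OF l])
  next
    fix a x assume a: "a \<in> arcs Q" and x: "x \<in> {x \<in> space P (tail Q a). \<pi> (tail Q a) x = 0}"
    then show "act P a x \<in> {x \<in> space P (head Q a). \<pi> (head Q a) x = 0}"
      using act_in[OF modules_dims[OF P] a] fhomD(3)[OF \<pi> a] lin_0[OF lin_act] by simp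
  qed auto
  show thesis
  proof (rule subrep_module[OF P W])
    fix N \<iota> assume N: "N \<in> modules Q I" "fhom Q N P \<iota>" "finj Q N \<iota>"
      "\<And>v. v \<in> verts Q \<Longrightarrow> \<iota> v ` space N v = {x \<in> space P v. \<pi> v x = 0}"
    then have "fker Q N \<iota> P \<pi>" unfolding fker_def by simp
    then show thesis by (rule that[OF N(1)])
  qed
qed

text \<open>The syzygy is defined by a choice, which is meaningful since covers and kernels
  exist.\<close>

lemma is_syz_syzygy:
  assumes "M \<in> modules Q I"
  shows "is_syz Q I (syzygy Q I M) M"
proof -
  obtain P \<pi> where c: "fcover Q I P \<pi> M" by (rule cover_exists[OF assms])
  obtain N \<iota> where "N \<in> modules Q I" "fker Q N \<iota> P \<pi>" by (rule kernel_exists[OF fcoverD(2,4)[OF c]])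
  then have "\<exists>N. is_syz Q I N M" unfolding is_syz_def using c by (intro exI conjI)
  then have "is_syz Q I (SOME N. is_syz Q I N M) M" by (rule someI_ex)
  then show ?thesis unfolding syzygy_def syzygy_iff .
qed

lemma is_syzD: "is_syz Q I N M \<Longrightarrow> N \<in> modules Q I"
  unfolding is_syz_def by simp

lemma syzygy_module: "M \<in> modules Q I \<Longrightarrow> syzygy Q I M \<in> modules Q I"
  by (rule is_syzD[OF is_syz_syzygy])

lemma syzygy_pow_module: "M \<in> modules Q I \<Longrightarrow> (syzygy Q I ^^ n) M \<in> modules Q I"
  by (induction n) (simp_all add: syzygy_module)

subsection \<open>Uniqueness\<close>

text \<open>A surjection lifts to the covers by projectivity, and the lift is surjective as the
  target cover is essential.\<close>

lemma cover_map:
  assumes c: "fcover Q I P \<pi> M" and c': "fcover Q I P' \<pi>' M'" and \<theta>: "fhom Q M M' \<theta>" "fsurj Q M M' \<theta>"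
  obtains f where "fhom Q P P' f" "fsurj Q P P' f"
    "\<And>v x. v \<in> verts Q \<Longrightarrow> x \<in> space P v \<Longrightarrow> \<pi>' v (f v x) = \<theta> v (\<pi> v x)"
proof -
  note c = fcoverD[OF c] and c' = fcoverD[OF c']
  from fprojD(2)[OF c(1) c'(2,3,4,5) fhom_comp[OF modules_dims[OF c(3)] c(4) \<theta>(1)]]
  obtain f where f: "fhom Q P P' f" "\<And>v x. v \<in> verts Q \<Longrightarrow> x \<in> space P v \<Longrightarrow> \<pi>' v (f v x) = \<theta> v (\<pi> v x)"
    by blast
  have "fsurj Q P M' (\<lambda>v x. \<pi>' v (f v x))"
    using fsurj_comp[OF c(5) \<theta>(2)] fsurj_cong[of Q P "\<lambda>v x. \<pi>' v (f v x)" "\<lambda>v x. \<theta> v (\<pi> v x)" M'] f(2) by simp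
  from rad_ker_essential[OF c'(2,4,6) modules_dims[OF c(2)] f(1) this]
  have s: "fsurj Q P P' f" .
  show thesis by (rule that[OF f(1) s f(2)])
qed

text \<open>A map between projective covers over an isomorphism is bijective, as there are surjections
  in both directions.\<close>

lemma cover_unique:
  assumes c: "fcover Q I P \<pi> M" and c': "fcover Q I P' \<pi>' M'"
    and \<theta>: "fhom Q M M' \<theta>" "fsurj Q M M' \<theta>" "finj Q M \<theta>"
  obtains f where "fhom Q P P' f" "fsurj Q P P' f" "finj Q P f"
    "\<And>v x. v \<in> verts Q \<Longrightarrow> x \<in> space P v \<Longrightarrow> \<pi>' v (f v x) = \<theta> v (\<pi> v x)"
proof -
  obtain f where f: "fhom Q P P' f" "fsurj Q P P' f"
    "\<And>v x. v \<in> verts Q \<Longrightarrow> x \<in> space P v \<Longrightarrow> \<pi>' v (f v x) = \<theta> v (\<pi> v x)"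
    using cover_map[OF c c' \<theta>(1,2)] by blast
  have "riso Q M M'" unfolding riso_def using \<theta> by (intro exI[of _ \<theta>] conjI)
  then have "riso Q M' M" by (rule iso_sym[OF modules_dims[OF fcoverD(3)[OF c]]])
  then obtain \<theta>' where \<theta>': "fhom Q M' M \<theta>'" "fsurj Q M' M \<theta>'" unfolding riso_def by (elim exE conjE)
  obtain g where g: "fhom Q P' P g" "fsurj Q P' P g"
    by (rule cover_map[OF c' c \<theta>']) (rule that)
  have inj: "finj Q P f" by (rule tdim_surj(2)[OF f(1,2) tdim_surj(1)[OF g]])
  show thesis by (rule that[OF f(1,2) inj f(3)])
qed

lemma kernel_unique:
  assumes N: "N \<in> modules Q I" "N' \<in> modules Q I" and k: "fker Q N \<iota> P \<pi>" and k': "fker Q N' \<iota>' P' \<pi>'"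
    and f: "fhom Q P P' f" "fsurj Q P P' f" "finj Q P f" and P: "dims_ok Q P"
    and ker: "\<And>v x. v \<in> verts Q \<Longrightarrow> x \<in> space P v \<Longrightarrow> \<pi>' v (f v x) = 0 \<longleftrightarrow> \<pi> v x = 0"
  shows "riso Q N N'"
proof -
  note k1 = fkerD[OF k] and k2 = fkerD[OF k']
  note in\<iota> = fhomD(2)[OF k1(1)] and in\<iota>' = fhomD(2)[OF k2(1)]
  note F = fhom_comp[OF P k1(1) f(1)]
  have im: "f v (\<iota> v x) \<in> \<iota>' v ` space N' v" if v: "v \<in> verts Q" and x: "x \<in> space N v" for v x
  proof -
    have "\<pi>' v (f v (\<iota> v x)) = 0" using ker[OF v in\<iota>[OF v x]] k1(3)[OF v x] by simp
    from k2(4)[OF v fhomD(2)[OF F v x] this] show ?thesis by (elim bexE) (metis imageI)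
  qed
  from inj_factor[OF modules_dims[OF N(2)] modules_dims[OF N(1)] k2(1,2) F im]
  obtain h where h: "fhom Q N N' h" "\<And>v x. v \<in> verts Q \<Longrightarrow> x \<in> space N v \<Longrightarrow> \<iota>' v (h v x) = f v (\<iota> v x)"
    by blast
  have "finj Q N h"
    unfolding finj_iff[OF h(1)]
  proof (intro ballI impI)
    fix v x assume v: "v \<in> verts Q" and x: "x \<in> space N v" and z: "h v x = 0"
    have "f v (\<iota> v x) = 0" using h(2)[OF v x] z lin_0[OF fhomD(1)[OF k2(1) v]] by simp
    then have "\<iota> v x = 0" using f(3) v in\<iota>[OF v x] unfolding finj_iff[OF f(1)] by simp
    then show "x = 0" using k1(2) v x unfolding finj_iff[OF k1(1)] by simp
  qed
  moreover have "fsurj Q N N' h"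
  proof (rule fsurjI[OF h(1)])
    fix v y assume v: "v \<in> verts Q" and y: "y \<in> space N' v"
    obtain x where x: "x \<in> space P v" "f v x = \<iota>' v y" using fsurjD[OF f(2) v in\<iota>'[OF v y]] by (elim bexE)
    then have "\<pi> v x = 0" using ker[OF v x(1)] k2(3)[OF v y] by simp
    from k1(4)[OF v x(1) this] obtain z where z: "z \<in> space N v" "\<iota> v z = x" by (elim bexE)
    then have "\<iota>' v (h v z) = \<iota>' v y" using h(2)[OF v z(1)] x(2) by simp
    moreover have "inj_on (\<iota>' v) (space N' v)" using k2(2) v unfolding finj_def by simp
    ultimately have "h v z = y" using y fhomD(2)[OF h(1) v z(1)] by (metis inj_onD)
    then show "\<exists>z\<in>space N v. h v z = y" using z(1) by (intro bexI[of _ z])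
  qed
  ultimately show ?thesis unfolding riso_def using h(1) by (intro exI conjI)
qed

lemma syz_unique:
  assumes "is_syz Q I N M" "is_syz Q I N' M'" "riso Q M M'"
  shows "riso Q N N'"
proof -
  obtain P \<pi> \<iota> where c: "fcover Q I P \<pi> M" and k: "fker Q N \<iota> P \<pi>"
    using assms(1) unfolding is_syz_def by (elim exE conjE)
  obtain P' \<pi>' \<iota>' where c': "fcover Q I P' \<pi>' M'" and k': "fker Q N' \<iota>' P' \<pi>'"
    using assms(2) unfolding is_syz_def by (elim exE conjE)
  obtain \<theta> where \<theta>: "fhom Q M M' \<theta>" "fsurj Q M M' \<theta>" "finj Q M \<theta>"
    using assms(3) unfolding riso_def by (elim exE conjE)
  obtain f where f: "fhom Q P P' f" "fsurj Q P P' f" "finj Q P f"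
    "\<And>v x. v \<in> verts Q \<Longrightarrow> x \<in> space P v \<Longrightarrow> \<pi>' v (f v x) = \<theta> v (\<pi> v x)"
    using cover_unique[OF c c' \<theta>] by blast
  note cd = fcoverD[OF c]
  show ?thesis
  proof (rule kernel_unique[OF is_syzD[OF assms(1)] is_syzD[OF assms(2)] k k' f(1-3) modules_dims[OF cd(2)]])
    fix v x assume v: "v \<in> verts Q" and x: "x \<in> space P v"
    have "\<theta> v (\<pi> v x) = 0 \<longleftrightarrow> \<pi> v x = 0"
      using \<theta>(3) v fhomD(2)[OF cd(4) v x] lin_0[OF fhomD(1)[OF \<theta>(1) v]] unfolding finj_iff[OF \<theta>(1)] by auto
    then show "\<pi>' v (f v x) = 0 \<longleftrightarrow> \<pi> v x = 0" using f(4)[OF v x] by simp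
  qed
qed

subsection \<open>Additivity\<close>

lemma fproj_biprod:
  assumes b: "biprod Q P P1 P2 j1 j2 q1 q2" and P: "P \<in> modules Q I" and "fproj Q I P1" "fproj Q I P2"
  shows "fproj Q I P"
  unfolding fproj_def
proof (intro conjI ballI allI impI P)
  note b = biprodD[OF b]
  fix M N G F assume M: "M \<in> modules Q I" and N: "N \<in> modules Q I"
    and G: "fhom Q M N G" "fsurj Q M N G" and F: "fhom Q P N F"
  note d = modules_dims[OF P]
  obtain H1 where H1: "fhom Q P1 M H1" "\<And>v x. v \<in> verts Q \<Longrightarrow> x \<in> space P1 v \<Longrightarrow> G v (H1 v x) = F v (j1 v x)"
    using fprojD(2)[OF assms(3) M N G fhom_comp[OF d b(1) F]] by blast
  obtain H2 where H2: "fhom Q P2 M H2" "\<And>v x. v \<in> verts Q \<Longrightarrow> x \<in> space P2 v \<Longrightarrow> G v (H2 v x) = F v (j2 v x)"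
    using fprojD(2)[OF assms(4) M N G fhom_comp[OF d b(2) F]] by blast
  note d1 = modules_dims[OF fprojD(1)[OF assms(3)]] and d2 = modules_dims[OF fprojD(1)[OF assms(4)]]
  show "\<exists>H. fhom Q P M H \<and> (\<forall>v\<in>verts Q. \<forall>x\<in>space P v. G v (H v x) = F v x)"
  proof (intro exI conjI ballI)
    show "fhom Q P M (\<lambda>v x. H1 v (q1 v x) + H2 v (q2 v x))"
      by (rule fhom_plus[OF fhom_comp[OF d1 b(3) H1(1)] fhom_comp[OF d2 b(4) H2(1)]])
    fix v x assume v: "v \<in> verts Q" and x: "x \<in> space P v"
    have "G v (H1 v (q1 v x) + H2 v (q2 v x)) = F v (j1 v (q1 v x)) + F v (j2 v (q2 v x))"
      using H1(2)[OF v fhomD(2)[OF b(3) v x]] H2(2)[OF v fhomD(2)[OF b(4) v x]]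
      by (simp add: lin_add[OF fhomD(1)[OF G(1) v]])
    also have "\<dots> = F v (j1 v (q1 v x) + j2 v (q2 v x))" by (simp add: lin_add[OF fhomD(1)[OF F v]])
    finally show "G v (H1 v (q1 v x) + H2 v (q2 v x)) = F v x" using b(9)[OF v x] by simp
  qed
qed

text \<open>The cover and the kernel of a direct sum are taken componentwise. That the kernel stays
  in the radical uses that inclusions map radicals into radicals.\<close>

lemma cover_kernel_dsum:
  assumes S: "S \<in> modules Q I" and s: "isum Q S M1 M2"
    and c1: "fcover Q I P1 \<pi>1 M1" and k1: "fker Q N1 \<iota>1 P1 \<pi>1" and N1: "N1 \<in> modules Q I"
    and c2: "fcover Q I P2 \<pi>2 M2" and k2: "fker Q N2 \<iota>2 P2 \<pi>2" and N2: "N2 \<in> modules Q I"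
  shows "\<exists>\<pi> \<iota>. fcover Q I (dsum Q P1 P2) \<pi> S \<and> fker Q (dsum Q N1 N2) \<iota> (dsum Q P1 P2) \<pi>"
proof -
  obtain i1 i2 p1 p2 where b: "biprod Q S M1 M2 i1 i2 p1 p2" using s unfolding isum_def by (elim exE)
  note b = biprodD[OF b] and c1 = fcoverD[OF c1] and c2 = fcoverD[OF c2] and k1 = fkerD[OF k1] and k2 = fkerD[OF k2]
  let ?P = "dsum Q P1 P2" and ?N = "dsum Q N1 N2"
  note P = dsum_module[OF c1(2) c2(2)] and N = dsum_module[OF N1 N2]
  obtain j1 j2 q1 q2 where j0: "biprod Q ?P P1 P2 j1 j2 q1 q2"
    using isum_dsum[OF modules_dims[OF c1(2)] modules_dims[OF c2(2)]] unfolding isum_def by (elim exE)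
  obtain a1 a2 r1 r2 where r0: "biprod Q ?N N1 N2 a1 a2 r1 r2"
    using isum_dsum[OF modules_dims[OF N1] modules_dims[OF N2]] unfolding isum_def by (elim exE)
  note j = biprodD[OF j0] and r = biprodD[OF r0]
  define \<pi> where "\<pi> = (\<lambda>v x. i1 v (\<pi>1 v (q1 v x)) + i2 v (\<pi>2 v (q2 v x)))"
  define \<iota> where "\<iota> = (\<lambda>v x. j1 v (\<iota>1 v (r1 v x)) + j2 v (\<iota>2 v (r2 v x)))"
  have \<pi>: "fhom Q ?P S \<pi>"
    unfolding \<pi>_def
    by (rule fhom_plus[OF fhom_comp[OF modules_dims[OF c1(3)] fhom_comp[OF modules_dims[OF c1(2)] j(3) c1(4)] b(1)]
          fhom_comp[OF modules_dims[OF c2(3)] fhom_comp[OF modules_dims[OF c2(2)] j(4) c2(4)] b(2)]])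
  have \<iota>: "fhom Q ?N ?P \<iota>"
    unfolding \<iota>_def
    by (rule fhom_plus[OF fhom_comp[OF modules_dims[OF c1(2)] fhom_comp[OF modules_dims[OF N1] r(3) k1(1)] j(1)]
          fhom_comp[OF modules_dims[OF c2(2)] fhom_comp[OF modules_dims[OF N2] r(4) k2(1)] j(2)]])
  note ins = fhomD(2)[OF j(1)] fhomD(2)[OF j(2)] fhomD(2)[OF j(3)] fhomD(2)[OF j(4)]
    fhomD(2)[OF r(1)] fhomD(2)[OF r(2)] fhomD(2)[OF r(3)] fhomD(2)[OF r(4)]
    fhomD(2)[OF b(1)] fhomD(2)[OF b(2)] fhomD(2)[OF b(3)] fhomD(2)[OF b(4)]
    fhomD(2)[OF c1(4)] fhomD(2)[OF c2(4)] fhomD(2)[OF k1(1)] fhomD(2)[OF k2(1)]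
  note lins = lin_add[OF fhomD(1)[OF j(3)]] lin_add[OF fhomD(1)[OF j(4)]] lin_add[OF fhomD(1)[OF b(3)]]
    lin_add[OF fhomD(1)[OF b(4)]] lin_add[OF fhomD(1)[OF r(3)]] lin_add[OF fhomD(1)[OF r(4)]]
  note zeros = lin_0[OF fhomD(1)[OF b(1)]] lin_0[OF fhomD(1)[OF b(2)]] lin_0[OF fhomD(1)[OF b(3)]]
    lin_0[OF fhomD(1)[OF b(4)]] lin_0[OF fhomD(1)[OF j(3)]] lin_0[OF fhomD(1)[OF j(4)]]
    lin_0[OF fhomD(1)[OF r(1)]] lin_0[OF fhomD(1)[OF r(2)]]
  have p\<pi>: "p1 v (\<pi> v x) = \<pi>1 v (q1 v x)" "p2 v (\<pi> v x) = \<pi>2 v (q2 v x)" if "v \<in> verts Q" "x \<in> space ?P v" for v x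
    using that by (simp_all add: \<pi>_def lins ins b(5-8))
  have q\<iota>: "q1 v (\<iota> v x) = \<iota>1 v (r1 v x)" "q2 v (\<iota> v x) = \<iota>2 v (r2 v x)" if "v \<in> verts Q" "x \<in> space ?N v" for v x
    using that by (simp_all add: \<iota>_def lins ins j(5-8))
  have surj: "fsurj Q ?P S \<pi>"
  proof (rule fsurjI[OF \<pi>])
    fix v y assume v: "v \<in> verts Q" and y: "y \<in> space S v"
    obtain x1 where x1: "x1 \<in> space P1 v" "\<pi>1 v x1 = p1 v y" using fsurjD[OF c1(5) v fhomD(2)[OF b(3) v y]] by (elim bexE)
    obtain x2 where x2: "x2 \<in> space P2 v" "\<pi>2 v x2 = p2 v y" using fsurjD[OF c2(5) v fhomD(2)[OF b(4) v y]] by (elim bexE)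
    show "\<exists>x\<in>space ?P v. \<pi> v x = y"
      by (rule bexI[of _ "j1 v x1 + j2 v x2"])
         (use v y x1 x2 in \<open>simp_all add: \<pi>_def lins ins j(5-8) b(9)\<close>)
  qed
  have rk: "rad_ker Q ?P \<pi>"
    unfolding rad_ker_def
  proof (intro ballI impI)
    fix v x assume v: "v \<in> verts Q" and x: "x \<in> space ?P v" and z: "\<pi> v x = 0"
    have "\<pi>1 v (q1 v x) = 0" "\<pi>2 v (q2 v x) = 0" using p\<pi>[OF v x] z v by (simp_all add: zeros)
    then have "q1 v x \<in> rad Q P1 v" "q2 v x \<in> rad Q P2 v"
      using rad_kerD[OF c1(6) v fhomD(2)[OF j(3) v x]] rad_kerD[OF c2(6) v fhomD(2)[OF j(4) v x]] by simp_all
    then have "j1 v (q1 v x) + j2 v (q2 v x) \<in> rad Q ?P v"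
      by (intro fv.subspace_add[OF subspace_rad] fhom_rad[OF j(1) v wf_digraph_axioms] fhom_rad[OF j(2) v wf_digraph_axioms])
    then show "x \<in> rad Q ?P v" using j(9)[OF v x] by simp
  qed
  have "fcover Q I ?P \<pi> S"
    unfolding fcover_def using fproj_biprod[OF j0 P c1(1) c2(1)] S \<pi> surj rk by simp
  moreover have "fker Q ?N \<iota> ?P \<pi>"
  proof (rule fkerI[OF \<iota>])
    fix v x assume v: "v \<in> verts Q" and x: "x \<in> space ?N v"
    show "\<pi> v (\<iota> v x) = 0"
      using v x q\<iota>[OF v x] by (simp add: \<pi>_def ins k1(3) k2(3) zeros)
    assume z: "\<iota> v x = 0"
    have "\<iota>1 v (r1 v x) = 0" "\<iota>2 v (r2 v x) = 0" using q\<iota>[OF v x] z v by (simp_all add: zeros)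
    then have "r1 v x = 0" "r2 v x = 0"
      using k1(2) k2(2) v fhomD(2)[OF r(3) v x] fhomD(2)[OF r(4) v x]
      unfolding finj_iff[OF k1(1)] finj_iff[OF k2(1)] by simp_all
    then show "x = 0" using r(9)[OF v x] v by (simp add: zeros)
  next
    fix v y assume v: "v \<in> verts Q" and y: "y \<in> space ?P v" and z: "\<pi> v y = 0"
    have "\<pi>1 v (q1 v y) = 0" "\<pi>2 v (q2 v y) = 0" using p\<pi>[OF v y] z v by (simp_all add: zeros)
    note ex = k1(4)[OF v fhomD(2)[OF j(3) v y] this(1)] k2(4)[OF v fhomD(2)[OF j(4) v y] this(2)]
    obtain x1 where x1: "x1 \<in> space N1 v" "\<iota>1 v x1 = q1 v y" using ex(1) by (elim bexE)
    obtain x2 where x2: "x2 \<in> space N2 v" "\<iota>2 v x2 = q2 v y" using ex(2) by (elim bexE)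
    note x = x1 x2
    show "\<exists>x\<in>space ?N v. \<iota> v x = y"
      by (rule bexI[of _ "a1 v x1 + a2 v x2"])
         (use v y x in \<open>simp_all add: \<iota>_def lins ins r(5-8) j(9)\<close>)
  qed
  ultimately show ?thesis by (intro exI conjI)
qed

lemma is_syz_dsum:
  assumes S: "S \<in> modules Q I" and s: "isum Q S M1 M2" and z1: "is_syz Q I N1 M1" and z2: "is_syz Q I N2 M2"
  shows "is_syz Q I (dsum Q N1 N2) S"
proof -
  obtain P1 \<pi>1 \<iota>1 where c1: "fcover Q I P1 \<pi>1 M1" and k1: "fker Q N1 \<iota>1 P1 \<pi>1"
    using z1 unfolding is_syz_def by (elim exE conjE)
  obtain P2 \<pi>2 \<iota>2 where c2: "fcover Q I P2 \<pi>2 M2" and k2: "fker Q N2 \<iota>2 P2 \<pi>2"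
    using z2 unfolding is_syz_def by (elim exE conjE)
  note N1 = is_syzD[OF z1] and N2 = is_syzD[OF z2]
  from cover_kernel_dsum[OF S s c1 k1 N1 c2 k2 N2] obtain \<pi> \<iota> where
    "fcover Q I (dsum Q P1 P2) \<pi> S" "fker Q (dsum Q N1 N2) \<iota> (dsum Q P1 P2) \<pi>" by (elim exE conjE)
  then show ?thesis unfolding is_syz_def using dsum_module[OF N1 N2] by (intro conjI exI)
qed

lemma cover_dsum:
  assumes S: "S \<in> modules Q I" and s: "isum Q S M1 M2"
    and c1: "fcover Q I P1 \<pi>1 M1" and c2: "fcover Q I P2 \<pi>2 M2"
  obtains \<pi> where "fcover Q I (dsum Q P1 P2) \<pi> S"
proof -
  obtain N1 \<iota>1 where k1: "N1 \<in> modules Q I" "fker Q N1 \<iota>1 P1 \<pi>1" by (rule kernel_exists[OF fcoverD(2,4)[OF c1]])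
  obtain N2 \<iota>2 where k2: "N2 \<in> modules Q I" "fker Q N2 \<iota>2 P2 \<pi>2" by (rule kernel_exists[OF fcoverD(2,4)[OF c2]])
  from cover_kernel_dsum[OF S s c1 k1(2,1) c2 k2(2,1)] obtain \<pi> \<iota> where
    "fcover Q I (dsum Q P1 P2) \<pi> S" by (elim exE conjE)
  then show thesis by (rule that)
qed

lemma syz_additive:
  assumes S: "S \<in> modules Q I" and s: "isum Q S M1 M2"
    and z: "is_syz Q I N S" and z1: "is_syz Q I N1 M1" and z2: "is_syz Q I N2 M2"
  shows "isum Q N N1 N2"
proof -
  note d = modules_dims[OF is_syzD[OF z1]] modules_dims[OF is_syzD[OF z2]]
  have "riso Q N (dsum Q N1 N2)" by (rule syz_unique[OF z is_syz_dsum[OF S s z1 z2] iso_refl])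
  from isum_transport[OF dims_dsum[OF d] d isum_dsum[OF d] this modules_dims[OF is_syzD[OF z]]]
  show ?thesis .
qed

subsection \<open>Zero modules and tops\<close>

lemma zero_rep_module: "zero_rep \<in> modules Q I"
  by (rule zero_arrows_module) (simp_all add: dims_ok_def zero_rep_def act_def)

lemma zero_rep_space [simp]: "space zero_rep v = {0}"
  by (simp add: zero_rep_def)

lemma iso_zero:
  assumes "\<And>v. v \<in> verts Q \<Longrightarrow> rdim M v = 0"
  shows "riso Q M zero_rep"
  by (rule isoI[of _ _ _ "\<lambda>v x. x" "\<lambda>v x. x"])
     (use assms in \<open>auto intro!: fhomI lin_id simp: lin_0[OF lin_act]\<close>)

lemma fproj_zero: "fproj Q I zero_rep"
  unfolding fproj_def
proof (intro conjI ballI allI impI zero_rep_module)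
  fix M N G F assume M: "M \<in> modules Q I" and G: "fhom Q M N G" and F: "fhom Q zero_rep N F"
  show "\<exists>H. fhom Q zero_rep M H \<and> (\<forall>v\<in>verts Q. \<forall>x\<in>space zero_rep v. G v (H v x) = F v x)"
    by (intro exI[of _ "\<lambda>v x. 0"] conjI fhomI)
       (simp_all add: lin_zero lin_0[OF lin_act] lin_0[OF fhomD(1)[OF G]] lin_0[OF fhomD(1)[OF F]])
qed

lemma syz_projective:
  assumes "fproj Q I P"
  shows "is_syz Q I zero_rep P"
proof -
  have "rad_ker Q P (\<lambda>v x. x)" unfolding rad_ker_def by (simp add: fv.subspace_0[OF subspace_rad])
  moreover have "fsurj Q P P (\<lambda>v x. x)" unfolding fsurj_def by simp
  ultimately have "fcover Q I P (\<lambda>v x. x) P" unfolding fcover_def using assms fhom_id fprojD(1)[OF assms] by simp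
  moreover have "fker Q zero_rep (\<lambda>v x. 0) P (\<lambda>v x. x)"
    by (rule fkerI) (auto intro!: fhomI simp: lin_zero lin_0[OF lin_act])
  ultimately show ?thesis unfolding is_syz_def using zero_rep_module by (intro conjI exI)
qed

text \<open>Semisimple modules are the modules on which the arrows act as zero.\<close>

definition zero_arrows :: "('v, 'e, 'k) rep \<Rightarrow> bool" where
  "zero_arrows T \<longleftrightarrow> (\<forall>a\<in>arcs Q. \<forall>x\<in>space T (tail Q a). act T a x = 0)"

text \<open>The top of M is the quotient by its radical; the arrows act on it as zero.\<close>

lemma top_exists:
  assumes M: "M \<in> modules Q I"
  obtains T t where "T \<in> modules Q I" "zero_arrows T" "fhom Q M T t" "fsurj Q M T t" "rad_ker Q M t"
proof -
  obtain T t where T: "T \<in> modules Q I" "fhom Q M T t" "fsurj Q M T t"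
    "\<And>v x. v \<in> verts Q \<Longrightarrow> x \<in> space M v \<Longrightarrow> t v x = 0 \<longleftrightarrow> x \<in> rad Q M v"
    using quotient_module[OF M subrep_rad[OF modules_dims[OF M]]] by blast
  have "act T a y = 0" if a: "a \<in> arcs Q" and y: "y \<in> space T (tail Q a)" for a y
  proof -
    obtain x where x: "x \<in> space M (tail Q a)" "t (tail Q a) x = y" using fsurjD[OF T(3) _ y] a by auto
    have "t (head Q a) (act M a x) = 0"
      using T(4)[of "head Q a"] a act_in[OF modules_dims[OF M] a] act_in_rad[OF a x(1)] by simp
    then show ?thesis using fhomD(3)[OF T(2) a x(1)] x(2) by simp
  qed
  then have "zero_arrows T" unfolding zero_arrows_def by simp
  moreover have "rad_ker Q M t" unfolding rad_ker_def using T(4) by simp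
  ultimately show thesis by (intro that[OF T(1) _ T(2,3)])
qed

text \<open>In particular, a module and its top have the same projective cover.\<close>

lemma fcover_comp:
  assumes c: "fcover Q I P \<pi> M" and t: "T \<in> modules Q I" "fhom Q M T t" "fsurj Q M T t" "rad_ker Q M t"
  shows "fcover Q I P (\<lambda>v x. t v (\<pi> v x)) T"
proof -
  note c = fcoverD[OF c]
  show ?thesis
    unfolding fcover_def
    using c(1) t(1) fhom_comp[OF modules_dims[OF c(3)] c(4) t(2)] fsurj_comp[OF c(5) t(3)]
      rad_ker_comp[OF c(4-6) t(4) modules_dims[OF c(2)]] by simp
qed

subsection \<open>Direct summands\<close>

text \<open>Direct summands are handled as retracts, for which functoriality and transitivity are obvious.\<close>

definition retract :: "('v, 'e, 'k) rep \<Rightarrow> ('v, 'e, 'k) rep \<Rightarrow> bool" where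
  "retract N M \<longleftrightarrow> (\<exists>s r. fhom Q N M s \<and> fhom Q M N r \<and> (\<forall>v\<in>verts Q. \<forall>x\<in>space N v. r v (s v x) = x))"

lemma isum_retract: "isum Q M N N' \<Longrightarrow> retract N M"
proof -
  assume "isum Q M N N'"
  then obtain i1 i2 p1 p2 where b: "biprod Q M N N' i1 i2 p1 p2" unfolding isum_def by (elim exE)
  note b = biprodD[OF b]
  show ?thesis unfolding retract_def by (intro exI[of _ i1] exI[of _ p1] conjI ballI b(1,3,5))
qed

lemma riso_retract: "dims_ok Q N \<Longrightarrow> riso Q N M \<Longrightarrow> retract N M"
proof -
  assume d: "dims_ok Q N" and i: "riso Q N M"
  obtain F H where F: "fhom Q N M F" "fhom Q M N H"
    "\<And>v x. v \<in> verts Q \<Longrightarrow> x \<in> space N v \<Longrightarrow> H v (F v x) = x"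
    "\<And>v y. v \<in> verts Q \<Longrightarrow> y \<in> space M v \<Longrightarrow> F v (H v y) = y"
    using isoE[OF wf_digraph_axioms d i] by blast
  show ?thesis unfolding retract_def by (intro exI[of _ F] exI[of _ H] conjI ballI F)
qed

lemma retract_trans:
  assumes M: "dims_ok Q M" and LM: "retract L M" and MN: "retract M N"
  shows "retract L N"
proof -
  obtain s r where sr: "fhom Q L M s" "fhom Q M L r" "\<forall>v\<in>verts Q. \<forall>x\<in>space L v. r v (s v x) = x"
    using LM unfolding retract_def by (elim exE conjE)
  obtain s' r' where sr': "fhom Q M N s'" "fhom Q N M r'" "\<forall>v\<in>verts Q. \<forall>x\<in>space M v. r' v (s' v x) = x"
    using MN unfolding retract_def by (elim exE conjE)
  show ?thesis
    unfolding retract_def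
    by (intro exI[of _ "\<lambda>v x. s' v (s v x)"] exI[of _ "\<lambda>v x. r v (r' v x)"] conjI ballI
          fhom_comp[OF M sr(1) sr'(1)] fhom_comp[OF M sr'(2) sr(2)])
       (simp add: sr(3) sr'(3) fhomD(2)[OF sr(1)])
qed

text \<open>The complement of a retract is the kernel of the retraction.\<close>

lemma retract_isum:
  assumes N: "N \<in> modules Q I" and M: "M \<in> modules Q I" and NM: "retract N M"
  obtains N' where "N' \<in> modules Q I" "isum Q M N N'"
proof -
  obtain s r where s: "fhom Q N M s" and r: "fhom Q M N r" and "\<forall>v\<in>verts Q. \<forall>x\<in>space N v. r v (s v x) = x"
    using NM unfolding retract_def by (elim exE conjE)
  then have rs: "r v (s v x) = x" if "v \<in> verts Q" "x \<in> space N v" for v x using that by simp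
  obtain N' \<iota> where N': "N' \<in> modules Q I" "fker Q N' \<iota> M r" by (rule kernel_exists[OF M r])
  note k = fkerD[OF N'(2)]
  have sr: "fhom Q M M (\<lambda>v x. x - s v (r v x))"
    by (rule fhomI)
       (simp_all add: lin_minus[OF lin_id lin_comp[OF fhomD(1)[OF r] fhomD(1)[OF s]]] fhomD[OF r] fhomD[OF s]
          lin_diff[OF lin_act])
  have im: "x - s v (r v x) \<in> \<iota> v ` space N' v" if v: "v \<in> verts Q" and x: "x \<in> space M v" for v x
  proof -
    have "r v (x - s v (r v x)) = 0"
      using rs[OF v fhomD(2)[OF r v x]] by (simp add: lin_diff[OF fhomD(1)[OF r v]])
    from k(4)[OF v fhomD(2)[OF sr v x] this] show ?thesis by (elim bexE) (metis imageI)
  qed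
  from inj_factor[OF modules_dims[OF N'(1)] modules_dims[OF M] k(1,2) sr im]
  obtain p where p: "fhom Q M N' p" "\<And>v x. v \<in> verts Q \<Longrightarrow> x \<in> space M v \<Longrightarrow> \<iota> v (p v x) = x - s v (r v x)" by blast
  have inj: "x = y" if "v \<in> verts Q" "x \<in> space N' v" "y \<in> space N' v" "\<iota> v x = \<iota> v y" for v x y
    using k(2) that unfolding finj_def by (metis inj_onD)
  have "biprod Q M N N' s \<iota> r p"
  proof (rule biprodI[OF s k(1) r p(1)])
    fix v x assume v: "v \<in> verts Q" and x: "x \<in> space N v"
    show "r v (s v x) = x" by (rule rs[OF v x])
    show "p v (s v x) = 0"
      by (rule inj[OF v fhomD(2)[OF p(1) v fhomD(2)[OF s v x]]])
         (simp_all add: p(2)[OF v fhomD(2)[OF s v x]] rs[OF v x] lin_0[OF fhomD(1)[OF k(1) v]])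
  next
    fix v x assume v: "v \<in> verts Q" and x: "x \<in> space N' v"
    show "r v (\<iota> v x) = 0" by (rule k(3)[OF v x])
    show "p v (\<iota> v x) = x"
      by (rule inj[OF v fhomD(2)[OF p(1) v fhomD(2)[OF k(1) v x]] x])
         (simp add: p(2)[OF v fhomD(2)[OF k(1) v x]] k(3)[OF v x] lin_0[OF fhomD(1)[OF s v]])
  next
    fix v x assume "v \<in> verts Q" "x \<in> space M v"
    then show "s v (r v x) + \<iota> v (p v x) = x" by (simp add: p(2))
  qed
  then have "isum Q M N N'" unfolding isum_def by (intro exI)
  then show thesis by (rule that[OF N'(1)])
qed

lemma is_summand_iff:
  assumes M: "M \<in> modules Q I"
  shows "is_summand Q I N M \<longleftrightarrow> N \<in> modules Q I \<and> retract N M"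
proof
  assume "is_summand Q I N M"
  then obtain N' where N: "N \<in> modules Q I" "N' \<in> modules Q I" "isomorphic Q M (dsum Q N N')"
    unfolding is_summand_def by blast
  then show "N \<in> modules Q I \<and> retract N M"
    using isum_retract isomorphic_dsum_iff[OF M[THEN modules_dims] N(1,2)[THEN modules_dims]] by simp
next
  assume N: "N \<in> modules Q I \<and> retract N M"
  then obtain N' where N': "N' \<in> modules Q I" "isum Q M N N'" using retract_isum[OF _ M] by blast
  then show "is_summand Q I N M"
    unfolding is_summand_def
    using N isomorphic_dsum_iff[OF M[THEN modules_dims] conjunct1[OF N, THEN modules_dims] N'(1)[THEN modules_dims]]
    by blast
qed

lemma syz_retract:
  assumes "N \<in> modules Q I" "M \<in> modules Q I" "retract N M" "is_syz Q I K N" "is_syz Q I L M"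
  shows "retract K L"
proof -
  obtain N' where N': "N' \<in> modules Q I" "isum Q M N N'" by (rule retract_isum[OF assms(1-3)])
  show ?thesis
    by (rule isum_retract[OF syz_additive[OF assms(2) N'(2) assms(5,4) is_syz_syzygy[OF N'(1)]]])
qed

lemma retract_dsum_list:
  assumes "\<And>S. S \<in> set Ss \<Longrightarrow> S \<in> modules Q I"
  shows "dsum_list Q Ss \<in> modules Q I" "S \<in> set Ss \<Longrightarrow> retract S (dsum_list Q Ss)"
proof -
  have mod: "dsum_list Q Ss \<in> modules Q I" if "\<And>S. S \<in> set Ss \<Longrightarrow> S \<in> modules Q I" for Ss
    using that by (induction Ss) (simp_all add: dsum_list_def zero_rep_module dsum_module)
  show "dsum_list Q Ss \<in> modules Q I" by (rule mod[OF assms])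
  assume "S \<in> set Ss"
  then show "retract S (dsum_list Q Ss)"
    using assms
  proof (induction Ss)
    case (Cons T Ss)
    let ?D = "dsum_list Q Ss"
    have e: "dsum_list Q (T # Ss) = dsum Q T ?D" by (simp add: dsum_list_def)
    have D: "?D \<in> modules Q I" by (rule mod) (simp add: Cons.prems)
    have T: "T \<in> modules Q I" using Cons.prems by simp
    have s: "isum Q (dsum Q T ?D) T ?D" by (rule isum_dsum[OF modules_dims[OF T] modules_dims[OF D]])
    show ?case
    proof (cases "S = T")
      case True
      then show ?thesis unfolding e using isum_retract[OF s] by simp
    next
      case False
      then have "retract S ?D" using Cons.IH Cons.prems by simp
      then show ?thesis
        unfolding e by (rule retract_trans[OF modules_dims[OF D] _ isum_retract[OF isum_commute[OF s]]])
    qed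
  qed simp
qed

subsection \<open>Semisimple modules\<close>

definition simple_at :: "'v \<Rightarrow> ('v, 'e, 'k) rep" where
  "simple_at v = Rep (\<lambda>w. if w = v then 1 else 0)
     (\<lambda>a. 0\<^sub>m (if head Q a = v then 1 else 0) (if tail Q a = v then 1 else 0))"

lemma simple_at_module: "simple_at v \<in> modules Q I"
  by (rule zero_arrows_module) (auto simp: simple_at_def dims_ok_def act_def)

text \<open>Representations with zero arrows are sums of the simples at the vertices, so an additive
  property is inherited from these.\<close>

lemma zero_arrows_induct:
  assumes T: "T \<in> modules Q I" "zero_arrows T"
    and zero: "\<And>M. M \<in> modules Q I \<Longrightarrow> riso Q M zero_rep \<Longrightarrow> R M"
    and base: "\<And>v. v \<in> verts Q \<Longrightarrow> R (simple_at v)"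
    and add: "\<And>S M N. S \<in> modules Q I \<Longrightarrow> M \<in> modules Q I \<Longrightarrow> N \<in> modules Q I \<Longrightarrow> isum Q S M N \<Longrightarrow> R M \<Longrightarrow> R N \<Longrightarrow> R S"
  shows "R T"
  using T
proof (induction "tdim T" arbitrary: T rule: less_induct)
  case (less T)
  note dT = modules_dims[OF less.prems(1)]
  show ?case
  proof (cases "\<exists>v\<in>verts Q. rdim T v \<noteq> 0")
    case False
    then show ?thesis using zero[OF less.prems(1) iso_zero] by blast
  next
    case True
    then obtain v where v: "v \<in> verts Q" "rdim T v \<noteq> 0" by blast
    define m where "m = (rdim T)(v := rdim T v - 1)"
    \<comment> \<open>Only dimensions matter when the arrows act as zero: one dimension at v is
      split off.\<close>
    define T' where "T' = Rep m (\<lambda>a. 0\<^sub>m (m (head Q a)) (m (tail Q a)) :: 'k mat)"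
    have d': "dims_ok Q T'" by (simp add: T'_def dims_ok_def)
    have z': "act T' a x = 0" for a x by (simp add: T'_def act_def)
    have zs: "act (simple_at v) a x = 0" for a x by (simp add: simple_at_def act_def)
    have T': "T' \<in> modules Q I" "zero_arrows T'"
      using zero_arrows_module[OF d'] z' by (simp_all add: zero_arrows_def)
    let ?D = "dsum Q (simple_at v) T'"
    have sp: "rdim ?D w = rdim T w" if "w \<in> verts Q" for w
      using v by (simp add: dsum_def simple_at_def T'_def m_def)
    have zd: "act ?D a x = 0" if "a \<in> arcs Q" for a x
      using act_dsum[OF modules_dims[OF simple_at_module] d' that] z' zs by (simp add: lin_0[OF lin_inr])
    have "riso Q T ?D"
      by (rule isoI[of _ _ _ "\<lambda>v x. x" "\<lambda>v x. x"])
         (use less.prems(2) in \<open>simp_all add: fhom_def lin_id sp zd zero_arrows_def\<close>)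
    from isum_transport[OF dims_dsum[OF modules_dims[OF simple_at_module] d'] modules_dims[OF simple_at_module] d'
        isum_dsum[OF modules_dims[OF simple_at_module] d'] this dT]
    have "isum Q T (simple_at v) T'" .
    moreover have "tdim T' < tdim T"
      unfolding tdim_def
      by (rule sum_strict_mono_ex1) (use v in \<open>auto simp: T'_def m_def intro!: bexI[of _ v]\<close>)
    ultimately show ?thesis
      using add[OF less.prems(1) simple_at_module T'(1)] base[OF v(1)] less.hyps[OF _ T'] by blast
  qed
qed

lemma simple_at_simple:
  assumes v: "v \<in> verts Q"
  shows "simple Q I (simple_at v)"
  unfolding simple_def
proof (intro conjI ballI impI)
  show "simple_at v \<in> modules Q I" by (rule simple_at_module)
  show "nonzero_rep Q (simple_at v)" unfolding nonzero_rep_def using v by (intro bexI[of _ v]) (simp add: simple_at_def)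
  fix N f assume N: "N \<in> modules Q I" and f: "f \<in> homs Q N (simple_at v)" and nz: "nonzero_rep Q N \<and> injective Q N f"
  let ?F = "\<lambda>v. mact (f v)"
  have F: "fhom Q N (simple_at v) ?F" by (rule homs_fhom[OF modules_dims[OF N] modules_dims[OF simple_at_module] f])
  have inj: "finj Q N ?F" using nz injective_iff[OF f] by simp
  have le: "rdim N w \<le> rdim (simple_at v) w" if "w \<in> verts Q" for w
    by (rule inj_dim_le(1)[OF fhomD(1)[OF F that]])
       (use fhomD(2)[OF F that] inj that in \<open>simp_all add: image_subset_iff finj_def\<close>)
  obtain w where "w \<in> verts Q" "rdim N w \<noteq> 0" using nz unfolding nonzero_rep_def by blast
  then have "rdim N v \<noteq> 0" using le[of w] by (cases "w = v") (simp_all add: simple_at_def)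
  then have "tdim (simple_at v) \<le> tdim N"
    unfolding tdim_def by (intro sum_mono) (simp add: simple_at_def)
  then have "fsurj Q N (simple_at v) ?F" by (rule tdim_inj(2)[OF F inj])
  then show "surjective Q N (simple_at v) f" by (simp only: surjective_hom_iff[OF f])
qed

end

section \<open>Finitely generated subgroups\<close>

text \<open>Subgroups of free abelian groups are handled as sets closed under subtraction, inside the
  additive group of all formal integer combinations.\<close>

inductive_set agen :: "'a::ab_group_add set \<Rightarrow> 'a set" for B where
  zero: "0 \<in> agen B"
| base: "x \<in> B \<Longrightarrow> x \<in> agen B"
| diff: "x \<in> agen B \<Longrightarrow> y \<in> agen B \<Longrightarrow> x - y \<in> agen B"

definition asub :: "'a::ab_group_add set \<Rightarrow> bool" where
  "asub L \<longleftrightarrow> 0 \<in> L \<and> (\<forall>x\<in>L. \<forall>y\<in>L. x - y \<in> L)"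

lemma asub_agen [simp]: "asub (agen B)"
  by (simp add: asub_def agen.zero agen.diff)

lemma asubD: "asub L \<Longrightarrow> 0 \<in> L" "asub L \<Longrightarrow> x \<in> L \<Longrightarrow> y \<in> L \<Longrightarrow> x - y \<in> L"
  by (simp_all add: asub_def)

lemma asub_uminus: "asub L \<Longrightarrow> x \<in> L \<Longrightarrow> -x \<in> L"
  using asubD(2)[of L 0 x] asubD(1)[of L] by simp

lemma asub_add: "asub L \<Longrightarrow> x \<in> L \<Longrightarrow> y \<in> L \<Longrightarrow> x + y \<in> L"
  using asubD(2)[of L x "-y"] asub_uminus[of L y] by simp

lemma agen_subset: "asub L \<Longrightarrow> B \<subseteq> L \<Longrightarrow> agen B \<subseteq> L"
proof
  fix x assume L: "asub L" "B \<subseteq> L" and "x \<in> agen B"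
  from this(3) show "x \<in> L" by induction (use L in \<open>auto intro: asubD\<close>)
qed

lemma agen_mono: "B \<subseteq> C \<Longrightarrow> agen B \<subseteq> agen C"
  by (rule agen_subset) (auto intro: agen.base)

lemma asub_cmul:
  assumes L: "asub (L :: ('a \<Rightarrow>\<^sub>0 int) set)" and x: "x \<in> L"
  shows "frag_cmul n x \<in> L"
proof (induction n rule: int_induct[of _ 0])
  case base
  then show ?case using asubD(1)[OF L] by simp
next
  case (step1 i)
  then show ?case using asub_add[OF L _ x] by (simp add: frag_cmul_distrib)
next
  case (step2 i)
  then show ?case using asubD(2)[OF L _ x] by (simp add: frag_cmul_diff_distrib)
qed

lemma agen_insert:
  assumes "y \<in> agen (insert x B)"
  shows "\<exists>n. y - frag_cmul n x \<in> agen B"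
  using assms
proof induction
  case zero
  show ?case by (rule exI[of _ 0]) (simp add: agen.zero)
next
  case (base y)
  then show ?case
  proof
    assume "y = x"
    then show ?thesis by (intro exI[of _ 1]) (simp add: agen.zero)
  next
    assume "y \<in> B"
    then show ?thesis by (intro exI[of _ 0]) (simp add: agen.base)
  qed
next
  case (diff y z)
  then obtain m n where "y - frag_cmul m x \<in> agen B" "z - frag_cmul n x \<in> agen B" by blast
  from agen.diff[OF this] show ?case
    by (intro exI[of _ "m - n"]) (simp add: frag_cmul_diff_distrib algebra_simps)
qed

text \<open>Division with remainder: the remainder of n modulo the least positive element d is in D
  and smaller than d.\<close>

lemma int_subgroup_generator:
  assumes D: "0 \<in> D" "\<And>m n. m \<in> D \<Longrightarrow> n \<in> D \<Longrightarrow> m - n \<in> D" and d: "d \<in> D" "d > 0"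
    and least: "\<And>n. n \<in> D \<Longrightarrow> n > 0 \<Longrightarrow> d \<le> n" and n: "n \<in> D"
  shows "(d::int) dvd n"
proof -
  have neg: "-m \<in> D" if "m \<in> D" for m using D(2)[OF D(1) that] by simp
  have mult: "q * d \<in> D" for q
  proof (induction q rule: int_induct[of _ 0])
    case (step1 i)
    have "i * d - (- d) \<in> D" by (rule D(2)[OF step1(2) neg[OF d(1)]])
    then show ?case by (simp add: algebra_simps)
  next
    case (step2 i)
    have "i * d - d \<in> D" by (rule D(2)[OF step2(2) d(1)])
    then show ?case by (simp add: algebra_simps)
  qed (simp add: D(1))
  have "n - (n div d) * d \<in> D" by (rule D(2)[OF n mult])
  then have "n mod d \<in> D" by (simp add: minus_div_mult_eq_mod)
  then have "n mod d = 0"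
    using least[of "n mod d"] d(2) by (metis pos_mod_bound pos_mod_sign less_le not_le)
  then show ?thesis by auto
qed

text \<open>A subgroup of a finitely generated abelian group is finitely generated, here relative to a
  subgroup R. One generator x is treated at a time: the multiples of x occurring in L modulo the
  other generators form a subgroup of the integers.\<close>

lemma subgroup_finitely_generated:
  fixes L R :: "('a \<Rightarrow>\<^sub>0 int) set"
  assumes "finite B" "asub L" "asub R" "R \<subseteq> L" "L \<subseteq> agen (B \<union> R)"
  shows "\<exists>Y. finite Y \<and> Y \<subseteq> L \<and> L \<subseteq> agen (Y \<union> R)"
  using assms(1,2,4,5)
proof (induction B arbitrary: L)
  case empty
  then show ?case by (intro exI[of _ "{}"]) auto
next
  case (insert x B)
  \<comment> \<open>The possible coefficients of x in elements of L.\<close>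
  define D where "D = {n. \<exists>l\<in>L. l - frag_cmul n x \<in> agen (B \<union> R)}"
  have D: "\<exists>n\<in>D. l - frag_cmul n x \<in> agen (B \<union> R)" if "l \<in> L" for l
    using agen_insert[of l x "B \<union> R"] insert.prems(3) that unfolding D_def by auto
  let ?L = "L \<inter> agen (B \<union> R)"
  \<comment> \<open>The elements of L without x are covered by the induction hypothesis.\<close>
  have "asub ?L" using insert.prems(1) asub_agen[of "B \<union> R"] unfolding asub_def by blast
  moreover have "R \<subseteq> ?L" using insert.prems(2) by (auto intro: agen.base)
  ultimately obtain Y where Y: "finite Y" "Y \<subseteq> ?L" "?L \<subseteq> agen (Y \<union> R)" using insert.IH[of ?L] by blast
  have D0: "0 \<in> D"
    unfolding D_def using asubD(1)[OF insert.prems(1)] by (auto intro!: bexI[of _ 0] agen.zero)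
  have Ddiff: "m - n \<in> D" if "m \<in> D" "n \<in> D" for m n
  proof -
    obtain k l where "k \<in> L" "l \<in> L" "k - frag_cmul m x \<in> agen (B \<union> R)" "l - frag_cmul n x \<in> agen (B \<union> R)"
      using \<open>m \<in> D\<close> \<open>n \<in> D\<close> unfolding D_def by blast
    then show ?thesis
      unfolding D_def using agen.diff[of "k - frag_cmul m x" "B \<union> R" "l - frag_cmul n x"] asubD(2)[OF insert.prems(1)]
      by (auto simp: frag_cmul_diff_distrib algebra_simps intro!: bexI[of _ "k - l"])
  qed
  show ?case
  proof (cases "\<exists>n\<in>D. n > 0")
    case False
    have "n = 0" if "n \<in> D" for n
    proof (rule ccontr)
      assume "n \<noteq> 0"
      then show False using False \<open>n \<in> D\<close> Ddiff[OF D0 \<open>n \<in> D\<close>] by (metis diff_0 neg_0_less_iff_less linorder_neqE)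
    qed
    then have "L \<subseteq> ?L" using D by fastforce
    then show ?thesis using Y by blast
  next
    case True
    define d where "d = int (LEAST k. k > 0 \<and> int k \<in> D)"
    obtain n where "n \<in> D" "n > 0" using True by blast
    then have "nat n > 0 \<and> int (nat n) \<in> D" by simp
    from LeastI[of "\<lambda>k. k > 0 \<and> int k \<in> D", OF this] have d: "d > 0" "d \<in> D" unfolding d_def by simp_all
    have least: "d \<le> n" if "n \<in> D" "n > 0" for n
      using Least_le[of "\<lambda>k. k > 0 \<and> int k \<in> D" "nat n"] that unfolding d_def by simp
    \<comment> \<open>An element of L with the least positive coefficient at x; it takes the place
      of the generator x.\<close>
    obtain l0 where l0: "l0 \<in> L" "l0 - frag_cmul d x \<in> agen (B \<union> R)" using d(2) unfolding D_def by blast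
    have "L \<subseteq> agen (insert l0 Y \<union> R)"
    proof
      fix l assume l: "l \<in> L"
      obtain n where n: "n \<in> D" "l - frag_cmul n x \<in> agen (B \<union> R)" using D[OF l] by blast
      obtain q where q: "n = d * q" using int_subgroup_generator[OF D0 Ddiff d(2,1) least n(1)] by auto
      have "l - frag_cmul q l0 \<in> L"
        by (rule asubD(2)[OF insert.prems(1) l asub_cmul[OF insert.prems(1) l0(1)]])
      moreover have "l - frag_cmul q l0 \<in> agen (B \<union> R)"
      proof -
        have "(l - frag_cmul n x) - frag_cmul q (l0 - frag_cmul d x) \<in> agen (B \<union> R)"
          by (rule agen.diff[OF n(2) asub_cmul[OF asub_agen l0(2)]])
        moreover have "frag_cmul q (l0 - frag_cmul d x) = frag_cmul q l0 - frag_cmul n x"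
          using frag_cmul_distrib2[of q "l0 - frag_cmul d x" "frag_cmul d x"]
          by (simp add: q algebra_simps)
        ultimately show ?thesis by simp
      qed
      ultimately have "l - frag_cmul q l0 \<in> agen (Y \<union> R)" using Y(3) by blast
      then have "l - frag_cmul q l0 \<in> agen (insert l0 Y \<union> R)" using agen_mono[of "Y \<union> R" "insert l0 Y \<union> R"] by blast
      moreover have "frag_cmul q l0 \<in> agen (insert l0 Y \<union> R)"
        by (rule asub_cmul[OF asub_agen agen.base]) simp
      ultimately show "l \<in> agen (insert l0 Y \<union> R)" using asub_add[OF asub_agen] by fastforce
    qed
    then show ?thesis using Y(1,2) l0(1) by (intro exI[of _ "insert l0 Y"]) auto
  qed
qed

lemma agen_keys: "(\<And>x. x \<in> B \<Longrightarrow> Poly_Mapping.keys x \<subseteq> S) \<Longrightarrow> y \<in> agen B \<Longrightarrow> Poly_Mapping.keys y \<subseteq> S"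
  for y :: "'a \<Rightarrow>\<^sub>0 int"
  by (erule agen.induct) (auto dest!: subsetD[OF keys_diff])

lemma generate_free_Abelian_group:
  assumes B: "\<And>x. x \<in> B \<Longrightarrow> Poly_Mapping.keys x \<subseteq> S"
  shows "generate (free_Abelian_group S) B = agen B"
proof (intro equalityI subsetI)
  interpret group "free_Abelian_group S" by simp
  fix x
  { assume "x \<in> generate (free_Abelian_group S) B"
    then show "x \<in> agen B"
      by induction (auto intro: agen.zero agen.base asub_add asub_uminus simp: inv_free_Abelian_group[OF B]) }
  assume "x \<in> agen B"
  then show "x \<in> generate (free_Abelian_group S) B"
  proof induction
    case zero
    then show ?case using generate.one[of "free_Abelian_group S" B] by simp
  next
    case (base x)
    then show ?case by (rule generate.incl)
  next
    case (diff x y)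
    have "Poly_Mapping.keys y \<subseteq> S" by (rule agen_keys[OF B diff.hyps(2)])
    moreover have "B \<subseteq> carrier (free_Abelian_group S)" using B by (intro subsetI) simp
    ultimately have "-y \<in> generate (free_Abelian_group S) B"
      using generate_m_inv_closed[of B y] diff.IH(2) by (simp add: inv_free_Abelian_group)
    from generate.eng[OF diff.IH(1) this] show ?case by simp
  qed
qed

lemma frag_in_agen: "(\<And>M. M \<in> Poly_Mapping.keys x \<Longrightarrow> frag_of M \<in> L) \<Longrightarrow> asub L \<Longrightarrow> x \<in> L"
proof (rule free_Abelian_group_induct[of x "Poly_Mapping.keys x"])
qed (auto intro: asubD)

lemma frag_extend_agen:
  assumes "x \<in> agen B" "asub L" "\<And>b. b \<in> B \<Longrightarrow> frag_extend f b \<in> L"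
  shows "frag_extend f x \<in> L"
  using assms(1) by induction (use assms(2,3) in \<open>simp_all add: frag_extend_diff asubD\<close>)

section \<open>The group of stable classes\<close>

context bound_quiver_algebra
begin

text \<open>The relations of the stable Grothendieck group, as elements of the free abelian group on
  the modules.\<close>

definition relators :: "(('v, 'e, 'k) rep \<Rightarrow>\<^sub>0 int) set" where
  "relators = {frag_of M - (frag_of M' + frag_of M'') | M M' M''.
         M \<in> modules Q I \<and> M' \<in> modules Q I \<and> M'' \<in> modules Q I \<and> isomorphic Q M (dsum Q M' M'')} \<union>
      {frag_of P | P. projective Q I P}"

abbreviation FM :: "(('v, 'e, 'k) rep \<Rightarrow>\<^sub>0 int) monoid" where
  "FM \<equiv> free_Abelian_group (modules Q I)"

text \<open>The preimage in the free abelian group of the subgroup generated by the classes of some modules.\<close>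

definition span0 :: "('v, 'e, 'k) rep set \<Rightarrow> (('v, 'e, 'k) rep \<Rightarrow>\<^sub>0 int) set" where
  "span0 S = agen (frag_of ` S \<union> relators)"

lemma relators_keys: "r \<in> relators \<Longrightarrow> Poly_Mapping.keys r \<subseteq> modules Q I"
proof -
  assume "r \<in> relators"
  then consider M M' M'' where "r = frag_of M - (frag_of M' + frag_of M'')"
      "M \<in> modules Q I" "M' \<in> modules Q I" "M'' \<in> modules Q I"
    | P where "r = frag_of P" "projective Q I P"
    unfolding relators_def by blast
  then show ?thesis
  proof cases
    case 1
    then have "r \<in> carrier FM"
      using keys_diff[of "frag_of M" "frag_of M' + frag_of M''"] Poly_Mapping.keys_add[of "frag_of M'" "frag_of M''"]
      by (fastforce simp: keys_frag_of)
    then show ?thesis by simp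
  qed (simp add: projective_def)
qed

lemma K0_relations_agen: "K0_relations Q I = agen relators"
  unfolding K0_relations_def relators_def[symmetric]
  by (rule generate_free_Abelian_group) (rule relators_keys)

lemma asub_span0 [simp]: "asub (span0 S)"
  by (simp add: span0_def)

lemma span0_base: "M \<in> S \<Longrightarrow> frag_of M \<in> span0 S"
  unfolding span0_def by (rule agen.base) simp

lemma span0_relators: "agen relators \<subseteq> span0 S"
  unfolding span0_def by (rule agen_mono) simp

lemma span0_mono: "S \<subseteq> T \<Longrightarrow> span0 S \<subseteq> span0 T"
  unfolding span0_def by (rule agen_mono) auto

lemma span0_least: "asub L \<Longrightarrow> agen relators \<subseteq> L \<Longrightarrow> (\<And>M. M \<in> S \<Longrightarrow> frag_of M \<in> L) \<Longrightarrow> span0 S \<subseteq> L"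
  unfolding span0_def by (rule agen_subset) (auto intro: agen.base)

lemma span0_isum:
  assumes "M \<in> modules Q I" "N \<in> modules Q I" "P \<in> modules Q I" "isum Q M N P"
  shows "frag_of M - (frag_of N + frag_of P) \<in> agen relators"
  by (rule agen.base)
     (use assms isomorphic_dsum_iff[OF assms(1-3)[THEN modules_dims]] in \<open>auto simp: relators_def\<close>)

lemma span0_projective: "fproj Q I P \<Longrightarrow> frag_of P \<in> agen relators"
  by (rule agen.base) (auto simp: relators_def projective_iff)

text \<open>Isomorphic modules have equal classes, as one of them is the sum of the other and the
  zero module, which is projective.\<close>

lemma span0_iso:
  assumes "M \<in> modules Q I" "N \<in> modules Q I" "riso Q M N"
  shows "frag_of M - frag_of N \<in> agen relators"
proof -
  note d = assms(1,2)[THEN modules_dims]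
  have b: "isum Q N N zero_rep"
    unfolding isum_def
    by (intro exI[of _ "\<lambda>v x. x"] exI[of _ "\<lambda>v x. 0"] biprodI)
       (auto intro!: fhomI simp: lin_id lin_zero lin_0[OF lin_act])
  have "isum Q M N zero_rep"
    by (rule isum_transport[OF d(2) d(2) modules_dims[OF zero_rep_module] b assms(3) d(1)])
  from span0_isum[OF assms(1,2) zero_rep_module this] span0_projective[OF fproj_zero]
  have "frag_of M - (frag_of N + frag_of zero_rep) + frag_of zero_rep \<in> agen relators"
    by (rule asub_add[OF asub_agen])
  then show ?thesis by (simp add: algebra_simps)
qed

lemma span0_iso_mem:
  assumes "M \<in> modules Q I" "N \<in> modules Q I" "riso Q M N" "asub L" "agen relators \<subseteq> L" "frag_of N \<in> L"
  shows "frag_of M \<in> L"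
  using asub_add[OF assms(4) subsetD[OF assms(5) span0_iso[OF assms(1-3)]] assms(6)] by simp

subsection \<open>Cosets\<close>

definition cls :: "(('v, 'e, 'k) rep \<Rightarrow>\<^sub>0 int) \<Rightarrow> (('v, 'e, 'k) rep \<Rightarrow>\<^sub>0 int) set" where
  "cls x = agen relators #>\<^bsub>FM\<^esub> x"

lemma normal_relations: "agen relators \<lhd> FM"
proof -
  interpret comm_group FM by (rule abelian_free_Abelian_group)
  have "subgroup (generate FM relators) FM"
    by (rule generate_is_subgroup) (use relators_keys in auto)
  then show ?thesis
    using generate_free_Abelian_group[OF relators_keys] by (simp add: normal_iff_subgroup)
qed

lemma K0_eq: "K0 Q I = FM Mod agen relators"
  by (simp add: K0_def K0_relations_agen)

lemma group_K0: "group (K0 Q I)"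
  unfolding K0_eq by (rule normal.factorgroup_is_group[OF normal_relations])

lemma K0_class_cls: "K0_class Q I M = cls (frag_of M)"
  by (simp add: K0_class_def cls_def K0_relations_agen)

lemma carrier_K0: "carrier (K0 Q I) = cls ` carrier FM"
  unfolding K0_eq carrier_FactGroup cls_def ..

lemma cls_add: "x \<in> carrier FM \<Longrightarrow> y \<in> carrier FM \<Longrightarrow> cls x \<otimes>\<^bsub>K0 Q I\<^esub> cls y = cls (x + y)"
  unfolding K0_eq cls_def using normal.rcos_sum[OF normal_relations, of x y] by simp

lemma cls_hom: "cls \<in> hom FM (K0 Q I)"
  by (rule homI) (simp_all add: carrier_K0 cls_add)

lemma cls_group_hom: "group_hom FM (K0 Q I) cls"
  by (simp add: group_hom_def group_hom_axioms_def group_K0 cls_hom)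

lemma diff_closed_FM: "x \<in> carrier FM \<Longrightarrow> y \<in> carrier FM \<Longrightarrow> x - y \<in> carrier FM"
  using keys_diff[of x y] by auto

lemma cls_diff:
  assumes "x \<in> carrier FM" "y \<in> carrier FM"
  shows "cls (x - y) = cls x \<otimes>\<^bsub>K0 Q I\<^esub> inv\<^bsub>K0 Q I\<^esub> cls y"
proof -
  interpret group_hom FM "K0 Q I" cls by (rule cls_group_hom)
  have "cls (x - y) = cls (x \<otimes>\<^bsub>FM\<^esub> inv\<^bsub>FM\<^esub> y)" using assms by simp
  also have "\<dots> = cls x \<otimes>\<^bsub>K0 Q I\<^esub> inv\<^bsub>K0 Q I\<^esub> cls y"
    using assms by (simp only: hom_mult G.inv_closed hom_inv)
  finally show ?thesis .
qed

lemma cls_eq_iff: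
  assumes x: "x \<in> carrier FM" and y: "y \<in> carrier FM"
  shows "cls x = cls y \<longleftrightarrow> x - y \<in> agen relators"
proof -
  interpret N: normal "agen relators" FM by (rule normal_relations)
  have sub: "subgroup (agen relators) FM" by (rule N.subgroup_axioms)
  have mem: "x \<in> agen relators #>\<^bsub>FM\<^esub> y \<longleftrightarrow> x - y \<in> agen relators"
    unfolding r_coset_def by (auto intro!: bexI[of _ "x - y"])
  show ?thesis
    unfolding cls_def mem[symmetric]
    using N.repr_independence[OF _ y sub, of x] N.rcos_self[OF x sub] by auto
qed

lemma cls_eq_mem:
  assumes "x \<in> carrier FM" "y \<in> carrier FM" "cls x = cls y" "asub L" "agen relators \<subseteq> L" "y \<in> L"
  shows "x \<in> L"
proof -
  have "x - y \<in> L" using assms cls_eq_iff by blast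
  from asub_add[OF assms(4) this assms(6)] show ?thesis by simp
qed

lemma span0_carrier: "S \<subseteq> modules Q I \<Longrightarrow> x \<in> span0 S \<Longrightarrow> x \<in> carrier FM"
  unfolding span0_def carrier_free_Abelian_group_iff
  by (rule agen_keys) (use relators_keys in auto)

lemma cls_image_subgroup:
  assumes L: "asub L" "L \<subseteq> carrier FM"
  shows "subgroup (cls ` L) (K0 Q I)"
proof -
  interpret K: group "K0 Q I" by (rule group_K0)
  interpret group_hom FM "K0 Q I" cls by (rule cls_group_hom)
  show ?thesis
  proof (rule K.subgroupI)
    show "cls ` L \<subseteq> carrier (K0 Q I)" using L(2) by (auto simp: carrier_K0)
    show "cls ` L \<noteq> {}" using asubD(1)[OF L(1)] by blast
    fix a assume "a \<in> cls ` L"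
    then obtain x where x: "x \<in> L" "a = cls x" by blast
    have "inv\<^bsub>K0 Q I\<^esub> a = cls (inv\<^bsub>FM\<^esub> x)" using hom_inv[of x] x L(2) by blast
    also have "\<dots> = cls (-x)" using x L(2) by (auto simp: inv_free_Abelian_group)
    finally show "inv\<^bsub>K0 Q I\<^esub> a \<in> cls ` L" using asub_uminus[OF L(1) x(1)] by blast
    fix b assume "b \<in> cls ` L"
    then obtain y where y: "y \<in> L" "b = cls y" by blast
    have "a \<otimes>\<^bsub>K0 Q I\<^esub> b = cls (x + y)" using x y L(2) cls_add by blast
    then show "a \<otimes>\<^bsub>K0 Q I\<^esub> b \<in> cls ` L" using asub_add[OF L(1) x(1) y(1)] by blast
  qed
qed

text \<open>Finitely many elements of the group involve finitely many modules, so a finitely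
  generated subgroup is contained in one that is generated by the classes of finitely many
  modules.\<close>

lemma fin_gen_subgroupD:
  assumes "fin_gen_subgroup (K0 Q I) H"
  obtains S where "finite S" "S \<subseteq> modules Q I" "\<And>x. x \<in> carrier FM \<Longrightarrow> cls x \<in> H \<Longrightarrow> x \<in> span0 S"
proof -
  interpret K: group "K0 Q I" by (rule group_K0)
  obtain T where T: "finite T" "T \<subseteq> carrier (K0 Q I)" "H = generate (K0 Q I) T"
    using assms unfolding fin_gen_subgroup_def by blast
  then have "\<forall>t\<in>T. \<exists>x\<in>carrier FM. cls x = t" unfolding carrier_K0 by blast
  then obtain g where g: "\<And>t. t \<in> T \<Longrightarrow> g t \<in> carrier FM" "\<And>t. t \<in> T \<Longrightarrow> cls (g t) = t" by metis
  define S where "S = (\<Union>t\<in>T. Poly_Mapping.keys (g t))"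
  have S: "finite S" "S \<subseteq> modules Q I" unfolding S_def using T(1) g(1) by auto
  have gS: "g t \<in> span0 S" if "t \<in> T" for t
    by (rule frag_in_agen) (use that in \<open>auto simp: S_def intro!: span0_base\<close>)
  have sp: "span0 S \<subseteq> carrier FM" using span0_carrier[OF S(2)] by blast
  have "T \<subseteq> cls ` span0 S" using g(2) gS by (metis imageI subsetI)
  from K.generate_subgroup_incl[OF this cls_image_subgroup[OF asub_span0 sp]]
  have H: "H \<subseteq> cls ` span0 S" by (simp add: T(3))
  have "x \<in> span0 S" if x: "x \<in> carrier FM" and "cls x \<in> H" for x
  proof -
    obtain y where y: "y \<in> span0 S" "cls x = cls y" using H \<open>cls x \<in> H\<close> by blast
    show ?thesis by (rule cls_eq_mem[OF x subsetD[OF sp y(1)] y(2) asub_span0 span0_relators y(1)])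
  qed
  then show thesis using that S by blast
qed

text \<open>The converse: a subgroup contained in a finitely generated one is finitely generated.
  Relative to the relations this holds in the free abelian group.\<close>

lemma fin_gen_subgroupI:
  assumes H: "subgroup H (K0 Q I)" and S: "finite S" "S \<subseteq> modules Q I"
    and mem: "\<And>x. x \<in> carrier FM \<Longrightarrow> cls x \<in> H \<Longrightarrow> x \<in> span0 S"
  shows "fin_gen_subgroup (K0 Q I) H"
proof -
  interpret K: group "K0 Q I" by (rule group_K0)
  interpret h: group_hom FM "K0 Q I" cls by (rule cls_group_hom)
  define L where "L = {x \<in> carrier FM. cls x \<in> H}"
  let ?R = "agen relators"
  have Rc: "?R \<subseteq> carrier FM" using span0_carrier[of "{}"] by (auto simp: span0_def)
  have clsR: "cls x = \<one>\<^bsub>K0 Q I\<^esub>" if "x \<in> ?R" for x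
  proof -
    have "cls x = cls 0" using that Rc agen.zero[of relators]
      by (subst cls_eq_iff) (auto simp del: carrier_free_Abelian_group_iff)
    then show ?thesis using h.hom_one by simp
  qed
  have L: "asub L"
    unfolding asub_def
  proof (intro conjI ballI)
    show "0 \<in> L" unfolding L_def using clsR[OF agen.zero] subgroup.one_closed[OF H] by simp
    fix x y assume "x \<in> L" "y \<in> L"
    then show "x - y \<in> L"
      unfolding L_def
      using cls_diff[of x y] diff_closed_FM[of x y] subgroup.m_closed[OF H] subgroup.m_inv_closed[OF H] by auto
  qed
  have RL: "?R \<subseteq> L" unfolding L_def using clsR Rc subgroup.one_closed[OF H]
    by (auto simp del: carrier_free_Abelian_group_iff)
  have "L \<subseteq> span0 S" using mem unfolding L_def by blast
  also have "\<dots> \<subseteq> agen (frag_of ` S \<union> ?R)"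
    unfolding span0_def by (rule agen_mono) (auto intro: agen.base)
  finally have "L \<subseteq> agen (frag_of ` S \<union> ?R)" .
  from subgroup_finitely_generated[OF finite_imageI[OF S(1)] L asub_agen RL this]
  obtain Y where Y: "finite Y" "Y \<subseteq> L" "L \<subseteq> agen (Y \<union> ?R)" by blast
  have Yc: "cls ` Y \<subseteq> carrier (K0 Q I)" using Y(2) by (auto simp: L_def carrier_K0)
  have gen: "x \<in> carrier FM \<and> cls x \<in> generate (K0 Q I) (cls ` Y)" if "x \<in> agen (Y \<union> ?R)" for x
    using that
  proof induction
    case zero
    show ?case using clsR[OF agen.zero] generate.one by simp
  next
    case (base x)
    then show ?case
    proof
      assume "x \<in> Y"
      then show ?thesis using Y(2) by (auto simp: L_def intro: generate.incl)
    next
      assume "x \<in> ?R"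
      then show ?thesis using clsR[of x] Rc generate.one by (auto simp del: carrier_free_Abelian_group_iff)
    qed
  next
    case (diff x y)
    then show ?case
      using cls_diff[of x y] diff_closed_FM[of x y] K.generate_m_inv_closed[OF Yc] generate.eng by metis
  qed
  have "H = generate (K0 Q I) (cls ` Y)"
  proof
    show "H \<subseteq> generate (K0 Q I) (cls ` Y)"
    proof
      fix a assume a: "a \<in> H"
      then obtain x where "x \<in> carrier FM" "a = cls x" using subgroup.subset[OF H] unfolding carrier_K0 by blast
      then show "a \<in> generate (K0 Q I) (cls ` Y)" using gen Y(3) a unfolding L_def by blast
    qed
    show "generate (K0 Q I) (cls ` Y) \<subseteq> H"
      by (rule K.generate_subgroup_incl[OF _ H]) (use Y(2) in \<open>auto simp: L_def\<close>)
  qed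
  then show ?thesis unfolding fin_gen_subgroup_def using Y(1) Yc by blast
qed

subsection \<open>The syzygy endomorphism\<close>

text \<open>The endomorphism of the free abelian group that induces the syzygy endomorphism. Working
  with it avoids cosets.\<close>

definition Om :: "(('v, 'e, 'k) rep \<Rightarrow>\<^sub>0 int) \<Rightarrow> (('v, 'e, 'k) rep \<Rightarrow>\<^sub>0 int)" where
  "Om = frag_extend (\<lambda>M. frag_of (syzygy Q I M))"

lemma Om_carrier:
  assumes "x \<in> carrier FM"
  shows "Om x \<in> carrier FM"
proof -
  have "Poly_Mapping.keys x \<subseteq> modules Q I" using assms by simp
  then show ?thesis
  proof (rule free_Abelian_group_induct)
    fix a b assume "Om a \<in> carrier FM" "Om b \<in> carrier FM"
    then show "Om (a - b) \<in> carrier FM" unfolding Om_def frag_extend_diff by (rule diff_closed_FM)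
  qed (simp_all add: Om_def syzygy_module)
qed

text \<open>Syzygies are additive and the syzygy of a projective module is zero, so the syzygy
  endomorphism is well defined.\<close>

lemma Om_relators:
  assumes "r \<in> agen relators"
  shows "Om r \<in> agen relators"
  unfolding Om_def
proof (rule frag_extend_agen[OF assms asub_agen])
  fix r assume "r \<in> relators"
  then consider M M' M'' where "r = frag_of M - (frag_of M' + frag_of M'')"
      "M \<in> modules Q I" "M' \<in> modules Q I" "M'' \<in> modules Q I" "isomorphic Q M (dsum Q M' M'')"
    | P where "r = frag_of P" "projective Q I P"
    unfolding relators_def by blast
  then show "frag_extend (\<lambda>M. frag_of (syzygy Q I M)) r \<in> agen relators"
  proof cases
    case 1
    have "isum Q M M' M''" using 1(5) isomorphic_dsum_iff[OF 1(2-4)[THEN modules_dims]] by simp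
    from syz_additive[OF 1(2) this is_syz_syzygy[OF 1(2)] is_syz_syzygy[OF 1(3)] is_syz_syzygy[OF 1(4)]]
    show ?thesis
      unfolding 1(1) by (simp add: frag_extend_diff frag_extend_add span0_isum syzygy_module 1)
  next
    case 2
    then have P: "fproj Q I P" by (simp add: projective_iff)
    note PM = fprojD(1)[OF P]
    have "riso Q (syzygy Q I P) zero_rep"
      by (rule syz_unique[OF is_syz_syzygy[OF PM] syz_projective[OF P] iso_refl])
    from span0_iso_mem[OF syzygy_module[OF PM] zero_rep_module this asub_agen order_refl span0_projective[OF fproj_zero]]
    show ?thesis unfolding 2(1) by simp
  qed
qed

lemma Om_hom: "Om \<in> hom FM FM"
  by (rule homI) (simp_all only: Om_carrier mult_free_Abelian_group, simp add: Om_def frag_extend_add)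

lemma Omega_bar_exists:
  obtains h where "h \<in> hom (K0 Q I) (K0 Q I)" "\<And>x. x \<in> carrier FM \<Longrightarrow> h (cls x) = cls (Om x)"
proof -
  have "cls \<circ> Om \<in> hom FM (K0 Q I)" by (rule hom_compose[OF Om_hom cls_hom])
  moreover have "(cls \<circ> Om) x = (cls \<circ> Om) y"
    if "x \<in> carrier FM" "y \<in> carrier FM" "agen relators #>\<^bsub>FM\<^esub> x = agen relators #>\<^bsub>FM\<^esub> y" for x y
  proof -
    have "x - y \<in> agen relators" using that cls_eq_iff unfolding cls_def by blast
    then have "Om (x - y) \<in> agen relators" by (rule Om_relators)
    then have "Om x - Om y \<in> agen relators" by (simp add: Om_def frag_extend_diff)
    then show ?thesis using cls_eq_iff[OF Om_carrier[OF that(1)] Om_carrier[OF that(2)]] by simp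
  qed
  ultimately show thesis
  proof (rule FactGroup_universal[OF _ normal_relations])
    fix h assume "h \<in> hom (FM Mod agen relators) (K0 Q I)"
      "\<And>x. x \<in> carrier FM \<Longrightarrow> h (agen relators #>\<^bsub>FM\<^esub> x) = (cls \<circ> Om) x"
    then show thesis using that[of h] unfolding K0_eq cls_def[symmetric] comp_def by blast
  qed
qed

lemma hom_K0_determined:
  assumes h: "h \<in> hom (K0 Q I) (K0 Q I)" "h' \<in> hom (K0 Q I) (K0 Q I)"
    and eq: "\<And>M. M \<in> modules Q I \<Longrightarrow> h (cls (frag_of M)) = h' (cls (frag_of M))" and x: "x \<in> carrier FM"
  shows "h (cls x) = h' (cls x)"
proof -
  interpret K: group "K0 Q I" by (rule group_K0)
  interpret h: group_hom "K0 Q I" "K0 Q I" h by (simp add: group_hom_def group_hom_axioms_def group_K0 h)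
  interpret h': group_hom "K0 Q I" "K0 Q I" h' by (simp add: group_hom_def group_hom_axioms_def group_K0 h)
  interpret c: group_hom FM "K0 Q I" cls by (rule cls_group_hom)
  have "Poly_Mapping.keys x \<subseteq> modules Q I" using x by simp
  then show ?thesis
  proof (rule free_Abelian_group_induct)
    have "cls 0 = \<one>\<^bsub>K0 Q I\<^esub>" using c.hom_one by simp
    then show "h (cls 0) = h' (cls 0)" by simp
  next
    fix x y assume xy: "Poly_Mapping.keys x \<subseteq> modules Q I" "Poly_Mapping.keys y \<subseteq> modules Q I"
      and e: "h (cls x) = h' (cls x)" "h (cls y) = h' (cls y)"
    have c: "cls x \<in> carrier (K0 Q I)" "cls y \<in> carrier (K0 Q I)" using xy by (auto simp: carrier_K0)
    have d: "cls (x - y) = cls x \<otimes>\<^bsub>K0 Q I\<^esub> inv\<^bsub>K0 Q I\<^esub> cls y" using cls_diff[of x y] xy by simp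
    show "h (cls (x - y)) = h' (cls (x - y))"
      using c e unfolding d by simp
  qed (rule eq)
qed

text \<open>The syzygy endomorphism is specified as the only homomorphism with the right values on
  the classes of modules, cut off outside the group. Existence and uniqueness identify it with the
  map induced by \<open>Om\<close>.\<close>

lemma Omega_bar_cls:
  assumes "x \<in> carrier FM"
  shows "Omega_bar Q I (cls x) = cls (Om x)"
proof -
  obtain h where h: "h \<in> hom (K0 Q I) (K0 Q I)" "\<And>x. x \<in> carrier FM \<Longrightarrow> h (cls x) = cls (Om x)"
    using Omega_bar_exists by blast
  let ?P = "\<lambda>h. h \<in> hom (K0 Q I) (K0 Q I) \<and> h \<in> extensional (carrier (K0 Q I)) \<and>
     (\<forall>M\<in>modules Q I. h (K0_class Q I M) = K0_class Q I (syzygy Q I M))"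
  let ?h = "restrict h (carrier (K0 Q I))"
  have he: "?h (cls x) = cls (Om x)" if "x \<in> carrier FM" for x
    using h(2)[OF that] that by (simp add: carrier_K0 del: carrier_free_Abelian_group_iff)
  have hh: "?h \<in> hom (K0 Q I) (K0 Q I)"
    using h(1) group.is_monoid[OF group_K0] by (auto simp: hom_def monoid.m_closed)
  have "?P ?h"
    using he hh by (simp add: K0_class_cls Om_def del: carrier_free_Abelian_group_iff)
  moreover have "h' = ?h" if h': "?P h'" for h'
  proof (rule extensionalityI[of _ "carrier (K0 Q I)"])
    fix c assume "c \<in> carrier (K0 Q I)"
    then obtain x where x: "x \<in> carrier FM" "c = cls x" unfolding carrier_K0 by blast
    have e: "h' (cls (frag_of M)) = ?h (cls (frag_of M))" if "M \<in> modules Q I" for M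
      using h' he[of "frag_of M"] that by (simp add: K0_class_cls Om_def)
    show "h' c = ?h c" unfolding x(2) by (rule hom_K0_determined[OF _ hh e x(1)]) (use h' in auto)
  qed (use h' in auto)
  ultimately have "Omega_bar Q I = ?h" unfolding Omega_bar_def by (rule the_equality)
  then show ?thesis using he[OF assms] by simp
qed

lemma Om_pow_carrier: "x \<in> carrier FM \<Longrightarrow> (Om ^^ n) x \<in> carrier FM"
  by (induction n) (simp_all only: funpow.simps id_apply comp_apply Om_carrier)

lemma Omega_bar_pow: "x \<in> carrier FM \<Longrightarrow> (Omega_bar Q I ^^ n) (cls x) = cls ((Om ^^ n) x)"
proof (induction n)
  case (Suc n)
  have "(Omega_bar Q I ^^ Suc n) (cls x) = Omega_bar Q I (cls ((Om ^^ n) x))" using Suc by simp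
  also have "\<dots> = cls ((Om ^^ Suc n) x)" using Omega_bar_cls[OF Om_pow_carrier[OF Suc.prems]] by simp
  finally show ?case .
qed simp

lemma Om_pow_diff: "(Om ^^ n) (x - y) = (Om ^^ n) x - (Om ^^ n) y"
  by (induction n) (simp_all add: Om_def frag_extend_diff)

lemma Om_pow_frag: "(Om ^^ n) (frag_of M) = frag_of ((syzygy Q I ^^ n) M)"
  by (induction n) (simp_all add: Om_def)

text \<open>The n-th syzygies of all modules generate the image of the n-th power of the syzygy endomorphism,
  and it is enough to bound this image by a finitely generated subgroup.\<close>

lemma syzygy_finite_iff:
  "syzygy_finite Q I \<longleftrightarrow>
    (\<exists>n S. finite S \<and> S \<subseteq> modules Q I \<and> (\<forall>M\<in>modules Q I. frag_of ((syzygy Q I ^^ n) M) \<in> span0 S))"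
proof
  assume "syzygy_finite Q I"
  then obtain n where f: "fin_gen_subgroup (K0 Q I) ((Omega_bar Q I ^^ n) ` carrier (K0 Q I))"
    unfolding syzygy_finite_def by blast
  obtain S where S: "finite S" "S \<subseteq> modules Q I"
    "\<And>x. x \<in> carrier FM \<Longrightarrow> cls x \<in> (Omega_bar Q I ^^ n) ` carrier (K0 Q I) \<Longrightarrow> x \<in> span0 S"
    using fin_gen_subgroupD[OF f] by blast
  have "frag_of ((syzygy Q I ^^ n) M) \<in> span0 S" if M: "M \<in> modules Q I" for M
  proof (rule S(3))
    have M': "frag_of M \<in> carrier FM" using M by simp
    then have "cls (frag_of ((syzygy Q I ^^ n) M)) = (Omega_bar Q I ^^ n) (cls (frag_of M))"
      using Omega_bar_pow Om_pow_frag by metis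
    then show "cls (frag_of ((syzygy Q I ^^ n) M)) \<in> (Omega_bar Q I ^^ n) ` carrier (K0 Q I)"
      using M' unfolding carrier_K0 by blast
  qed (simp add: syzygy_pow_module M)
  then show "\<exists>n S. finite S \<and> S \<subseteq> modules Q I \<and> (\<forall>M\<in>modules Q I. frag_of ((syzygy Q I ^^ n) M) \<in> span0 S)"
    using S(1,2) by blast
next
  assume "\<exists>n S. finite S \<and> S \<subseteq> modules Q I \<and> (\<forall>M\<in>modules Q I. frag_of ((syzygy Q I ^^ n) M) \<in> span0 S)"
  then obtain n S where S: "finite S" "S \<subseteq> modules Q I"
    "\<And>M. M \<in> modules Q I \<Longrightarrow> frag_of ((syzygy Q I ^^ n) M) \<in> span0 S" by blast
  let ?L = "(Om ^^ n) ` carrier FM"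
  have im: "(Omega_bar Q I ^^ n) ` carrier (K0 Q I) = cls ` ?L"
    unfolding carrier_K0 image_image by (rule image_cong[OF refl Omega_bar_pow])
  have "asub ?L"
    unfolding asub_def
  proof (intro conjI ballI)
    have "(Om ^^ n) 0 = 0" using Om_pow_diff[of n 0 0] by simp
    then show "0 \<in> ?L" by (intro image_eqI[of _ _ 0]) simp_all
    fix x y assume "x \<in> ?L" "y \<in> ?L"
    then show "x - y \<in> ?L" using diff_closed_FM by (auto simp flip: Om_pow_diff simp del: carrier_free_Abelian_group_iff)
  qed
  then have "subgroup (cls ` ?L) (K0 Q I)" by (rule cls_image_subgroup) (use Om_pow_carrier in blast)
  moreover have "x \<in> span0 S" if x: "x \<in> carrier FM" "cls x \<in> cls ` ?L" for x
  proof -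
    obtain y where y: "y \<in> carrier FM" "cls x = cls ((Om ^^ n) y)" using x(2) by blast
    have "Poly_Mapping.keys y \<subseteq> modules Q I" using y(1) by simp
    then have "(Om ^^ n) y \<in> span0 S"
    proof (rule free_Abelian_group_induct)
      show "(Om ^^ n) 0 \<in> span0 S" using Om_pow_diff[of n 0 0] asubD(1)[OF asub_span0] by simp
    qed (simp_all add: Om_pow_diff Om_pow_frag S(3) asubD(2)[OF asub_span0])
    then show ?thesis
      by (rule cls_eq_mem[OF x(1) Om_pow_carrier[OF y(1)] y(2) asub_span0 span0_relators])
  qed
  ultimately have "fin_gen_subgroup (K0 Q I) (cls ` ?L)" by (rule fin_gen_subgroupI[OF _ S(1,2)])
  then show "syzygy_finite Q I" unfolding syzygy_finite_def by (intro exI[of _ n]) (simp only: im)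
qed

end

section \<open>Morita context algebras with trivial products\<close>

text \<open>The hypotheses of the theorem that concern the relations, in a form symmetric in A and B:
  c_ab and c_ba are the sets of arrows from A to B and from B to A, and such an arrow composes to
  zero with every arrow that ends at its source.\<close>

locale morita =
  A: bound_quiver_algebra QA IA + B: bound_quiver_algebra QB IB + C: bound_quiver_algebra QC IC
  for QA QB QC :: "('v, 'e) pre_digraph" and IA IB IC :: "(('v, 'e) path \<Rightarrow>\<^sub>0 'k::field) set" +
  fixes c_ab c_ba :: "'e set"
  assumes subA: "subquiver QA QC" and subB: "subquiver QB QC"
    and IA_eq: "IC \<inter> carrier (path_algebra QA) = IA" and IB_eq: "IC \<inter> carrier (path_algebra QB) = IB"
    and verts_C: "verts QC = verts QA \<union> verts QB" and disj: "verts QA \<inter> verts QB = {}"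
    and arcs_C: "arcs QC = arcs QA \<union> arcs QB \<union> c_ab \<union> c_ba"
    and c_ab: "\<And>a. a \<in> c_ab \<Longrightarrow> tail QC a \<in> verts QA \<and> head QC a \<in> verts QB"
    and c_ba: "\<And>a. a \<in> c_ba \<Longrightarrow> tail QC a \<in> verts QB \<and> head QC a \<in> verts QA"
    and zero_ab: "\<And>a b. a \<in> arcs QA \<union> c_ba \<Longrightarrow> b \<in> c_ab \<Longrightarrow>
      arrow QC a \<otimes>\<^bsub>path_algebra QC\<^esub> arrow QC b \<in> IC"
    and zero_ba: "\<And>a b. a \<in> arcs QB \<union> c_ab \<Longrightarrow> b \<in> c_ba \<Longrightarrow>
      arrow QC a \<otimes>\<^bsub>path_algebra QC\<^esub> arrow QC b \<in> IC"
begin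

text \<open>The hypotheses do not distinguish A from B. Facts about the B-side are obtained by
  exchanging the two.\<close>

lemma flip: "morita QB QA QC IB IA IC c_ba c_ab"
  by unfold_locales
     (use subA subB IA_eq IB_eq verts_C disj arcs_C c_ab c_ba zero_ab zero_ba in \<open>auto simp: Un_ac Int_commute\<close>)

abbreviation "extA \<equiv> extend_rep QC QA"
abbreviation "extB \<equiv> extend_rep QC QB"
abbreviation "resA \<equiv> restrict_rep QA"
abbreviation "resB \<equiv> restrict_rep QB"

lemma arcs_A:
  assumes "a \<in> arcs QA"
  shows "a \<in> arcs QC" "tail QC a = tail QA a" "head QC a = head QA a" "tail QA a \<in> verts QA" "head QA a \<in> verts QA"
  using assms subA A.tail_in_verts[OF assms] A.head_in_verts[OF assms] by (auto simp: subquiver_def)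

lemma arcs_B:
  assumes "a \<in> arcs QB"
  shows "a \<in> arcs QC" "tail QC a = tail QB a" "head QC a = head QB a" "tail QB a \<in> verts QB" "head QB a \<in> verts QB"
  using assms subB B.tail_in_verts[OF assms] B.head_in_verts[OF assms] by (auto simp: subquiver_def)

lemma arc_cases:
  assumes "a \<in> arcs QC"
  obtains (inA) "a \<in> arcs QA" "a \<notin> arcs QB" "tail QC a \<in> verts QA" "head QC a \<in> verts QA"
    | (inB) "a \<in> arcs QB" "a \<notin> arcs QA" "tail QC a \<in> verts QB" "head QC a \<in> verts QB"
    | (ab) "a \<in> c_ab" "a \<notin> arcs QA" "a \<notin> arcs QB" "tail QC a \<in> verts QA" "head QC a \<in> verts QB"
    | (ba) "a \<in> c_ba" "a \<notin> arcs QA" "a \<notin> arcs QB" "tail QC a \<in> verts QB" "head QC a \<in> verts QA"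
proof -
  have A: "tail QC a \<in> verts QA \<and> head QC a \<in> verts QA" if "a \<in> arcs QA" using arcs_A[OF that] by simp
  have B: "tail QC a \<in> verts QB \<and> head QC a \<in> verts QB" if "a \<in> arcs QB" using arcs_B[OF that] by simp
  have d: "v \<notin> verts QB" if "v \<in> verts QA" for v using disj that by blast
  show thesis
    using assms arcs_C A B c_ab[of a] c_ba[of a] d[of "tail QC a"] d[of "head QC a"] inA inB ab ba by blast
qed

lemma verts_cases:
  assumes "v \<in> verts QC"
  obtains (inA) "v \<in> verts QA" "v \<notin> verts QB" | (inB) "v \<in> verts QB" "v \<notin> verts QA"
  using assms verts_C disj by blast

lemma verts_A: "v \<in> verts QA \<Longrightarrow> v \<in> verts QC"
  using verts_C by blast

subsection \<open>Restriction and extension\<close>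

lemma rdim_ext: "rdim (extA M) v = (if v \<in> verts QA then rdim M v else 0)"
  by (simp add: extend_rep_def Let_def)

lemma rdim_res: "rdim (resA M) v = (if v \<in> verts QA then rdim M v else 0)"
  by (simp add: restrict_rep_def)

lemma act_ext: "act (extA M) a x = (if a \<in> arcs QA then act M a x else 0)"
  by (simp add: extend_rep_def Let_def act_def)

lemma act_res: "act (resA M) a x = (if a \<in> arcs QA then act M a x else 0)"
  by (simp add: restrict_rep_def act_def)

lemma dims_res: "dims_ok QC M \<Longrightarrow> dims_ok QA (resA M)"
  unfolding dims_ok_def
proof
  fix a assume d: "\<forall>a\<in>arcs QC. rmap M a \<in> carrier_mat (rdim M (head QC a)) (rdim M (tail QC a))"
    and a: "a \<in> arcs QA"
  show "rmap (resA M) a \<in> carrier_mat (rdim (resA M) (head QA a)) (rdim (resA M) (tail QA a))"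
    using bspec[OF d arcs_A(1)[OF a]] a arcs_A(2-5)[OF a] by (simp add: restrict_rep_def)
qed

lemma dims_ext: "dims_ok QA M \<Longrightarrow> dims_ok QC (extA M)"
  unfolding dims_ok_def using arcs_A by (auto simp: extend_rep_def Let_def)

lemma awalk_C_A: "C.awalk u p v \<Longrightarrow> set p \<subseteq> arcs QA \<Longrightarrow> u \<in> verts QA \<Longrightarrow> A.awalk u p v"
  by (induction p arbitrary: u)
     (auto simp: A.awalk_Nil_iff C.awalk_Nil_iff A.awalk_Cons_iff C.awalk_Cons_iff arcs_A)

lemma pathact_res: "set p \<subseteq> arcs QA \<Longrightarrow> pathact (resA M) p x = pathact M p x"
  by (induction p arbitrary: x) (auto simp: act_res)

lemma pathact_ext: "set p \<subseteq> arcs QA \<Longrightarrow> pathact (extA M) p x = pathact M p x"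
  by (induction p arbitrary: x) (auto simp: act_ext)

lemma pathact_ext_zero: "\<not> set p \<subseteq> arcs QA \<Longrightarrow> pathact (extA M) p x = 0"
  by (induction p arbitrary: x) (auto simp: act_ext lin_0[OF lin_pathact])

lemma IA_IC: "f \<in> IA \<Longrightarrow> f \<in> IC"
  using IA_eq by blast

lemma res_module:
  assumes M: "M \<in> modules QC IC"
  shows "resA M \<in> modules QA IA"
  unfolding A.modules_iff
proof (intro conjI ballI)
  show "dims_ok QA (resA M)" by (rule dims_res[OF C.modules_dims[OF M]])
  fix f u v x assume f: "f \<in> IA" and u: "u \<in> verts QA" and v: "v \<in> verts QA" and x: "x \<in> space (resA M) u"
  have "pathact (resA M) p x = pathact M p x" if "(u, p, v) \<in> Poly_Mapping.keys f" for p
    by (rule pathact_res) (use A.I_keys[OF f] that in \<open>auto simp: paths_def A.awalk_def\<close>)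
  then have "elemact (resA M) f u v x = elemact M f u v x" by (simp add: elemact_def)
  also have "\<dots> = 0" using M IA_IC[OF f] verts_A u v x unfolding C.modules_iff by (simp add: rdim_res)
  finally show "elemact (resA M) f u v x = 0" .
qed

lemma IC_closed:
  "f \<in> IC \<Longrightarrow> g \<in> IC \<Longrightarrow> f + g \<in> IC" "f \<in> IC \<Longrightarrow> g \<in> IC \<Longrightarrow> f - g \<in> IC" "0 \<in> IC"
  "f \<in> IC \<Longrightarrow> Poly_Mapping.keys g \<subseteq> paths QC \<Longrightarrow> palg_mult f g \<in> IC"
  "f \<in> IC \<Longrightarrow> Poly_Mapping.keys g \<subseteq> paths QC \<Longrightarrow> palg_mult g f \<in> IC"
proof -
  interpret ideal IC C.kQ by (rule C.ideal_I)
  have sub: "additive_subgroup IC C.kQ" by (rule is_additive_subgroup)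
  show add: "f + g \<in> IC" if "f \<in> IC" "g \<in> IC" for f g using additive_subgroup.a_closed[OF sub that] by (simp add: C.add_kQ)
  show "0 \<in> IC" using additive_subgroup.zero_closed[OF sub] by (simp add: path_algebra_def)
  show "palg_mult f g \<in> IC" if "f \<in> IC" "Poly_Mapping.keys g \<subseteq> paths QC" for f g
    using I_r_closed[of f g] that by (simp add: C.carrier_kQ C.mult_kQ)
  show l: "palg_mult g f \<in> IC" if "f \<in> IC" "Poly_Mapping.keys g \<subseteq> paths QC" for f g
    using I_l_closed[of f g] that by (simp add: C.carrier_kQ C.mult_kQ)
  show "f - g \<in> IC" if "f \<in> IC" "g \<in> IC" for f g
  proof -
    have g: "g \<in> carrier C.kQ" by (rule Icarr[OF that(2)])
    then have "-g \<in> carrier C.kQ" by (simp add: C.carrier_kQ in_keys_iff subset_iff)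
    moreover have "(-g) \<oplus>\<^bsub>C.kQ\<^esub> g = \<zero>\<^bsub>C.kQ\<^esub>" by (simp add: path_algebra_def)
    ultimately have "\<ominus>\<^bsub>C.kQ\<^esub> g = -g" using minus_equality g by metis
    then have "-g \<in> IC" using additive_subgroup.a_inv_closed[OF sub that(2)] by simp
    from add[OF that(1) this] show ?thesis by simp
  qed
qed

lemma sum_in_IC: "(\<And>p. p \<in> S \<Longrightarrow> h p \<in> IC) \<Longrightarrow> sum h S \<in> IC"
  by (induction S rule: infinite_finite_induct) (simp_all add: IC_closed)

text \<open>Consecutive arrows whose composition vanishes in C.\<close>

definition forbidden :: "'e \<Rightarrow> 'e \<Rightarrow> bool" where
  "forbidden a b \<longleftrightarrow> a \<in> arcs QA \<union> c_ba \<and> b \<in> c_ab \<or> a \<in> arcs QB \<union> c_ab \<and> b \<in> c_ba"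

lemma forbidden_IC: "forbidden a b \<Longrightarrow> palg_mult (arrow QC a) (arrow QC b) \<in> IC"
  unfolding forbidden_def C.mult_kQ[symmetric] using zero_ab zero_ba by blast

text \<open>A path that starts and ends in A without staying there leaves A and comes back. The arrow by
  which it comes back is preceded by an arrow ending in B, with which it composes to zero.\<close>

lemma return_forbidden:
  assumes "C.awalk w p v" "w \<in> verts QB" "v \<in> verts QA" "z \<in> c_ab \<union> arcs QB"
  shows "\<exists>p1 a b p2. z # p = p1 @ a # b # p2 \<and> forbidden a b"
  using assms
proof (induction p arbitrary: w z)
  case Nil
  then show ?case using disj by (auto simp: C.awalk_Nil_iff)
next
  case (Cons y p)
  then have y: "y \<in> arcs QC" "tail QC y = w" and p: "C.awalk (head QC y) p v" by (auto simp: C.awalk_Cons_iff)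
  from y(1) show ?case
  proof (cases y rule: arc_cases)
    case inB
    then obtain p1 a b p2 where "y # p = p1 @ a # b # p2" "forbidden a b"
      using Cons.IH[OF p _ Cons.prems(3), of y] by auto
    then show ?thesis by (intro exI[of _ "z # p1"] exI[of _ a] exI[of _ b] exI[of _ p2]) simp
  next
    case ba
    then have "forbidden z y" using Cons.prems(4) by (auto simp: forbidden_def)
    then show ?thesis by (intro exI[of _ "[]"] exI[of _ z] exI[of _ y] exI[of _ p]) simp
  qed (use y(2) Cons.prems(2) disj in auto)
qed

lemma leaving_forbidden:
  assumes "C.awalk u p v" "u \<in> verts QA" "v \<in> verts QA" "\<not> set p \<subseteq> arcs QA"
  shows "\<exists>p1 a b p2. p = p1 @ a # b # p2 \<and> forbidden a b"
  using assms
proof (induction p arbitrary: u)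
  case (Cons y p)
  then have y: "y \<in> arcs QC" "tail QC y = u" and p: "C.awalk (head QC y) p v" by (auto simp: C.awalk_Cons_iff)
  from y(1) show ?case
  proof (cases y rule: arc_cases)
    case inA
    then obtain p1 a b p2 where "p = p1 @ a # b # p2" "forbidden a b"
      using Cons.IH[OF p _ Cons.prems(3)] Cons.prems(4) by auto
    then show ?thesis by (intro exI[of _ "y # p1"] exI[of _ a] exI[of _ b] exI[of _ p2]) simp
  next
    case ab
    then show ?thesis using return_forbidden[OF p _ Cons.prems(3), of y] by simp
  qed (use y(2) Cons.prems(2) disj in auto)
qed simp

lemma forbidden_path_IC:
  assumes p: "C.awalk u (p1 @ a # b # p2) v" and ab: "forbidden a b"
  shows "Poly_Mapping.single (u, p1 @ a # b # p2, v) c \<in> IC"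
proof -
  have w: "C.awalk u p1 (tail QC a)" "a \<in> arcs QC" "b \<in> arcs QC" "head QC a = tail QC b" "C.awalk (head QC b) p2 v"
    using p by (auto simp: C.awalk_append_iff C.awalk_Cons_iff)
  have "palg_mult (Poly_Mapping.single (u, p1, tail QC a) c) (palg_mult (palg_mult (arrow QC a) (arrow QC b))
      (Poly_Mapping.single (head QC b, p2, v) 1)) \<in> IC"
    using w by (intro IC_closed(4,5) forbidden_IC[OF ab]) (auto simp: paths_def)
  then show ?thesis using w by (simp add: arrow_def palg_mult_single)
qed

text \<open>Multiplication with idempotents on both sides selects the paths from u to v.\<close>

lemma corner_expand:
  fixes f :: "('v, 'e) path \<Rightarrow>\<^sub>0 'k"
  shows "palg_mult (Poly_Mapping.single (u, [], u) 1) (palg_mult f (Poly_Mapping.single (v, [], v) 1)) =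
    (\<Sum>p\<in>{p. (u, p, v) \<in> Poly_Mapping.keys f}. Poly_Mapping.single (u, p, v) (Poly_Mapping.lookup f (u, p, v)))"
    (is "?l = (\<Sum>p\<in>?S. ?g p)")
proof -
  let ?h = "\<lambda>x. Poly_Mapping.single x (Poly_Mapping.lookup f x)"
  let ?t = "\<lambda>x. if fst x = u \<and> snd (snd x) = v then ?h x else 0"
  have "palg_mult f (Poly_Mapping.single (v, [], v) 1)
      = (\<Sum>x\<in>Poly_Mapping.keys f. path_times x (v, [], v) (Poly_Mapping.lookup f x * 1))"
    by (subst palg_mult_superset[of "Poly_Mapping.keys f" _ "{(v, [], v)}"]) simp_all
  also have "\<dots> = (\<Sum>x\<in>Poly_Mapping.keys f. if snd (snd x) = v then ?h x else 0)"
    by (rule sum.cong) (auto split: prod.splits)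
  finally have "?l = (\<Sum>x\<in>Poly_Mapping.keys f. palg_mult (Poly_Mapping.single (u, [], u) 1)
      (if snd (snd x) = v then ?h x else 0))"
    by (simp add: palg_mult_sum_right)
  also have "\<dots> = (\<Sum>x\<in>Poly_Mapping.keys f. ?t x)"
    by (rule sum.cong) (auto simp: palg_mult_single split: prod.splits)
  also have "\<dots> = (\<Sum>x\<in>(\<lambda>p. (u, p, v)) ` ?S. ?h x)"
    by (rule sum.mono_neutral_cong_right) auto
  also have "\<dots> = (\<Sum>p\<in>?S. ?g p)"
    by (subst sum.reindex) (auto simp: inj_on_def)
  finally show ?thesis .
qed

text \<open>Extension by zero respects the relations of C. A relation acts on the extension through
  its terms that are paths in A. The other terms from A to A contain a forbidden pair, so they are
  relations of C themselves; what remains of the relation lies in the corner algebra, hence in the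
  ideal of A.\<close>

lemma ext_module:
  assumes M: "M \<in> modules QA IA"
  shows "extA M \<in> modules QC IC"
  unfolding C.modules_iff
proof (intro conjI ballI)
  show d: "dims_ok QC (extA M)" by (rule dims_ext[OF A.modules_dims[OF M]])
  fix f u v x assume f: "f \<in> IC" and u: "u \<in> verts QC" and v: "v \<in> verts QC" and x: "x \<in> space (extA M) u"
  have sp: "elemact (extA M) f u v x \<in> space (extA M) v"
    unfolding C.mact_elem_map[OF d C.I_keys[OF f] x, symmetric]
    by (rule mact_in_V[of _ _ "rdim (extA M) u"]) (simp add: elem_map_def)
  show "elemact (extA M) f u v x = 0"
  proof (cases "u \<in> verts QA \<and> v \<in> verts QA")
    case False
    then show ?thesis
    proof (cases "v \<in> verts QA")
      case True
      then have "x = 0" using False x by (simp add: rdim_ext)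
      then show ?thesis by (simp add: elemact_def lin_0[OF lin_pathact])
    next
      case False
      then show ?thesis using sp by (simp add: rdim_ext)
    qed
  next
    case True
    let ?S = "{p. (u, p, v) \<in> Poly_Mapping.keys f}"
    \<comment> \<open>Of the paths from u to v in f, those that stay in A; g is the corresponding
      part of f.\<close>
    define S where "S = {p \<in> ?S. set p \<subseteq> arcs QA}"
    define g where "g = (\<Sum>p\<in>S. Poly_Mapping.single (u, p, v) (Poly_Mapping.lookup f (u, p, v)))"
    let ?h = "\<lambda>p. Poly_Mapping.single (u, p, v) (Poly_Mapping.lookup f (u, p, v))"
    have fin: "finite ?S" by (rule finite_paths_in_keys)
    have finS: "finite S" unfolding S_def using fin by simp
    have walk: "C.awalk u p v" if "p \<in> ?S" for p using C.I_keys[OF f] that by (auto simp: paths_def)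
    have "(\<Sum>p\<in>?S. ?h p) \<in> IC"
      unfolding corner_expand[symmetric]
      by (intro IC_closed f) (use u v in \<open>auto simp: paths_def C.awalk_Nil_iff\<close>)
    moreover have "?h p \<in> IC" if p: "p \<in> ?S - S" for p
    proof -
      have "\<not> set p \<subseteq> arcs QA" and w: "C.awalk u p v" using p walk unfolding S_def by simp_all
      then obtain p1 a b p2 where e: "p = p1 @ a # b # p2" "forbidden a b"
        using leaving_forbidden[OF w] True by (elim exE conjE) auto
      then show ?thesis using forbidden_path_IC[of u p1 a b p2 v] w by simp
    qed
    then have "(\<Sum>p\<in>?S - S. ?h p) \<in> IC" by (rule sum_in_IC)
    ultimately have "(\<Sum>p\<in>?S. ?h p) - (\<Sum>p\<in>?S - S. ?h p) \<in> IC" by (rule IC_closed(2))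
    also have "(\<Sum>p\<in>?S. ?h p) - (\<Sum>p\<in>?S - S. ?h p) = g"
    proof -
      have "S \<subseteq> ?S" unfolding S_def by blast
      from sum.subset_diff[OF this fin, of ?h] show ?thesis unfolding g_def by simp
    qed
    finally have "g \<in> IC" .
    have lg: "Poly_Mapping.lookup g (a, q, b) = (if q \<in> S \<and> a = u \<and> b = v then Poly_Mapping.lookup f (u, q, v) else 0)"
      for a q b
    proof -
      have "Poly_Mapping.lookup g (a, q, b) = (\<Sum>p\<in>S. Poly_Mapping.lookup (?h p) (a, q, b))"
        unfolding g_def lookup_sum ..
      also have "\<dots> = (\<Sum>p\<in>S. if p = q then if a = u \<and> b = v then Poly_Mapping.lookup f (u, q, v) else 0 else 0)"
        by (rule sum.cong) (simp_all add: lookup_single when_def)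
      finally show ?thesis unfolding sum.delta[OF finS] by simp
    qed
    have kg: "Poly_Mapping.keys g = (\<lambda>p. (u, p, v)) ` S"
    proof (intro equalityI subsetI)
      fix y assume "y \<in> Poly_Mapping.keys g"
      moreover obtain a q b where "y = (a, q, b)" by (cases y)
      ultimately show "y \<in> (\<lambda>p. (u, p, v)) ` S" by (simp add: in_keys_iff lg split: if_splits)
    next
      fix y assume "y \<in> (\<lambda>p. (u, p, v)) ` S"
      then obtain q where "q \<in> S" "y = (u, q, v)" by (elim imageE)
      then show "y \<in> Poly_Mapping.keys g" by (simp add: S_def in_keys_iff lg)
    qed
    have "Poly_Mapping.keys g \<subseteq> paths QA"
      unfolding kg using awalk_C_A[OF walk] True by (auto simp: S_def paths_def)
    then have gA: "g \<in> IA"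
      unfolding IA_eq[symmetric] using \<open>g \<in> IC\<close> by (intro IntI) (simp_all only: A.carrier_kQ)
    have "elemact (extA M) f u v x = (\<Sum>p\<in>S. scal (Poly_Mapping.lookup f (u, p, v)) (pathact (extA M) p x))"
      unfolding elemact_def
      by (rule sum.mono_neutral_right[OF fin]) (auto simp: S_def pathact_ext_zero)
    also have "\<dots> = (\<Sum>p\<in>S. scal (Poly_Mapping.lookup g (u, p, v)) (pathact M p x))"
      by (rule sum.cong) (auto simp: lg pathact_ext S_def)
    also have "\<dots> = elemact M g u v x"
      unfolding elemact_def by (rule sum.cong) (auto simp: kg)
    also have "\<dots> = 0" using M gA True x unfolding A.modules_iff by (simp add: rdim_ext)
    finally show ?thesis .
  qed
qed

lemma fhom_res:
  assumes F: "fhom QC M N F"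
  shows "fhom QA (resA M) (resA N) F"
proof (rule fhomI)
  fix a x assume a: "a \<in> arcs QA" and "x \<in> space (resA M) (tail QA a)"
  then have "x \<in> space M (tail QC a)" by (simp add: arcs_A rdim_res)
  from fhomD(3)[OF F arcs_A(1)[OF a] this]
  show "F (head QA a) (act (resA M) a x) = act (resA N) a (F (tail QA a) x)"
    using a by (simp add: arcs_A act_res)
qed (simp_all add: fhomD[OF F] rdim_res verts_A)

lemma riso_res:
  assumes "dims_ok QC M" "riso QC M N"
  shows "riso QA (resA M) (resA N)"
proof -
  obtain F H where F: "fhom QC M N F" "fhom QC N M H"
    "\<And>v x. v \<in> verts QC \<Longrightarrow> x \<in> space M v \<Longrightarrow> H v (F v x) = x"
    "\<And>v y. v \<in> verts QC \<Longrightarrow> y \<in> space N v \<Longrightarrow> F v (H v y) = y"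
    using isoE[OF C.wf_digraph_axioms assms] by blast
  show ?thesis
    by (rule isoI[OF fhom_res[OF F(1)], of H]) (simp_all add: F fhomD(2)[OF F(2)] rdim_res verts_A)
qed

lemma isum_res:
  assumes "isum QC S M N"
  shows "isum QA (resA S) (resA M) (resA N)"
proof -
  obtain i1 i2 p1 p2 where b: "biprod QC S M N i1 i2 p1 p2" using assms unfolding isum_def by (elim exE)
  note b = biprodD[OF b]
  have "biprod QA (resA S) (resA M) (resA N) i1 i2 p1 p2"
    by (rule biprodI[OF fhom_res[OF b(1)] fhom_res[OF b(2)] fhom_res[OF b(3)] fhom_res[OF b(4)]])
       (simp_all add: b rdim_res verts_A)
  then show ?thesis unfolding isum_def by (intro exI)
qed

lemma retract_res:
  assumes "C.retract N M"
  shows "A.retract (resA N) (resA M)"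
proof -
  obtain s r where sr: "fhom QC N M s" "fhom QC M N r" "\<forall>v\<in>verts QC. \<forall>x\<in>space N v. r v (s v x) = x"
    using assms unfolding C.retract_def by (elim exE conjE)
  show ?thesis
    unfolding A.retract_def
    by (intro exI[of _ s] exI[of _ r] conjI ballI fhom_res sr(1,2)) (simp add: sr(3) rdim_res verts_A)
qed

text \<open>Outside A a morphism between extensions is a map between zero spaces; zero is chosen there.\<close>

definition extF :: "('v \<Rightarrow> (nat \<Rightarrow> 'k) \<Rightarrow> nat \<Rightarrow> 'k) \<Rightarrow> 'v \<Rightarrow> (nat \<Rightarrow> 'k) \<Rightarrow> nat \<Rightarrow> 'k" where
  "extF F = (\<lambda>v. if v \<in> verts QA then F v else (\<lambda>x. 0))"

lemma extF_simps: "v \<in> verts QA \<Longrightarrow> extF F v = F v" "v \<notin> verts QA \<Longrightarrow> extF F v x = 0"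
  by (simp_all add: extF_def)

lemma fhom_ext:
  assumes "fhom QA M N F"
  shows "fhom QC (extA M) (extA N) (extF F)"
proof (rule fhomI)
  fix v assume v: "v \<in> verts QC"
  show "lin (extF F v)" by (cases "v \<in> verts QA") (simp_all add: extF_def fhomD(1)[OF assms] lin_zero)
  fix x assume "x \<in> space (extA M) v"
  then show "extF F v x \<in> space (extA N) v"
    by (cases "v \<in> verts QA") (simp_all add: extF_simps rdim_ext fhomD(2)[OF assms])
next
  fix a x assume a: "a \<in> arcs QC" and x: "x \<in> space (extA M) (tail QC a)"
  show "extF F (head QC a) (act (extA M) a x) = act (extA N) a (extF F (tail QC a) x)"
  proof (cases "a \<in> arcs QA")
    case True
    then show ?thesis
      using x fhomD(3)[OF assms True] by (simp add: arcs_A extF_simps act_ext rdim_ext)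
  next
    case False
    have "extF F (head QC a) 0 = 0"
      by (cases "head QC a \<in> verts QA") (simp_all add: extF_simps lin_0[OF fhomD(1)[OF assms]])
    then show ?thesis using False by (simp add: act_ext)
  qed
qed

lemma fsurj_ext:
  assumes F: "fhom QA M N F" and s: "fsurj QA M N F"
  shows "fsurj QC (extA M) (extA N) (extF F)"
proof (rule fsurjI[OF fhom_ext[OF F]])
  fix v y assume v: "v \<in> verts QC" and y: "y \<in> space (extA N) v"
  show "\<exists>x\<in>space (extA M) v. extF F v x = y"
  proof (cases "v \<in> verts QA")
    case True
    then show ?thesis using y fsurjD[OF s True] by (simp add: rdim_ext extF_simps)
  next
    case False
    then show ?thesis using y by (simp add: rdim_ext extF_simps)
  qed
qed

lemma riso_ext:
  fixes M N :: "('v, 'e, 'k) rep"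
  assumes d: "dims_ok QA M" and i: "riso QA M N"
  shows "riso QC (extA M) (extA N)"
proof -
  obtain F H where F: "fhom QA M N F" "fhom QA N M H"
    "\<And>v x. v \<in> verts QA \<Longrightarrow> x \<in> space M v \<Longrightarrow> H v (F v x) = x"
    "\<And>v y. v \<in> verts QA \<Longrightarrow> y \<in> space N v \<Longrightarrow> F v (H v y) = y"
    using isoE[OF A.wf_digraph_axioms assms] by blast
  show ?thesis
  proof (rule isoI[OF fhom_ext[OF F(1)], of "extF H"])
    fix v assume v: "v \<in> verts QC"
    show "extF H v y \<in> space (extA M) v" if "y \<in> space (extA N) v" for y
      using fhomD(2)[OF fhom_ext[OF F(2)] v that] .
    show "extF H v (extF F v x) = x" if "x \<in> space (extA M) v" for x
      by (cases "v \<in> verts QA") (use that in \<open>simp_all add: extF_simps rdim_ext F\<close>)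
    show "extF F v (extF H v x) = x" if "x \<in> space (extA N) v" for x
      by (cases "v \<in> verts QA") (use that in \<open>simp_all add: extF_simps rdim_ext F\<close>)
  qed
qed

lemma isum_ext:
  fixes S M N :: "('v, 'e, 'k) rep"
  assumes "isum QA S M N"
  shows "isum QC (extA S) (extA M) (extA N)"
proof -
  obtain i1 i2 p1 p2 where b: "biprod QA S M N i1 i2 p1 p2" using assms unfolding isum_def by (elim exE)
  note b = biprodD[OF b]
  have "biprod QC (extA S) (extA M) (extA N) (extF i1) (extF i2) (extF p1) (extF p2)"
  proof (rule biprodI[OF fhom_ext[OF b(1)] fhom_ext[OF b(2)] fhom_ext[OF b(3)] fhom_ext[OF b(4)]])
    fix v x assume v: "v \<in> verts QC"
    show "extF p1 v (extF i1 v x) = x" "extF p2 v (extF i1 v x) = 0" if "x \<in> space (extA M) v"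
      by (cases "v \<in> verts QA"; use that in \<open>simp add: extF_simps rdim_ext b\<close>)+
    show "extF p2 v (extF i2 v x) = x" "extF p1 v (extF i2 v x) = 0" if "x \<in> space (extA N) v"
      by (cases "v \<in> verts QA"; use that in \<open>simp add: extF_simps rdim_ext b\<close>)+
    show "extF i1 v (extF p1 v x) + extF i2 v (extF p2 v x) = x" if "x \<in> space (extA S) v"
      by (cases "v \<in> verts QA") (use that in \<open>simp_all add: extF_simps rdim_ext b\<close>)
  qed
  then show ?thesis unfolding isum_def by (intro exI)
qed

lemma riso_res_ext: "riso QA (resA (extA M)) M"
  by (rule isoI[of _ _ _ "\<lambda>v x. x" "\<lambda>v x. x"])
     (auto intro!: fhomI simp: lin_id rdim_res rdim_ext act_res act_ext arcs_A)

subsection \<open>The connecting arrows act trivially on radicals\<close>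

text \<open>The radical at the source of a connecting arrow is spanned by images of arrows, and each
  of these composes to zero with the connecting arrow.\<close>

lemma connecting_kills_rad:
  assumes M: "M \<in> modules QC IC" and a: "a \<in> c_ab \<union> c_ba" and y: "y \<in> rad QC M (tail QC a)"
  shows "act M a y = 0"
proof (rule rad_kill[OF lin_act _ y])
  fix b x assume b: "b \<in> arcs QC" "head QC b = tail QC a" and x: "x \<in> space M (tail QC b)"
  have aC: "a \<in> arcs QC" using a arcs_C by blast
  from b(1) have "forbidden b a"
    by (cases b rule: arc_cases)
       (use a b(2) c_ab[of a] c_ba[of a] disj in \<open>auto simp: forbidden_def\<close>)
  then have "Poly_Mapping.single (tail QC b, [] @ b # a # [], head QC a) 1 \<in> IC"
    by (intro forbidden_path_IC) (use aC b in \<open>auto simp: C.awalk_Cons_iff C.awalk_Nil_iff\<close>)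
  moreover have "tail QC b \<in> verts QC" "head QC a \<in> verts QC" using b aC by simp_all
  ultimately have "elemact M (Poly_Mapping.single (tail QC b, [b, a], head QC a) 1) (tail QC b) (head QC a) x = 0"
    using M x unfolding C.modules_iff by simp
  then show "act M a (act M b x) = 0" by (simp add: C.elemact_single)
qed

text \<open>Without the action of the connecting arrows, a module is the sum of its A-part and its
  B-part.\<close>

definition split :: "('v, 'e, 'k) rep \<Rightarrow> bool" where
  "split M \<longleftrightarrow> (\<forall>a\<in>c_ab \<union> c_ba. \<forall>x\<in>space M (tail QC a). act M a x = 0)"

lemma split_part:
  assumes "split M"
  shows "fhom QC (extA (resA M)) M (\<lambda>v x. if v \<in> verts QA then x else 0)" (is ?i)
    and "fhom QC M (extA (resA M)) (\<lambda>v x. if v \<in> verts QA then x else 0)" (is ?p)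
proof -
  have lin: "lin (\<lambda>x. if v \<in> verts QA then x else (0 :: nat \<Rightarrow> 'k))" for v
    by (cases "v \<in> verts QA") (simp_all add: lin_id lin_zero)
  have cross: "act M a x = 0" if "a \<in> c_ab \<or> a \<in> c_ba" "x \<in> space M (tail QC a)" for a x
    using assms that unfolding split_def by blast
  have d: "v \<notin> verts QB" if "v \<in> verts QA" for v using disj that by blast
  show ?i
  proof (rule fhomI)
    fix a x assume a: "a \<in> arcs QC" and x: "x \<in> space (extA (resA M)) (tail QC a)"
    from a show "(if head QC a \<in> verts QA then act (extA (resA M)) a x else 0)
        = act M a (if tail QC a \<in> verts QA then x else 0)"
      by (cases a rule: arc_cases)
         (use x cross[of a x] d[of "tail QC a"] d[of "head QC a"] in
           \<open>auto simp: act_ext act_res rdim_ext rdim_res lin_0[OF lin_act]\<close>)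
  qed (auto simp: lin rdim_ext rdim_res split: if_splits)
  show ?p
  proof (rule fhomI)
    fix a x assume a: "a \<in> arcs QC" and x: "x \<in> space M (tail QC a)"
    from a show "(if head QC a \<in> verts QA then act M a x else 0)
        = act (extA (resA M)) a (if tail QC a \<in> verts QA then x else 0)"
      by (cases a rule: arc_cases)
         (use x cross[of a x] d[of "tail QC a"] d[of "head QC a"] in
           \<open>auto simp: act_ext act_res rdim_ext rdim_res lin_0[OF lin_act]\<close>)
  qed (auto simp: lin rdim_ext rdim_res split: if_splits)
qed

lemma split_isum:
  assumes "split M"
  shows "isum QC M (extA (resA M)) (extB (resB M))"
proof -
  interpret F: morita QB QA QC IB IA IC c_ba c_ab by (rule flip)
  have "F.split M" using assms unfolding F.split_def split_def by blast
  note parts = split_part[OF assms] F.split_part[OF this]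
  have "biprod QC M (extA (resA M)) (extB (resB M)) (\<lambda>v x. if v \<in> verts QA then x else 0)
      (\<lambda>v x. if v \<in> verts QB then x else 0) (\<lambda>v x. if v \<in> verts QA then x else 0)
      (\<lambda>v x. if v \<in> verts QB then x else 0)"
  proof (rule biprodI[OF parts(1,3,2,4)])
    fix v x assume v: "v \<in> verts QC"
    let ?a = "\<lambda>v x. if v \<in> verts QA then x else (0 :: nat \<Rightarrow> 'k)"
    let ?b = "\<lambda>v x. if v \<in> verts QB then x else (0 :: nat \<Rightarrow> 'k)"
    show "?a v (?a v x) = x" "?b v (?a v x) = 0" if "x \<in> space (extA (resA M)) v"
      using v that by (cases v rule: verts_cases; simp add: rdim_ext)+
    show "?b v (?b v x) = x" "?a v (?b v x) = 0" if "x \<in> space (extB (resB M)) v"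
      using v that by (cases v rule: verts_cases; simp add: F.rdim_ext)+
    show "?a v (?a v x) + ?b v (?b v x) = x"
      using v by (cases v rule: verts_cases) simp_all
  qed
  then show ?thesis unfolding isum_def by (intro exI)
qed

text \<open>The kernel of a projective cover lies in the radical, which the connecting arrows
  annihilate.\<close>

lemma ker_split:
  assumes c: "fcover QC IC P \<pi> M" and k: "fker QC K \<iota> P \<pi>" and K: "dims_ok QC K"
  shows "split K"
  unfolding split_def
proof (intro ballI)
  fix a x assume a: "a \<in> c_ab \<union> c_ba" and x: "x \<in> space K (tail QC a)"
  note c = fcoverD[OF c] and k = fkerD[OF k]
  have aC: "a \<in> arcs QC" using a arcs_C by blast
  have t: "tail QC a \<in> verts QC" "head QC a \<in> verts QC" using aC by simp_all
  have "\<iota> (tail QC a) x \<in> rad QC P (tail QC a)"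
    by (rule rad_kerD[OF c(6) t(1) fhomD(2)[OF k(1) t(1) x] k(3)[OF t(1) x]])
  then have "\<iota> (head QC a) (act K a x) = 0"
    using connecting_kills_rad[OF c(2) a] fhomD(3)[OF k(1) aC x] by simp
  then show "act K a x = 0"
    using k(2) t(2) C.act_in[OF K aC] unfolding finj_iff[OF k(1)] by simp
qed

lemma syz_isum:
  assumes "is_syz QC IC K M"
  shows "isum QC K (extA (resA K)) (extB (resB K))"
proof -
  obtain P \<pi> \<iota> where "fcover QC IC P \<pi> M" "fker QC K \<iota> P \<pi>"
    using assms unfolding is_syz_def by (elim exE conjE)
  then show ?thesis by (intro split_isum ker_split C.modules_dims[OF C.is_syzD[OF assms]])
qed

subsection \<open>Syzygies of modules over A\<close>

lemma rad_ext: "v \<in> verts QA \<Longrightarrow> x \<in> rad QA M v \<Longrightarrow> x \<in> rad QC (extA M) v"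
proof (erule rad_induct)
  fix a y assume a: "a \<in> arcs QA" "head QA a = v" and y: "y \<in> space M (tail QA a)"
  have "y \<in> space (extA M) (tail QC a)" using y a by (simp add: arcs_A rdim_ext)
  from act_in_rad[OF arcs_A(1)[OF a(1)] this] show "act M a y \<in> rad QC (extA M) v"
    using a by (simp add: arcs_A act_ext)
qed (simp_all add: fv.subspace_0[OF subspace_rad] fv.subspace_add[OF subspace_rad] fv.subspace_scale[OF subspace_rad])

text \<open>The projective cover P over C of a module over A has all of its B-part in the radical. Hence
  the arrows back from B to A act as zero on P, and P restricts to a projective cover over A.\<close>

lemma cover_ext:
  assumes E: "E \<in> modules QA IA" and c: "fcover QC IC P \<pi> (extA E)"
  shows "fcover QA IA (resA P) \<pi> E"
proof -
  note c = fcoverD[OF c]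
  have ba_zero: "act P a x = 0" if a: "a \<in> c_ba" and x: "x \<in> space P (tail QC a)" for a x
  proof -
    have v: "tail QC a \<in> verts QC" "tail QC a \<notin> verts QA" using c_ba[OF a] verts_C disj by blast+
    have "\<pi> (tail QC a) x = 0" using fhomD(2)[OF c(4) v(1) x] v(2) by (simp add: rdim_ext)
    from connecting_kills_rad[OF c(2) _ rad_kerD[OF c(6) v(1) x this]] a show ?thesis by simp
  qed
  have radA: "x \<in> rad QA (resA P) v" if v: "v \<in> verts QA" and x: "x \<in> rad QC P v" for v x
  proof -
    have "rad QC P v \<subseteq> rad QA (resA P) v"
    proof (rule rad_subset[OF subspace_rad])
      fix a y assume a: "a \<in> arcs QC" "head QC a = v" and y: "y \<in> space P (tail QC a)"
      from a(1) show "act P a y \<in> rad QA (resA P) v"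
      proof (cases a rule: arc_cases)
        case inA
        then have "y \<in> space (resA P) (tail QA a)" using y by (simp add: arcs_A rdim_res)
        from act_in_rad[OF inA(1) this] show ?thesis using inA a(2) by (simp add: act_res arcs_A)
      next
        case ba
        then show ?thesis using ba_zero[OF ba(1) y] fv.subspace_0[OF subspace_rad] by simp
      qed (use a(2) v disj in auto)
    qed
    then show ?thesis using x by (rule subsetD)
  qed
  have \<pi>: "fhom QA (resA P) E \<pi>"
  proof (rule fhomI)
    fix v assume v: "v \<in> verts QA"
    show "lin (\<pi> v)" by (rule fhomD(1)[OF c(4) verts_A[OF v]])
    show "\<pi> v x \<in> space E v" if "x \<in> space (resA P) v" for x
      using fhomD(2)[OF c(4) verts_A[OF v], of x] that v by (simp add: rdim_res rdim_ext)
  next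
    fix a x assume a: "a \<in> arcs QA" and "x \<in> space (resA P) (tail QA a)"
    then have "x \<in> space P (tail QC a)" by (simp add: arcs_A rdim_res)
    from fhomD(3)[OF c(4) arcs_A(1)[OF a] this]
    show "\<pi> (head QA a) (act (resA P) a x) = act E a (\<pi> (tail QA a) x)"
      using a by (simp add: arcs_A act_res act_ext)
  qed
  have surj: "fsurj QA (resA P) E \<pi>"
  proof (rule fsurjI[OF \<pi>])
    fix v y assume v: "v \<in> verts QA" and "y \<in> space E v"
    then have "y \<in> space (extA E) v" by (simp add: rdim_ext)
    from fsurjD[OF c(5) verts_A[OF v] this] show "\<exists>x\<in>space (resA P) v. \<pi> v x = y"
      using v by (simp add: rdim_res)
  qed
  have rk: "rad_ker QA (resA P) \<pi>"
    unfolding rad_ker_def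
  proof (intro ballI impI)
    fix v x assume v: "v \<in> verts QA" and x: "x \<in> space (resA P) v" and z: "\<pi> v x = 0"
    from x v have "x \<in> space P v" by (simp add: rdim_res)
    from radA[OF v rad_kerD[OF c(6) verts_A[OF v] this z]] show "x \<in> rad QA (resA P) v" .
  qed
  have "fproj QA IA (resA P)"
    unfolding fproj_def
  proof (intro conjI ballI allI impI)
    show "resA P \<in> modules QA IA" by (rule res_module[OF c(2)])
    fix M N G F assume M: "M \<in> modules QA IA" and N: "N \<in> modules QA IA"
      and G: "fhom QA M N G" "fsurj QA M N G" and F: "fhom QA (resA P) N F"
    \<comment> \<open>A morphism defined on the A-part extends by zero to P, because the arrows from
      B to A act as zero.\<close>
    have F': "fhom QC P (extA N) (extF F)"
    proof (rule fhomI)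
      fix v assume v: "v \<in> verts QC"
      show "lin (extF F v)" by (cases "v \<in> verts QA") (simp_all add: extF_def fhomD(1)[OF F] lin_zero)
      show "extF F v x \<in> space (extA N) v" if "x \<in> space P v" for x
        by (cases "v \<in> verts QA") (use fhomD(2)[OF F, of v x] that in \<open>simp_all add: extF_simps rdim_ext rdim_res\<close>)
    next
      fix a x assume a: "a \<in> arcs QC" and x: "x \<in> space P (tail QC a)"
      from a show "extF F (head QC a) (act P a x) = act (extA N) a (extF F (tail QC a) x)"
      proof (cases a rule: arc_cases)
        case inA
        then have "x \<in> space (resA P) (tail QA a)" using x by (simp add: arcs_A rdim_res)
        from fhomD(3)[OF F inA(1) this] show ?thesis
          using inA by (simp add: arcs_A extF_simps act_ext act_res)
      next
        case ba
        then show ?thesis using ba_zero[OF ba(1) x] lin_0[OF fhomD(1)[OF F]] by (simp add: extF_simps act_ext)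
      qed (use disj in \<open>auto simp: extF_def act_ext\<close>)
    qed
    from fprojD(2)[OF c(1) ext_module[OF M] ext_module[OF N] fhom_ext[OF G(1)] fsurj_ext[OF G] F']
    obtain H where H: "fhom QC P (extA M) H" "\<forall>v\<in>verts QC. \<forall>x\<in>space P v. extF G v (H v x) = extF F v x"
      by (elim exE conjE)
    show "\<exists>H. fhom QA (resA P) M H \<and> (\<forall>v\<in>verts QA. \<forall>x\<in>space (resA P) v. G v (H v x) = F v x)"
    proof (intro exI[of _ H] conjI ballI fhomI)
      fix v assume v: "v \<in> verts QA"
      show "lin (H v)" by (rule fhomD(1)[OF H(1) verts_A[OF v]])
      fix x assume "x \<in> space (resA P) v"
      then have x: "x \<in> space P v" using v by (simp add: rdim_res)
      show "H v x \<in> space M v" using fhomD(2)[OF H(1) verts_A[OF v] x] v by (simp add: rdim_ext)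
      show "G v (H v x) = F v x" using bspec[OF bspec[OF H(2) verts_A[OF v]] x] v by (simp add: extF_simps)
    next
      fix a x assume a: "a \<in> arcs QA" and "x \<in> space (resA P) (tail QA a)"
      then have "x \<in> space P (tail QC a)" by (simp add: arcs_A rdim_res)
      from fhomD(3)[OF H(1) arcs_A(1)[OF a] this]
      show "H (head QA a) (act (resA P) a x) = act M a (H (tail QA a) x)"
        using a by (simp add: arcs_A act_res act_ext)
    qed
  qed
  then show ?thesis unfolding fcover_def using E \<pi> surj rk by simp
qed

lemma ker_res:
  assumes k: "fker QC K \<iota> P \<pi>"
  shows "fker QA (resA K) \<iota> (resA P) \<pi>"
proof (rule fkerI)
  note k = fkerD[OF k]
  show "fhom QA (resA K) (resA P) \<iota>" by (rule fhom_res[OF k(1)])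
  fix v assume v: "v \<in> verts QA"
  { fix x assume "x \<in> space (resA K) v"
    then have x: "x \<in> space K v" using v by (simp add: rdim_res)
    show "\<pi> v (\<iota> v x) = 0" by (rule k(3)[OF verts_A[OF v] x])
    show "x = 0" if "\<iota> v x = 0" using k(2) verts_A[OF v] x that unfolding finj_iff[OF k(1)] by simp }
  fix y assume "y \<in> space (resA P) v" and z: "\<pi> v y = 0"
  then have "y \<in> space P v" using v by (simp add: rdim_res)
  from k(4)[OF verts_A[OF v] this z] show "\<exists>x\<in>space (resA K) v. \<iota> v x = y" using v by (simp add: rdim_res)
qed

lemma syz_ext:
  assumes "E \<in> modules QA IA" "is_syz QC IC K (extA E)"
  shows "is_syz QA IA (resA K) E"
proof -
  obtain P \<pi> \<iota> where "fcover QC IC P \<pi> (extA E)" "fker QC K \<iota> P \<pi>"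
    using assms(2) unfolding is_syz_def by (elim exE conjE)
  then show ?thesis
    unfolding is_syz_def using res_module[OF C.is_syzD[OF assms(2)]] cover_ext[OF assms(1)] ker_res
    by (intro conjI exI)
qed

text \<open>The B-part of the syzygy of a module over A is the B-part of its projective cover. As a
  module and its top have the same projective cover, it depends on the top only.\<close>

lemma syz_ext_B:
  assumes c: "fcover QC IC P \<pi> (extA E)" and k: "fker QC K \<iota> P \<pi>"
  shows "riso QB (resB K) (resB P)"
proof -
  interpret F: morita QB QA QC IB IA IC c_ba c_ab by (rule flip)
  note c = fcoverD[OF c] and k = fkerD[OF k]
  note h = F.fhom_res[OF k(1)]
  have "finj QB (resB K) \<iota>" using k(2) by (simp add: finj_def F.rdim_res F.verts_A)
  moreover have "fsurj QB (resB K) (resB P) \<iota>"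
  proof (rule fsurjI[OF h])
    fix v y assume v: "v \<in> verts QB" and "y \<in> space (resB P) v"
    then have y: "y \<in> space P v" by (simp add: F.rdim_res)
    have "v \<notin> verts QA" using v disj by blast
    then have "\<pi> v y = 0" using fhomD(2)[OF c(4) F.verts_A[OF v] y] by (simp add: rdim_ext)
    from k(4)[OF F.verts_A[OF v] y this] show "\<exists>x\<in>space (resB K) v. \<iota> v x = y"
      using v by (simp add: F.rdim_res)
  qed
  ultimately show ?thesis unfolding riso_def using h by (intro exI conjI)
qed

lemma syz_top_B:
  assumes E: "E \<in> modules QA IA" and T: "T \<in> modules QA IA"
    and t: "fhom QA E T t" "fsurj QA E T t" "rad_ker QA E t"
    and K: "is_syz QC IC K (extA E)" and K': "is_syz QC IC K' (extA T)"
  shows "riso QB (resB K) (resB K')"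
proof -
  interpret F: morita QB QA QC IB IA IC c_ba c_ab by (rule flip)
  obtain P \<pi> \<iota> where c: "fcover QC IC P \<pi> (extA E)" and k: "fker QC K \<iota> P \<pi>"
    using K unfolding is_syz_def by (elim exE conjE)
  have rk: "rad_ker QC (extA E) (extF t)"
    unfolding rad_ker_def
  proof (intro ballI impI)
    fix v x assume x: "x \<in> space (extA E) v" and z: "extF t v x = 0"
    show "x \<in> rad QC (extA E) v"
    proof (cases "v \<in> verts QA")
      case True
      then show ?thesis
        using rad_ext[OF True rad_kerD[OF t(3) True, of x]] x z by (simp add: rdim_ext extF_simps)
    next
      case False
      then show ?thesis using x fv.subspace_0[OF subspace_rad] by (simp add: rdim_ext)
    qed
  qed
  note c' = C.fcover_comp[OF c ext_module[OF T] fhom_ext[OF t(1)] fsurj_ext[OF t(1,2)] rk]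
  obtain L \<kappa> where L: "L \<in> modules QC IC" "fker QC L \<kappa> P (\<lambda>v x. extF t v (\<pi> v x))"
    by (rule C.kernel_exists[OF fcoverD(2,4)[OF c']])
  have "is_syz QC IC L (extA T)" unfolding is_syz_def using L c' by (intro conjI exI)
  then have "riso QC L K'" by (rule C.syz_unique[OF _ K' C.iso_refl])
  then have LK: "riso QB (resB L) (resB K')" by (rule F.riso_res[OF C.modules_dims[OF L(1)]])
  note d = F.dims_res[OF C.modules_dims[OF L(1)]] F.dims_res[OF C.modules_dims[OF C.is_syzD[OF K]]]
    F.dims_res[OF C.modules_dims[OF fcoverD(2)[OF c]]]
  have "riso QB (resB P) (resB L)" by (rule B.iso_sym[OF d(1) syz_ext_B[OF c' L(2)]])
  from B.iso_trans[OF d(2,3) syz_ext_B[OF c k] this]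
  have "riso QB (resB K) (resB L)" .
  then show ?thesis by (rule B.iso_trans[OF d(2,1) _ LK])
qed

lemma zero_arrows_ext: "A.zero_arrows T \<Longrightarrow> C.zero_arrows (extA T)"
  unfolding A.zero_arrows_def C.zero_arrows_def by (simp add: act_ext arcs_A rdim_ext)

text \<open>The A-parts of the syzygies of semisimple modules are controlled by those of the simple
  modules at the vertices. The function g will be the class over A or the class of the extension.\<close>

lemma res_syz_semisimple:
  fixes g :: "('v, 'e, 'k) rep \<Rightarrow> 'g::ab_group_add"
  assumes H: "asub H"
    and add: "\<And>S M N. S \<in> modules QA IA \<Longrightarrow> M \<in> modules QA IA \<Longrightarrow> N \<in> modules QA IA \<Longrightarrow>
      isum QA S M N \<Longrightarrow> g S - (g M + g N) \<in> H"
    and zero: "\<And>M. M \<in> modules QA IA \<Longrightarrow> riso QA M zero_rep \<Longrightarrow> g M \<in> H"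
    and base: "\<And>v. v \<in> verts QC \<Longrightarrow> g (resA (syzygy QC IC (C.simple_at v))) \<in> H"
    and T: "T \<in> modules QC IC" "C.zero_arrows T"
  shows "g (resA (syzygy QC IC T)) \<in> H"
proof (rule C.zero_arrows_induct[OF T])
  fix M assume M: "M \<in> modules QC IC" and z: "riso QC M zero_rep"
  note K = C.syzygy_module[OF M]
  have "riso QC (syzygy QC IC M) zero_rep"
    by (rule C.syz_unique[OF C.is_syz_syzygy[OF M] C.syz_projective[OF C.fproj_zero] z])
  then have "riso QA (resA (syzygy QC IC M)) (resA zero_rep)" by (rule riso_res[OF C.modules_dims[OF K]])
  moreover have "riso QA (resA zero_rep) zero_rep" by (rule A.iso_zero) (simp add: restrict_rep_def zero_rep_def)
  ultimately have "riso QA (resA (syzygy QC IC M)) zero_rep"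
    by (rule A.iso_trans[OF dims_res[OF C.modules_dims[OF K]] dims_res[OF C.modules_dims[OF C.zero_rep_module]]])
  then show "g (resA (syzygy QC IC M)) \<in> H" by (rule zero[OF res_module[OF K]])
next
  fix S M N assume m: "S \<in> modules QC IC" "M \<in> modules QC IC" "N \<in> modules QC IC"
    and s: "isum QC S M N" and IH: "g (resA (syzygy QC IC M)) \<in> H" "g (resA (syzygy QC IC N)) \<in> H"
  have "isum QC (syzygy QC IC S) (syzygy QC IC M) (syzygy QC IC N)"
    by (rule C.syz_additive[OF m(1) s C.is_syz_syzygy[OF m(1)] C.is_syz_syzygy[OF m(2)] C.is_syz_syzygy[OF m(3)]])
  from add[OF m[THEN C.syzygy_module, THEN res_module] isum_res[OF this]]
  have "g (resA (syzygy QC IC S)) - (g (resA (syzygy QC IC M)) + g (resA (syzygy QC IC N))) \<in> H" .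
  from asub_add[OF H this asub_add[OF H IH]] show "g (resA (syzygy QC IC S)) \<in> H" by simp
qed (rule base)

lemma zero_rep_ext: "riso QC (extA zero_rep) zero_rep"
  by (rule C.iso_zero) (simp add: extend_rep_def Let_def zero_rep_def)

lemma riso_zero_ext:
  assumes "M \<in> modules QA IA" "riso QA M zero_rep"
  shows "frag_of (extA M) \<in> agen C.relators"
proof -
  have "riso QC (extA M) zero_rep"
    by (rule C.iso_trans[OF dims_ext[OF A.modules_dims[OF assms(1)]] dims_ext[OF A.modules_dims[OF A.zero_rep_module]]
          riso_ext[OF A.modules_dims[OF assms(1)] assms(2)] zero_rep_ext])
  from C.span0_iso_mem[OF ext_module[OF assms(1)] C.zero_rep_module this asub_agen order_refl
      C.span0_projective[OF C.fproj_zero]] show ?thesis .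
qed

text \<open>A projective P over C is the projective cover of its top, which splits into an A-part and a
  B-part. The cover of the A-part restricts to a projective over A; the cover of the B-part restricts
  to the A-part of its syzygy.\<close>

lemma res_projective:
  assumes P: "fproj QC IC P" and H: "asub H" "agen A.relators \<subseteq> H"
    and base: "\<And>v. v \<in> verts QC \<Longrightarrow> frag_of (resA (syzygy QC IC (C.simple_at v))) \<in> H"
  shows "frag_of (resA P) \<in> H"
proof -
  interpret F: morita QB QA QC IB IA IC c_ba c_ab by (rule flip)
  note PM = fprojD(1)[OF P]
  obtain T t where T: "T \<in> modules QC IC" "C.zero_arrows T" "fhom QC P T t" "fsurj QC P T t" "rad_ker QC P t"
    by (rule C.top_exists[OF PM])
  have c: "fcover QC IC P t T" unfolding fcover_def using P T by simp
  have "split T" using T(2) arcs_C unfolding split_def C.zero_arrows_def by blast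
  then have s: "isum QC T (extA (resA T)) (extB (resB T))" by (rule split_isum)
  have A1: "resA T \<in> modules QA IA" and B1: "resB T \<in> modules QB IB"
    using res_module[OF T(1)] F.res_module[OF T(1)] by simp_all
  obtain P1 \<pi>1 where c1: "fcover QC IC P1 \<pi>1 (extA (resA T))" by (rule C.cover_exists[OF ext_module[OF A1]])
  obtain P2 \<pi>2 where c2: "fcover QC IC P2 \<pi>2 (extB (resB T))" by (rule C.cover_exists[OF F.ext_module[OF B1]])
  note P1 = fcoverD(2)[OF c1] and P2 = fcoverD(2)[OF c2]
  obtain \<pi> where c12: "fcover QC IC (dsum QC P1 P2) \<pi> T" by (rule C.cover_dsum[OF T(1) s c1 c2])
  have id: "fsurj QC T T (\<lambda>v x. x)" "finj QC T (\<lambda>v x. x)" by (simp_all add: fsurj_def finj_def)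
  obtain f where "fhom QC P (dsum QC P1 P2) f" "fsurj QC P (dsum QC P1 P2) f" "finj QC P f"
    by (rule C.cover_unique[OF c c12 fhom_id id]) (rule that)
  then have iso12: "riso QC P (dsum QC P1 P2)" unfolding riso_def by (intro exI conjI)
  note d = C.modules_dims[OF P1] C.modules_dims[OF P2]
  from C.isum_transport[OF C.dims_dsum[OF d] d C.isum_dsum[OF d] iso12 C.modules_dims[OF PM]]
  have "isum QA (resA P) (resA P1) (resA P2)" by (rule isum_res)
  from A.span0_isum[OF res_module[OF PM] res_module[OF P1] res_module[OF P2] this]
  have sum: "frag_of (resA P) - (frag_of (resA P1) + frag_of (resA P2)) \<in> H" using H(2) by blast
  have r1: "frag_of (resA P1) \<in> H"
    using A.span0_projective[OF fcoverD(1)[OF cover_ext[OF A1 c1]]] H(2) by blast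
  obtain K \<kappa> where K: "K \<in> modules QC IC" "fker QC K \<kappa> P2 \<pi>2" by (rule C.kernel_exists[OF fcoverD(2,4)[OF c2]])
  let ?L = "syzygy QC IC (extB (resB T))"
  have L: "?L \<in> modules QC IC" by (rule C.syzygy_module[OF F.ext_module[OF B1]])
  have zT: "C.zero_arrows (extB (resB T))"
    using T(2) unfolding C.zero_arrows_def by (simp add: F.act_ext F.act_res F.rdim_ext F.rdim_res F.arcs_A)
  have "frag_of (resA ?L) \<in> H"
  proof (rule res_syz_semisimple[of H frag_of])
    show "asub H" by (rule H(1))
    show "frag_of (resA (syzygy QC IC (C.simple_at v))) \<in> H" if "v \<in> verts QC" for v by (rule base[OF that])
    show "extB (resB T) \<in> modules QC IC" by (rule F.ext_module[OF B1])
    show "C.zero_arrows (extB (resB T))" by (rule zT)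
    show "frag_of S - (frag_of M + frag_of N) \<in> H"
      if "S \<in> modules QA IA" "M \<in> modules QA IA" "N \<in> modules QA IA" "isum QA S M N" for S M N
      using A.span0_isum[OF that] H(2) by blast
    show "frag_of M \<in> H" if "M \<in> modules QA IA" "riso QA M zero_rep" for M
      using A.span0_iso_mem[OF that(1) A.zero_rep_module that(2) H] A.span0_projective[OF A.fproj_zero] H(2) by blast
  qed
  moreover have "riso QA (resA P2) (resA ?L)"
  proof -
    have "is_syz QC IC K (extB (resB T))" unfolding is_syz_def using K c2 by (intro conjI exI)
    from C.syz_unique[OF this C.is_syz_syzygy[OF F.ext_module[OF B1]] C.iso_refl]
    have KL: "riso QA (resA K) (resA ?L)" by (rule riso_res[OF C.modules_dims[OF K(1)]])
    have "riso QA (resA P2) (resA K)"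
      by (rule A.iso_sym[OF dims_res[OF C.modules_dims[OF K(1)]] F.syz_ext_B[OF c2 K(2)]])
    then show ?thesis by (rule A.iso_trans[OF dims_res[OF d(2)] dims_res[OF C.modules_dims[OF K(1)]] _ KL])
  qed
  ultimately have r2: "frag_of (resA P2) \<in> H"
    using A.span0_iso_mem[OF res_module[OF P2] res_module[OF L] _ H] by blast
  from asub_add[OF H(1) sum asub_add[OF H(1) r1 r2]] show ?thesis by simp
qed

end

section \<open>Comparison of the stable groups\<close>

locale morita_orbit = morita QA QB QC IA IB IC c_ab c_ba
  for QA QB QC :: "('v, 'e) pre_digraph" and IA IB IC :: "(('v, 'e) path \<Rightarrow>\<^sub>0 'k::field) set" and c_ab c_ba +
  fixes C0 :: "('v, 'e, 'k) rep"
  assumes C0: "C0 \<in> modules QC IC" and simple_C0: "\<And>v. v \<in> verts QC \<Longrightarrow> C.retract (C.simple_at v) C0"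
begin

lemma flip_orbit: "morita_orbit QB QA QC IB IA IC c_ba c_ab C0"
  by (rule morita_orbit.intro[OF flip]) (unfold_locales, rule C0, rule simple_C0)

text \<open>Generators of the orbit subgroup that come from A: direct summands of single syzygies,
  as the sums of these add nothing to the subgroup.\<close>

definition orbA :: "('v, 'e, 'k) rep set" where
  "orbA = {extA Z | Z k. Z \<in> modules QA IA \<and> A.retract Z ((syzygy QA IA ^^ k) (resA (syzygy QC IC C0)))}"

definition orbB :: "('v, 'e, 'k) rep set" where
  "orbB = {extB Z | Z k. Z \<in> modules QB IB \<and> B.retract Z ((syzygy QB IB ^^ k) (resB (syzygy QC IC C0)))}"

text \<open>The preimage of the orbit subgroup in the free abelian group.\<close>

definition orb :: "(('v, 'e, 'k) rep \<Rightarrow>\<^sub>0 int) set" where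
  "orb = C.span0 (orbA \<union> orbB)"

lemma asub_orb: "asub orb"
  by (simp add: orb_def)

lemma relators_orb: "agen C.relators \<subseteq> orb"
  unfolding orb_def by (rule C.span0_relators)

lemma orbA_orb: "M \<in> orbA \<Longrightarrow> frag_of M \<in> orb"
  unfolding orb_def by (rule C.span0_base) simp

lemma flip_defs:
  "morita_orbit.orbA QB QC IB IC C0 = orbB" "morita_orbit.orbB QA QC IA IC C0 = orbA"
  "morita_orbit.orb QB QA QC IB IA IC C0 = orb"
proof -
  interpret F: morita_orbit QB QA QC IB IA IC c_ba c_ab C0 by (rule flip_orbit)
  show A: "F.orbA = orbB" by (simp add: F.orbA_def orbB_def)
  show B: "F.orbB = orbA" by (simp add: F.orbB_def orbA_def)
  show "F.orb = orb" unfolding F.orb_def orb_def A B by (simp add: Un_commute)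
qed

text \<open>By additivity it is enough to consider the simple modules, which are summands of
  \<open>C\<^sub>0\<close>; their syzygies are then summands of the syzygy of \<open>C\<^sub>0\<close>.\<close>

lemma semisimple_orb:
  assumes "T \<in> modules QC IC" "C.zero_arrows T"
  shows "frag_of (extA (resA (syzygy QC IC T))) \<in> orb"
proof (rule res_syz_semisimple[of orb "\<lambda>M. frag_of (extA M)"])
  show "asub orb" by (rule asub_orb)
  show "frag_of (extA S) - (frag_of (extA M) + frag_of (extA N)) \<in> orb"
    if "S \<in> modules QA IA" "M \<in> modules QA IA" "N \<in> modules QA IA" "isum QA S M N" for S M N
    using C.span0_isum[OF that(1-3)[THEN ext_module] isum_ext[OF that(4)]] relators_orb by blast
  show "frag_of (extA M) \<in> orb" if "M \<in> modules QA IA" "riso QA M zero_rep" for M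
    using riso_zero_ext[OF that] relators_orb by blast
  show "frag_of (extA (resA (syzygy QC IC (C.simple_at v)))) \<in> orb" if v: "v \<in> verts QC" for v
  proof (rule orbA_orb)
    let ?S = "syzygy QC IC (C.simple_at v)"
    have m: "resA ?S \<in> modules QA IA" by (rule res_module[OF C.syzygy_module[OF C.simple_at_module]])
    have "C.retract ?S (syzygy QC IC C0)"
      by (rule C.syz_retract[OF C.simple_at_module C0 simple_C0[OF v] C.is_syz_syzygy[OF C.simple_at_module]
            C.is_syz_syzygy[OF C0]])
    then have "A.retract (resA ?S) ((syzygy QA IA ^^ 0) (resA (syzygy QC IC C0)))" by (simp add: retract_res)
    with m show "extA (resA ?S) \<in> orbA" unfolding orbA_def by blast
  qed
qed (rule assms)+

text \<open>The A-part of the syzygy over C is the syzygy over A. The B-part depends on the top of E only, so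
  it comes from the syzygies of simple modules.\<close>

lemma syz_ext_class:
  assumes E: "E \<in> modules QA IA"
  shows "frag_of (syzygy QC IC (extA E)) - frag_of (extA (syzygy QA IA E)) \<in> orb"
proof -
  interpret F: morita_orbit QB QA QC IB IA IC c_ba c_ab C0 by (rule flip_orbit)
  let ?K = "syzygy QC IC (extA E)"
  note E' = ext_module[OF E]
  note sK = C.is_syz_syzygy[OF E'] and K = C.syzygy_module[OF E']
  note mA = res_module[OF K] and mB = F.res_module[OF K]
  have 1: "frag_of ?K - (frag_of (extA (resA ?K)) + frag_of (extB (resB ?K))) \<in> orb"
    using C.span0_isum[OF K ext_module[OF mA] F.ext_module[OF mB] syz_isum[OF sK]] relators_orb by blast
  have "riso QA (resA ?K) (syzygy QA IA E)"
    by (rule A.syz_unique[OF syz_ext[OF E sK] A.is_syz_syzygy[OF E] A.iso_refl])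
  from C.span0_iso[OF ext_module[OF mA] ext_module[OF A.syzygy_module[OF E]] riso_ext[OF A.modules_dims[OF mA] this]]
  have 2: "frag_of (extA (resA ?K)) - frag_of (extA (syzygy QA IA E)) \<in> orb" using relators_orb by blast
  obtain T t where T: "T \<in> modules QA IA" "A.zero_arrows T" "fhom QA E T t" "fsurj QA E T t" "rad_ker QA E t"
    by (rule A.top_exists[OF E])
  let ?L = "syzygy QC IC (extA T)"
  note T' = ext_module[OF T(1)]
  have "riso QB (resB ?K) (resB ?L)" by (rule syz_top_B[OF E T(1,3-5) sK C.is_syz_syzygy[OF T']])
  then have "riso QC (extB (resB ?K)) (extB (resB ?L))" by (rule F.riso_ext[OF B.modules_dims[OF mB]])
  moreover have "frag_of (extB (resB ?L)) \<in> orb"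
    using F.semisimple_orb[OF T' zero_arrows_ext[OF T(2)]] by (simp only: flip_defs)
  ultimately have 3: "frag_of (extB (resB ?K)) \<in> orb"
    by (rule C.span0_iso_mem[OF F.ext_module[OF mB] F.ext_module[OF F.res_module[OF C.syzygy_module[OF T']]]
          _ asub_orb relators_orb])
  from asub_add[OF asub_orb asub_add[OF asub_orb 1 2] 3] show ?thesis by (simp add: algebra_simps)
qed

text \<open>For Z in the orbit over A, the syzygy over A is in the orbit as well, and the syzygy
  over C differs from it by an element of the orbit subgroup.\<close>

lemma orbA_syz:
  assumes "M \<in> orbA"
  shows "frag_of (syzygy QC IC M) \<in> orb"
proof -
  obtain Z k where Z: "M = extA Z" "Z \<in> modules QA IA"
    and r: "A.retract Z ((syzygy QA IA ^^ k) (resA (syzygy QC IC C0)))"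
    using assms unfolding orbA_def by blast
  have N: "(syzygy QA IA ^^ k) (resA (syzygy QC IC C0)) \<in> modules QA IA"
    by (rule A.syzygy_pow_module[OF res_module[OF C.syzygy_module[OF C0]]])
  have "A.retract (syzygy QA IA Z) ((syzygy QA IA ^^ Suc k) (resA (syzygy QC IC C0)))"
    using A.syz_retract[OF Z(2) N r A.is_syz_syzygy[OF Z(2)] A.is_syz_syzygy[OF N]] by simp
  then have "extA (syzygy QA IA Z) \<in> orbA" unfolding orbA_def using A.syzygy_module[OF Z(2)] by blast
  from asub_add[OF asub_orb syz_ext_class[OF Z(2)] orbA_orb[OF this]] show ?thesis by (simp add: Z(1))
qed

lemma Om_orb:
  assumes "x \<in> orb"
  shows "C.Om x \<in> orb"
  using assms unfolding orb_def C.span0_def C.Om_def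
proof (rule frag_extend_agen)
  interpret F: morita_orbit QB QA QC IB IA IC c_ba c_ab C0 by (rule flip_orbit)
  fix b assume "b \<in> frag_of ` (orbA \<union> orbB) \<union> C.relators"
  then consider M where "b = frag_of M" "M \<in> orbA" | M where "b = frag_of M" "M \<in> orbB" | "b \<in> C.relators" by blast
  then have "C.Om b \<in> orb"
  proof cases
    case 1
    then show ?thesis using orbA_syz by (simp add: C.Om_def)
  next
    case 2
    then show ?thesis using F.orbA_syz unfolding flip_defs by (simp add: C.Om_def)
  next
    case 3
    then show ?thesis using C.Om_relators[OF agen.base] relators_orb by blast
  qed
  then show "frag_extend (\<lambda>M. frag_of (syzygy QC IC M)) b \<in> agen (frag_of ` (orbA \<union> orbB) \<union> C.relators)"
    unfolding orb_def C.span0_def C.Om_def .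
qed simp

text \<open>The error made in each step is in the orbit subgroup, and it stays there under further
  syzygies.\<close>

lemma Om_pow_ext:
  assumes E: "E \<in> modules QA IA"
  shows "(C.Om ^^ n) (frag_of (extA E)) - frag_of (extA ((syzygy QA IA ^^ n) E)) \<in> orb"
proof (induction n)
  case 0
  show ?case using asubD(1)[OF asub_orb] by simp
next
  case (Suc n)
  let ?E = "(syzygy QA IA ^^ n) E"
  have "C.Om ((C.Om ^^ n) (frag_of (extA E)) - frag_of (extA ?E)) \<in> orb" by (rule Om_orb[OF Suc])
  from asub_add[OF asub_orb this syz_ext_class[OF A.syzygy_pow_module[OF E, of n]]]
  show ?case by (simp add: C.Om_def frag_extend_diff)
qed

text \<open>The class of the extension of \<open>\<Omega>\<^sub>A E\<close> depends additively on
  the class of E in the stable group of A: a projective E contributes zero. The class of the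
  extension of E itself does not have this property. This is why one syzygy more than n is
  taken.\<close>

lemma ext_syz_finite:
  assumes fin: "\<And>E. E \<in> modules QA IA \<Longrightarrow> frag_of ((syzygy QA IA ^^ n) E) \<in> A.span0 S"
    and m: "Suc n \<le> m" and E: "E \<in> modules QA IA"
  shows "frag_of (extA ((syzygy QA IA ^^ m) E)) \<in> C.span0 ((\<lambda>M. extA (syzygy QA IA M)) ` S)"
    (is "_ \<in> ?H")
proof -
  let ?g = "\<lambda>M. frag_of (extA (syzygy QA IA M))"
  obtain j where j: "m = Suc n + j" using m le_Suc_ex by blast
  let ?E = "(syzygy QA IA ^^ j) E"
  have "frag_extend ?g (frag_of ((syzygy QA IA ^^ n) ?E)) \<in> ?H"
  proof (rule frag_extend_agen[OF fin[OF A.syzygy_pow_module[OF E], unfolded A.span0_def]])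
    fix b assume "b \<in> frag_of ` S \<union> A.relators"
    then consider M where "b = frag_of M" "M \<in> S"
      | M M' M'' where "b = frag_of M - (frag_of M' + frag_of M'')"
      "M \<in> modules QA IA" "M' \<in> modules QA IA" "M'' \<in> modules QA IA" "isomorphic QA M (dsum QA M' M'')"
      | P where "b = frag_of P" "projective QA IA P"
      unfolding A.relators_def by blast
    then show "frag_extend ?g b \<in> ?H"
    proof cases
      case 1
      then show ?thesis by (auto intro: C.span0_base)
    next
      case 2
      have "isum QA M M' M''" using 2(5) A.isomorphic_dsum_iff[OF 2(2-4)[THEN A.modules_dims]] by simp
      from A.syz_additive[OF 2(2) this A.is_syz_syzygy[OF 2(2)] A.is_syz_syzygy[OF 2(3)] A.is_syz_syzygy[OF 2(4)]]
      have "isum QC (extA (syzygy QA IA M)) (extA (syzygy QA IA M')) (extA (syzygy QA IA M''))" by (rule isum_ext)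
      from C.span0_isum[OF 2(2-4)[THEN A.syzygy_module, THEN ext_module] this]
      show ?thesis unfolding 2(1) using C.span0_relators by (simp add: frag_extend_diff frag_extend_add subset_iff)
    next
      case 3
      then have P: "fproj QA IA P" by (simp add: A.projective_iff)
      note PM = fprojD(1)[OF P]
      have "riso QA (syzygy QA IA P) zero_rep"
        by (rule A.syz_unique[OF A.is_syz_syzygy[OF PM] A.syz_projective[OF P] A.iso_refl])
      from riso_zero_ext[OF A.syzygy_module[OF PM] this] show ?thesis
        unfolding 3(1) using C.span0_relators by auto
    qed
  qed simp
  then show ?thesis unfolding j by (simp add: funpow_add)
qed

text \<open>One syzygy splits M into an A-part and a B-part, and k further ones bring both parts
  into the finitely generated subgroups, up to elements of the orbit subgroup.\<close>

lemma syzygy_finite_C: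
  assumes A: "syzygy_finite QA IA" and B: "syzygy_finite QB IB"
    and orb: "finite S0" "S0 \<subseteq> modules QC IC" "orb \<subseteq> C.span0 S0"
  shows "syzygy_finite QC IC"
proof -
  interpret F: morita_orbit QB QA QC IB IA IC c_ba c_ab C0 by (rule flip_orbit)
  obtain nA SA where SA: "finite SA" "SA \<subseteq> modules QA IA"
    "\<And>E. E \<in> modules QA IA \<Longrightarrow> frag_of ((syzygy QA IA ^^ nA) E) \<in> A.span0 SA"
    using A unfolding A.syzygy_finite_iff by blast
  obtain nB SB where SB: "finite SB" "SB \<subseteq> modules QB IB"
    "\<And>E. E \<in> modules QB IB \<Longrightarrow> frag_of ((syzygy QB IB ^^ nB) E) \<in> B.span0 SB"
    using B unfolding B.syzygy_finite_iff by blast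
  let ?SA = "(\<lambda>M. extA (syzygy QA IA M)) ` SA" and ?SB = "(\<lambda>M. extB (syzygy QB IB M)) ` SB"
  let ?S = "?SA \<union> ?SB \<union> S0"
  define k where "k = max (Suc nA) (Suc nB)"
  have kA: "Suc nA \<le> k" and kB: "Suc nB \<le> k" by (simp_all add: k_def)
  have fin: "finite ?S" using SA(1) SB(1) orb(1) by simp
  have "?SA \<subseteq> modules QC IC"
    by (intro image_subsetI ext_module A.syzygy_module) (rule subsetD[OF SA(2)])
  moreover have "?SB \<subseteq> modules QC IC"
    by (intro image_subsetI F.ext_module B.syzygy_module) (rule subsetD[OF SB(2)])
  ultimately have sub: "?S \<subseteq> modules QC IC" using orb(2) by simp
  have sA: "C.span0 ?SA \<subseteq> C.span0 ?S" and sB: "C.span0 ?SB \<subseteq> C.span0 ?S" and s0: "C.span0 S0 \<subseteq> C.span0 ?S"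
    by (rule C.span0_mono; blast)+
  have o: "orb \<subseteq> C.span0 ?S" using orb(3) s0 by (rule order.trans)
  have "frag_of ((syzygy QC IC ^^ Suc k) M) \<in> C.span0 ?S" if M: "M \<in> modules QC IC" for M
  proof -
    let ?K = "syzygy QC IC M"
    note K = C.syzygy_module[OF M]
    note mA = res_module[OF K] and mB = F.res_module[OF K]
    let ?a = "frag_of (extA (resA ?K))" and ?b = "frag_of (extB (resB ?K))"
    have pow_rel: "(C.Om ^^ k) r \<in> agen C.relators" if "r \<in> agen C.relators" for r
      using that by (induction k) (simp_all add: C.Om_relators)
    have "frag_of ?K - (?a + ?b) \<in> agen C.relators"
      by (rule C.span0_isum[OF K ext_module[OF mA] F.ext_module[OF mB] syz_isum[OF C.is_syz_syzygy[OF M]]])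
    then have "(C.Om ^^ k) (frag_of ?K - ?a - ?b) \<in> agen C.relators" using pow_rel by (simp add: diff_diff_add)
    then have 1: "frag_of ((syzygy QC IC ^^ k) ?K) - (C.Om ^^ k) ?a - (C.Om ^^ k) ?b \<in> C.span0 ?S"
      unfolding C.Om_pow_diff C.Om_pow_frag using C.span0_relators by blast
    have 2: "(C.Om ^^ k) ?a \<in> C.span0 ?S"
    proof -
      have "(C.Om ^^ k) ?a - frag_of (extA ((syzygy QA IA ^^ k) (resA ?K))) \<in> C.span0 ?S"
        using Om_pow_ext[OF mA] o by blast
      from asub_add[OF C.asub_span0 this, of "frag_of (extA ((syzygy QA IA ^^ k) (resA ?K)))"]
      show ?thesis
        using subsetD[OF sA ext_syz_finite[OF SA(3) kA mA]] by simp
    qed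
    have 3: "(C.Om ^^ k) ?b \<in> C.span0 ?S"
    proof -
      have "(C.Om ^^ k) ?b - frag_of (extB ((syzygy QB IB ^^ k) (resB ?K))) \<in> C.span0 ?S"
        using F.Om_pow_ext[OF mB] o unfolding flip_defs by blast
      from asub_add[OF C.asub_span0 this, of "frag_of (extB ((syzygy QB IB ^^ k) (resB ?K)))"]
      show ?thesis
        using subsetD[OF sB F.ext_syz_finite[OF SB(3) kB mB]] by simp
    qed
    have "frag_of ((syzygy QC IC ^^ k) ?K) \<in> C.span0 ?S"
      using asub_add[OF C.asub_span0 asub_add[OF C.asub_span0 1 3] 2] by simp
    then show ?thesis by (simp only: funpow_Suc_right comp_apply)
  qed
  then show ?thesis unfolding C.syzygy_finite_iff using fin sub by (intro exI[of _ "Suc k"] exI[of _ ?S] conjI ballI)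
qed

text \<open>Restriction maps the relations of the stable group of C into the subgroup generated by
  the relations for A and the A-parts of the syzygies of the simple modules. Applied to the class of
  the extension of an n-th syzygy over A, which is the n-th syzygy over C up to the orbit subgroup,
  it returns the n-th syzygy over A.\<close>

lemma syzygy_finite_A:
  assumes C: "syzygy_finite QC IC" and orb: "finite S0" "S0 \<subseteq> modules QC IC" "orb \<subseteq> C.span0 S0"
  shows "syzygy_finite QA IA"
proof -
  obtain n S where S: "finite S" "S \<subseteq> modules QC IC"
    "\<And>M. M \<in> modules QC IC \<Longrightarrow> frag_of ((syzygy QC IC ^^ n) M) \<in> C.span0 S"
    using C unfolding C.syzygy_finite_iff by blast
  let ?D = "(\<lambda>v. resA (syzygy QC IC (C.simple_at v))) ` verts QC"
  let ?S = "resA ` (S \<union> S0) \<union> ?D"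
  let ?H = "A.span0 ?S"
  have fin: "finite ?S" using S(1) orb(1) by simp
  have "?D \<subseteq> modules QA IA" by (intro image_subsetI res_module C.syzygy_module C.simple_at_module)
  moreover have "resA ` (S \<union> S0) \<subseteq> modules QA IA"
    by (intro image_subsetI res_module) (use S(2) orb(2) in blast)
  ultimately have sub: "?S \<subseteq> modules QA IA" by (intro Un_least)
  have sS: "C.span0 S \<subseteq> C.span0 (S \<union> S0)" and s0: "C.span0 S0 \<subseteq> C.span0 (S \<union> S0)"
    by (rule C.span0_mono; blast)+
  have psi: "frag_extend (\<lambda>M. frag_of (resA M)) x \<in> ?H" if "x \<in> C.span0 (S \<union> S0)" for x
    using that unfolding C.span0_def
  proof (rule frag_extend_agen)
    fix b assume "b \<in> frag_of ` (S \<union> S0) \<union> C.relators"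
    then consider M where "b = frag_of M" "M \<in> S \<union> S0"
      | M M' M'' where "b = frag_of M - (frag_of M' + frag_of M'')"
      "M \<in> modules QC IC" "M' \<in> modules QC IC" "M'' \<in> modules QC IC" "isomorphic QC M (dsum QC M' M'')"
      | P where "b = frag_of P" "projective QC IC P"
      unfolding C.relators_def by blast
    then show "frag_extend (\<lambda>M. frag_of (resA M)) b \<in> ?H"
    proof cases
      case 1
      then show ?thesis by (auto intro: A.span0_base)
    next
      case 2
      have "isum QC M M' M''" using 2(5) C.isomorphic_dsum_iff[OF 2(2-4)[THEN C.modules_dims]] by simp
      from A.span0_isum[OF 2(2-4)[THEN res_module] isum_res[OF this]]
      show ?thesis unfolding 2(1) using A.span0_relators by (simp add: frag_extend_diff frag_extend_add subset_iff)
    next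
      case 3
      then have "fproj QC IC P" by (simp add: C.projective_iff)
      then have "frag_of (resA P) \<in> ?H"
        by (rule res_projective[OF _ A.asub_span0 A.span0_relators]) (intro A.span0_base UnI2 imageI)
      then show ?thesis unfolding 3(1) by simp
    qed
  qed simp
  have "frag_of ((syzygy QA IA ^^ n) E) \<in> ?H" if E: "E \<in> modules QA IA" for E
  proof -
    let ?E = "(syzygy QA IA ^^ n) E"
    have mE: "?E \<in> modules QA IA" by (rule A.syzygy_pow_module[OF E])
    have 1: "frag_of ((syzygy QC IC ^^ n) (extA E)) \<in> C.span0 (S \<union> S0)" using S(3)[OF ext_module[OF E]] sS by blast
    have 2: "frag_of ((syzygy QC IC ^^ n) (extA E)) - frag_of (extA ?E) \<in> C.span0 (S \<union> S0)"
      using Om_pow_ext[OF E, of n] orb(3) s0 unfolding C.Om_pow_frag by blast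
    from asubD(2)[OF C.asub_span0 1 2] have "frag_of (extA ?E) \<in> C.span0 (S \<union> S0)" by simp
    from psi[OF this] have "frag_of (resA (extA ?E)) \<in> ?H" by simp
    moreover have "riso QA ?E (resA (extA ?E))"
      by (rule A.iso_sym[OF dims_res[OF dims_ext[OF A.modules_dims[OF mE]]] riso_res_ext])
    ultimately show ?thesis
      by (intro A.span0_iso_mem[OF mE res_module[OF ext_module[OF mE]] _ A.asub_span0 A.span0_relators])
  qed
  then show ?thesis unfolding A.syzygy_finite_iff using fin sub by (intro exI[of _ n] exI[of _ ?S] conjI ballI)
qed

end

lemma (in bound_quiver_algebra) retract_add_class:
  assumes Z: "Z \<in> modules Q I" and Y: "Y \<in> modules Q I" "Y \<in> \<C>" and r: "retract Z Y"
  shows "Z \<in> add_class Q I \<C>"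
proof -
  note d = modules_dims[OF Z] modules_dims[OF zero_rep_module]
  have "biprod Q Z Z zero_rep (\<lambda>v x. x) (\<lambda>v x. 0) (\<lambda>v x. x) (\<lambda>v x. 0)"
    by (rule biprodI) (auto intro!: fhomI simp: lin_id lin_zero lin_0[OF lin_act])
  then have "isum Q Z Z zero_rep" unfolding isum_def by (intro exI)
  then have "isomorphic Q Z (dsum_list Q [Z])"
    using isomorphic_dsum_iff[OF d(1) d] by (simp add: dsum_list_def)
  moreover have "is_summand Q I Z Y" using is_summand_iff[OF Y(1)] Z r by simp
  ultimately show ?thesis
    unfolding add_class_def using Z Y(2) by (intro CollectI conjI exI[of _ "[Z]"]) auto
qed

lemma (in morita_orbit) orbA_orbit_subgroup:
  assumes "M \<in> orbA"
  shows "M \<in> modules QC IC" "K0_class QC IC M \<in> orbit_subgroup QC IC QA IA QB IB C0"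
proof -
  obtain Z k where Z: "M = extA Z" "Z \<in> modules QA IA"
    and r: "A.retract Z ((syzygy QA IA ^^ k) (resA (syzygy QC IC C0)))"
    using assms unfolding orbA_def by blast
  show "M \<in> modules QC IC" unfolding Z(1) by (rule ext_module[OF Z(2)])
  have "Z \<in> add_class QA IA (syzygy_orbit QA IA (resA (syzygy QC IC C0)))"
    by (rule A.retract_add_class[OF Z(2) A.syzygy_pow_module[OF res_module[OF C.syzygy_module[OF C0]]] _ r])
       (simp add: syzygy_orbit_def)
  then show "K0_class QC IC M \<in> orbit_subgroup QC IC QA IA QB IB C0"
    unfolding Z(1) orbit_subgroup_def by (intro generate.incl UnI1 imageI)
qed

lemma orbit_subgroup_commute: "orbit_subgroup QC IC QA IA QB IB C0 = orbit_subgroup QC IC QB IB QA IA C0"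
  unfolding orbit_subgroup_def by (simp only: Un_commute)

theorem proposition3p1:
  fixes QA QB QC :: "('v, 'e) pre_digraph"
    and IA IB IC :: "(('v, 'e) path \<Rightarrow>\<^sub>0 'k::field) set"
    and \<alpha>s \<beta>s :: "'e set"
    and Ss :: "('v, 'e, 'k) rep list"
  assumes A: "bound_quiver QA IA"
    and B: "bound_quiver QB IB"
    and C: "bound_quiver QC IC"
    and sub: "subquiver QA QC" "subquiver QB QC"
    and morita_context: "IC \<inter> carrier (path_algebra QA) = IA" "IC \<inter> carrier (path_algebra QB) = IB"
    and vertices: "verts QC = verts QA \<union> verts QB" "verts QA \<inter> verts QB = {}"
    and arrows: "arcs QC = arcs QA \<union> arcs QB \<union> \<alpha>s \<union> \<beta>s"
      "arcs QA \<inter> arcs QB = {}" "(arcs QA \<union> arcs QB) \<inter> (\<alpha>s \<union> \<beta>s) = {}" "\<alpha>s \<inter> \<beta>s = {}"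
    and \<alpha>s: "\<forall>a\<in>\<alpha>s. tail QC a \<in> verts QA \<and> head QC a \<in> verts QB"
    and \<beta>s: "\<forall>b\<in>\<beta>s. tail QC b \<in> verts QB \<and> head QC b \<in> verts QA"
    and relations:
      "Idl\<^bsub>path_algebra QC\<^esub> (IA \<union> IB
         \<union> {arrow QC a \<otimes>\<^bsub>path_algebra QC\<^esub> arrow QC \<alpha>j | a \<alpha>j. a \<in> arcs QA \<and> \<alpha>j \<in> \<alpha>s}
         \<union> {arrow QC b \<otimes>\<^bsub>path_algebra QC\<^esub> arrow QC \<beta>k | b \<beta>k. b \<in> arcs QB \<and> \<beta>k \<in> \<beta>s}
         \<union> {arrow QC \<alpha>j \<otimes>\<^bsub>path_algebra QC\<^esub> arrow QC \<beta>k | \<alpha>j \<beta>k. \<alpha>j \<in> \<alpha>s \<and> \<beta>k \<in> \<beta>s}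
         \<union> {arrow QC \<beta>k \<otimes>\<^bsub>path_algebra QC\<^esub> arrow QC \<alpha>j | \<alpha>j \<beta>k. \<alpha>j \<in> \<alpha>s \<and> \<beta>k \<in> \<beta>s}) \<subseteq> IC"
    and simples: "complete_simples QC IC Ss"
    and orbits: "fin_gen_subgroup (K0 QC IC)
      (orbit_subgroup QC IC QA IA QB IB (dsum_list QC Ss))"
  shows "syzygy_finite QC IC \<longleftrightarrow> syzygy_finite QA IA \<and> syzygy_finite QB IB"
proof -
  let ?C0 = "dsum_list QC Ss"
  interpret A: bound_quiver_algebra QA IA by unfold_locales (rule A)
  interpret B: bound_quiver_algebra QB IB by unfold_locales (rule B)
  interpret C: bound_quiver_algebra QC IC by unfold_locales (rule C)
  note gens = relations[unfolded genideal_def]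
  interpret morita QA QB QC IA IB IC \<alpha>s \<beta>s
  proof unfold_locales
    show "arrow QC a \<otimes>\<^bsub>C.kQ\<^esub> arrow QC b \<in> IC" if "a \<in> arcs QA \<union> \<beta>s" "b \<in> \<alpha>s" for a b
      using that by (intro subsetD[OF gens]) blast
    show "arrow QC a \<otimes>\<^bsub>C.kQ\<^esub> arrow QC b \<in> IC" if "a \<in> arcs QB \<union> \<alpha>s" "b \<in> \<beta>s" for a b
      using that by (intro subsetD[OF gens]) blast
  qed (use sub morita_context vertices arrows(1) \<alpha>s \<beta>s in auto)
  have Ss: "S \<in> modules QC IC" if "S \<in> set Ss" for S
    using simples that by (simp add: complete_simples_def simple_def)
  interpret morita_orbit QA QB QC IA IB IC \<alpha>s \<beta>s ?C0
  proof unfold_locales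
    show C0: "?C0 \<in> modules QC IC" by (rule C.retract_dsum_list(1)[OF Ss])
    fix v assume "v \<in> verts QC"
    then obtain T where T: "T \<in> set Ss" "isomorphic QC (C.simple_at v) T"
      using simples C.simple_at_simple unfolding complete_simples_def by blast
    note d = C.modules_dims[OF C.simple_at_module, of v] C.modules_dims[OF Ss[OF T(1)]]
    have "C.retract (C.simple_at v) T"
      by (rule C.riso_retract[OF d(1)]) (use T(2) C.isomorphic_iff_iso[OF d] in simp)
    then show "C.retract (C.simple_at v) ?C0"
      by (rule C.retract_trans[OF d(2) _ C.retract_dsum_list(2)[OF Ss T(1)]])
  qed
  interpret F: morita_orbit QB QA QC IB IA IC \<beta>s \<alpha>s ?C0 by (rule flip_orbit)
  obtain S0 where S0: "finite S0" "S0 \<subseteq> modules QC IC"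
    "\<And>x. x \<in> carrier C.FM \<Longrightarrow> C.cls x \<in> orbit_subgroup QC IC QA IA QB IB ?C0 \<Longrightarrow> x \<in> C.span0 S0"
    using C.fin_gen_subgroupD[OF orbits] by blast
  have "orb \<subseteq> C.span0 S0"
    unfolding orb_def
  proof (rule C.span0_least[OF C.asub_span0 C.span0_relators])
    fix M assume "M \<in> orbA \<union> orbB"
    then have "M \<in> modules QC IC \<and> K0_class QC IC M \<in> orbit_subgroup QC IC QA IA QB IB ?C0"
      using orbA_orbit_subgroup F.orbA_orbit_subgroup unfolding flip_defs
        orbit_subgroup_commute[of QC IC QB] by blast
    then show "frag_of M \<in> C.span0 S0" by (intro S0(3)) (simp_all add: C.K0_class_cls)
  qed
  note orb = S0(1,2) this
  show ?thesis
  proof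
    assume fin: "syzygy_finite QC IC"
    have "orb = F.orb" by (simp only: flip_defs)
    then show "syzygy_finite QA IA \<and> syzygy_finite QB IB"
      using syzygy_finite_A[OF fin orb] F.syzygy_finite_A[OF fin S0(1,2)] orb(3) by simp
  next
    assume "syzygy_finite QA IA \<and> syzygy_finite QB IB"
    then show "syzygy_finite QC IC" using syzygy_finite_C orb by blast
  qed
qed

end
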